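(* There is an absolute constant $C$ and an algorithm running in time polynomial in $n$ and $|\mathcal{S}|$ (given a rank oracle for the matroid) which, given an instance of the matroid-basis optimal search problem with a matroid of rank $k\ge 2$, computes a (possibly randomized) partially-adaptive strategy whose expected total cost is at most $C\log k$ times the minimum expected total cost of any partially-adaptive strategy.
   Context: Matroid-basis optimal search (unit probing times). There are $n$ boxes $\mathcal{B}=\{1,\dots,n\}$, a matroid on ground set $\mathcal{B}$ of rank $k$ (accessed via its rank function $r$), and a finite list $\mathcal{S}$ of scenarios; the true scenario $s$ is drawn uniformly at random from $\mathcal{S}$ and is unknown. In scenario $s$, box $i$ has cost $c_{is}\ge0$. Probing a box takes one unit of time and reveals its cost. A strategy probes boxes, then stops and selects a set of probed boxes forming a basis of the matroid; its total cost is the number of probes plus the sum of the costs of the selected boxes, evaluated in expectation. A partially-adaptive strategy probes boxes in a fixed order that does not depend on observed costs, but may decide when to stop based on the costs observed so far. *)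

theory Defs
  imports "HOL-Probability.Probability_Mass_Function"
begin

section \<open>Matroids\<close>

locale matroid =
  fixes carrier :: "'a set" and indep :: "'a set \<Rightarrow> bool"
  assumes finite_carrier: "finite carrier"
    and indep_subset_carrier: "indep X \<Longrightarrow> X \<subseteq> carrier"
    and indep_empty: "indep {}"
    and indep_subset: "indep X \<Longrightarrow> Y \<subseteq> X \<Longrightarrow> indep Y"
    and augment: "indep X \<Longrightarrow> indep Y \<Longrightarrow> card X < card Y \<Longrightarrow> \<exists>y\<in>Y - X. indep (insert y X)"

definition matroid_basis :: "('a set \<Rightarrow> bool) \<Rightarrow> 'a set \<Rightarrow> bool" where
  "matroid_basis indep B \<longleftrightarrow> indep B \<and> (\<forall>X. indep X \<longrightarrow> B \<subseteq> X \<longrightarrow> X = B)"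

definition matroid_rank :: "('a set \<Rightarrow> bool) \<Rightarrow> 'a set \<Rightarrow> nat" where
  "matroid_rank indep X = Max {card Y |Y. Y \<subseteq> X \<and> indep Y}"


section \<open>Matroid-basis optimal search\<close>

text \<open>A scenario is its cost function; \<open>scenarios\<close> is a list because repetitions carry
  probability mass.\<close>

record search_instance =
  num_boxes :: nat
  indep_sets :: "nat set \<Rightarrow> bool"
  scenarios :: "(nat \<Rightarrow> real) list"

definition boxes :: "search_instance \<Rightarrow> nat set" where
  "boxes I = {1..num_boxes I}"

definition num_scenarios :: "search_instance \<Rightarrow> nat" where
  "num_scenarios I = length (scenarios I)"

definition box_cost :: "search_instance \<Rightarrow> nat \<Rightarrow> nat \<Rightarrow> real" where
  "box_cost I i s = (scenarios I ! s) i"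

definition rank_oracle :: "search_instance \<Rightarrow> nat set \<Rightarrow> nat" where
  "rank_oracle I X = matroid_rank (indep_sets I) (X \<inter> boxes I)"

definition instance_rank :: "search_instance \<Rightarrow> nat" where
  "instance_rank I = matroid_rank (indep_sets I) (boxes I)"

definition search_problem :: "search_instance \<Rightarrow> bool" where
  "search_problem I \<longleftrightarrow> matroid (boxes I) (indep_sets I) \<and> scenarios I \<noteq> [] \<and>
     (\<forall>s<num_scenarios I. \<forall>i\<in>boxes I. 0 \<le> box_cost I i s)"


section \<open>Partially-adaptive strategies\<close>

text \<open>The decision rule sees the costs observed so far, in probing order. It answers \<open>None\<close> to
  continue and \<open>Some B\<close> to stop and select \<open>B\<close>. The order does not depend on the observations.\<close>

record strategy =
  probe_order :: "nat list"
  decide :: "real list \<Rightarrow> nat set option"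

definition observed :: "search_instance \<Rightarrow> nat list \<Rightarrow> nat \<Rightarrow> nat \<Rightarrow> real list" where
  "observed I xs s t = map (\<lambda>i. box_cost I i s) (take t xs)"

definition decision_at :: "search_instance \<Rightarrow> strategy \<Rightarrow> nat \<Rightarrow> nat \<Rightarrow> nat set option" where
  "decision_at I \<pi> s t = decide \<pi> (observed I (probe_order \<pi>) s t)"

definition stop_time :: "search_instance \<Rightarrow> strategy \<Rightarrow> nat \<Rightarrow> nat" where
  "stop_time I \<pi> s = (LEAST t. decision_at I \<pi> s t \<noteq> None)"

definition selected :: "search_instance \<Rightarrow> strategy \<Rightarrow> nat \<Rightarrow> nat set" where
  "selected I \<pi> s = the (decision_at I \<pi> s (stop_time I \<pi> s))"

definition pa_strategies :: "search_instance \<Rightarrow> strategy set" where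
  "pa_strategies I = {\<pi>.
     distinct (probe_order \<pi>) \<and> set (probe_order \<pi>) = boxes I \<and>
     (\<forall>s<num_scenarios I.
        (\<exists>t\<le>num_boxes I. decision_at I \<pi> s t \<noteq> None) \<and>
        selected I \<pi> s \<subseteq> set (take (stop_time I \<pi> s) (probe_order \<pi>)) \<and>
        matroid_basis (indep_sets I) (selected I \<pi> s))}"

definition total_cost :: "search_instance \<Rightarrow> strategy \<Rightarrow> nat \<Rightarrow> real" where
  "total_cost I \<pi> s = real (stop_time I \<pi> s) + (\<Sum>i\<in>selected I \<pi> s. box_cost I i s)"

definition scenario_average_cost :: "search_instance \<Rightarrow> strategy \<Rightarrow> real" where
  "scenario_average_cost I \<pi> =
     (\<Sum>s<num_scenarios I. total_cost I \<pi> s) / real (num_scenarios I)"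

text \<open>Randomized strategies are distributions over deterministic ones, drawn independently of the
  true scenario. A deterministic strategy \<open>\<pi>\<close> is \<open>return_pmf \<pi>\<close>.\<close>

definition randomized_pa_strategies :: "search_instance \<Rightarrow> strategy pmf set" where
  "randomized_pa_strategies I = {Q. set_pmf Q \<subseteq> pa_strategies I}"

definition expected_total_cost :: "search_instance \<Rightarrow> strategy pmf \<Rightarrow> real" where
  "expected_total_cost I Q = measure_pmf.expectation Q (scenario_average_cost I)"

definition pa_opt :: "search_instance \<Rightarrow> real" where
  "pa_opt I = (INF Q\<in>randomized_pa_strategies I. expected_total_cost I Q)"


section \<open>Randomized oracle algorithms and their running time\<close>

text \<open>The model is a random access machine, presented as a while language, whose memory consists
  of named two-dimensional arrays of naturals and of reals. A command takes one step per
  assignment, test, coin flip or oracle call; expressions have a size fixed by the program.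

  Multiplication and rounding of reals are deliberately absent, as is multiplication of naturals.
  With unit-cost addition, (truncated) subtraction and comparison alone, \<open>T\<close> steps add only
  \<open>O(T)\<close> bits to the length of any number, so that the step count is polynomially related to Turing
  machine time; with further operations at unit cost it need not be. The only constants are
  naturals, so that no information can be hidden in a program's real constants.\<close>

type_synonym array_name = string

datatype nexp =
    Const nat
  | NGet array_name nexp nexp
  | NPlus nexp nexp
  | NMinus nexp nexp

datatype rexp =
    OfNat nexp
  | RGet array_name nexp nexp
  | RPlus rexp rexp
  | RMinus rexp rexp

datatype bexp =
    NLess nexp nexp
  | RLess rexp rexp
  | Neg bexp
  | Conj bexp bexp

datatype com =
    Skip
  | NSet array_name nexp nexp nexp
  | RSet array_name nexp nexp rexp
  | Flip array_name nexp nexp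
  | Query array_name nexp nexp array_name nexp
  | Seq com com
  | Cond bexp com com
  | While bexp com

record memory =
  nmem :: "array_name \<Rightarrow> nat \<Rightarrow> nat \<Rightarrow> nat"
  rmem :: "array_name \<Rightarrow> nat \<Rightarrow> nat \<Rightarrow> real"

fun nval :: "nexp \<Rightarrow> memory \<Rightarrow> nat" where
  "nval (Const k) \<sigma> = k"
| "nval (NGet a e1 e2) \<sigma> = nmem \<sigma> a (nval e1 \<sigma>) (nval e2 \<sigma>)"
| "nval (NPlus e1 e2) \<sigma> = nval e1 \<sigma> + nval e2 \<sigma>"
| "nval (NMinus e1 e2) \<sigma> = nval e1 \<sigma> - nval e2 \<sigma>"

fun rval :: "rexp \<Rightarrow> memory \<Rightarrow> real" where
  "rval (OfNat e) \<sigma> = real (nval e \<sigma>)"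
| "rval (RGet a e1 e2) \<sigma> = rmem \<sigma> a (nval e1 \<sigma>) (nval e2 \<sigma>)"
| "rval (RPlus e1 e2) \<sigma> = rval e1 \<sigma> + rval e2 \<sigma>"
| "rval (RMinus e1 e2) \<sigma> = rval e1 \<sigma> - rval e2 \<sigma>"

fun bval :: "bexp \<Rightarrow> memory \<Rightarrow> bool" where
  "bval (NLess e1 e2) \<sigma> \<longleftrightarrow> nval e1 \<sigma> < nval e2 \<sigma>"
| "bval (RLess e1 e2) \<sigma> \<longleftrightarrow> rval e1 \<sigma> < rval e2 \<sigma>"
| "bval (Neg b) \<sigma> \<longleftrightarrow> \<not> bval b \<sigma>"
| "bval (Conj b1 b2) \<sigma> \<longleftrightarrow> bval b1 \<sigma> \<and> bval b2 \<sigma>"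

definition nwrite :: "array_name \<Rightarrow> nat \<Rightarrow> nat \<Rightarrow> nat \<Rightarrow> memory \<Rightarrow> memory" where
  "nwrite a i j v \<sigma> = \<sigma>\<lparr>nmem := (nmem \<sigma>)(a := (nmem \<sigma> a)(i := (nmem \<sigma> a i)(j := v)))\<rparr>"

definition rwrite :: "array_name \<Rightarrow> nat \<Rightarrow> nat \<Rightarrow> real \<Rightarrow> memory \<Rightarrow> memory" where
  "rwrite a i j v \<sigma> = \<sigma>\<lparr>rmem := (rmem \<sigma>)(a := (rmem \<sigma> a)(i := (rmem \<sigma> a i)(j := v)))\<rparr>"

text \<open>\<open>Query a e1 e2 q e\<close> writes to \<open>a[e1,e2]\<close> the oracle's answer for the set of column indices at
  which row \<open>e\<close> of \<open>q\<close> is nonzero.\<close>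

fun step :: "(nat set \<Rightarrow> nat) \<Rightarrow> com \<Rightarrow> memory \<Rightarrow> (com \<times> memory) pmf" where
  "step r Skip \<sigma> = return_pmf (Skip, \<sigma>)"
| "step r (NSet a e1 e2 e) \<sigma> =
     return_pmf (Skip, nwrite a (nval e1 \<sigma>) (nval e2 \<sigma>) (nval e \<sigma>) \<sigma>)"
| "step r (RSet a e1 e2 e) \<sigma> =
     return_pmf (Skip, rwrite a (nval e1 \<sigma>) (nval e2 \<sigma>) (rval e \<sigma>) \<sigma>)"
| "step r (Flip a e1 e2) \<sigma> =
     map_pmf (\<lambda>b. (Skip, nwrite a (nval e1 \<sigma>) (nval e2 \<sigma>) (of_bool b) \<sigma>)) (bernoulli_pmf (1/2))"
| "step r (Query a e1 e2 q e) \<sigma> =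
     return_pmf (Skip, nwrite a (nval e1 \<sigma>) (nval e2 \<sigma>) (r {i. nmem \<sigma> q (nval e \<sigma>) i \<noteq> 0}) \<sigma>)"
| "step r (Seq c1 c2) \<sigma> =
     (if c1 = Skip then return_pmf (c2, \<sigma>)
      else map_pmf (\<lambda>(c1', \<sigma>'). (Seq c1' c2, \<sigma>')) (step r c1 \<sigma>))"
| "step r (Cond b c1 c2) \<sigma> = return_pmf (if bval b \<sigma> then c1 else c2, \<sigma>)"
| "step r (While b c) \<sigma> = return_pmf (if bval b \<sigma> then Seq c (While b c) else Skip, \<sigma>)"

fun steps :: "(nat set \<Rightarrow> nat) \<Rightarrow> nat \<Rightarrow> com \<Rightarrow> memory \<Rightarrow> (com \<times> memory) pmf" where
  "steps r 0 c \<sigma> = return_pmf (c, \<sigma>)"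
| "steps r (Suc T) c \<sigma> = bind_pmf (step r c \<sigma>) (\<lambda>(c', \<sigma>'). steps r T c' \<sigma>')"


section \<open>Input and output conventions\<close>

text \<open>The matroid is not part of the initial memory; it is reachable only through \<open>Query\<close>.\<close>

definition input_memory :: "search_instance \<Rightarrow> memory" where
  "input_memory I =
     \<lparr>nmem = (\<lambda>a i j.
        if a = ''boxes'' \<and> i = 0 \<and> j = 0 then num_boxes I
        else if a = ''scenarios'' \<and> i = 0 \<and> j = 0 then num_scenarios I
        else 0),
      rmem = (\<lambda>a i s.
        if a = ''cost'' \<and> i \<in> boxes I \<and> s < num_scenarios I then box_cost I i s else 0)\<rparr>"

text \<open>A strategy is output as a probing order together with a finite decision table that has one
  row per scenario: row \<open>s\<close> says to stop and select the boxes \<open>i\<close> with \<open>select[s,i] \<noteq> 0\<close> when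
  exactly \<open>stop[s,0]\<close> boxes have been probed and their costs are those of scenario \<open>s\<close>. The first
  matching row applies. On cost observations that occur in no scenario the table never stops.\<close>

definition output_strategy :: "search_instance \<Rightarrow> memory \<Rightarrow> strategy" where
  "output_strategy I \<sigma> =
     (let xs = map (\<lambda>j. nmem \<sigma> ''order'' j 0) [0..<num_boxes I] in
      \<lparr>probe_order = xs,
       decide = map_of (map (\<lambda>s. (observed I xs s (nmem \<sigma> ''stop'' s 0),
                                  {i \<in> boxes I. nmem \<sigma> ''select'' s i \<noteq> 0}))
                            [0..<num_scenarios I])\<rparr>)"

text \<open>Within \<open>T\<close> steps the program halts on every sequence of coin flips, and \<open>Q\<close> is the
  distribution, over the coin flips, of the strategy it outputs.\<close>

definition computes_strategy_within ::
    "com \<Rightarrow> search_instance \<Rightarrow> nat \<Rightarrow> strategy pmf \<Rightarrow> bool" where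
  "computes_strategy_within P I T Q \<longleftrightarrow>
     (let R = steps (rank_oracle I) T P (input_memory I) in
      (\<forall>(c, \<sigma>) \<in> set_pmf R. c = Skip) \<and>
      Q = map_pmf (\<lambda>(c, \<sigma>). output_strategy I \<sigma>) R)"

end

theory Submission
  imports Defs
begin

text \<open>
  For a budget \<open>D\<close>, round the costs of a scenario up to multiples of \<open>D / k\<close>. The cost of a cheapest
  basis among a set \<open>S\<close> of boxes is the integral over \<open>\<theta>\<close> of \<open>k\<close> minus the rank of the boxes in \<open>S\<close> of
  cost at most \<open>\<theta>\<close>, so that containing a basis of cost \<open>O(D)\<close> becomes a threshold condition on a sum of
  \<open>k + 1\<close> matroid ranks, an integral monotone submodular function with values \<open>O(k\<^sup>2)\<close>. As for ranking
  with submodular valuations, give a scenario that misses its threshold by \<open>x\<close> the potential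
  \<open>1 + 1/2 + \<dots> + 1/x\<close>, which is at most \<open>H = O(ln k)\<close>. If the first \<open>D\<close> boxes of some order cover an
  uncovered scenario, then one of them lowers its potential by at least \<open>1/D\<close>. Hence \<open>O(D H)\<close> greedy
  probes leave uncovered, besides scenarios that the optimum does not cover by time \<open>D\<close>, at most a
  quarter of those that were uncovered before. Repeating this with \<open>D\<close> running through the powers of
  two gives an order whose cover times are within \<open>O(ln k)\<close> of the optimum.

  Stopping as soon as the cheapest basis found costs no more than the time spent loses only a factor
  of two against the best stopping time in hindsight, as in ski rental, and depends only on the
  observed costs.
\<close>

text \<open>The bound is logarithmic in \<open>k\<close> and not in the number of scenarios because
  no phase has to cover everything. Apart from scenarios that the competitor misses as well, a phase
  divides the number left over by four, which outweighs the doubling of the phase lengths once cover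
  times are summed. The harmonic weights make uncovered scenarios count alike: a gain is divided by
  what the scenario still misses, so that a covering set always accounts for a constant total drop.
  Two obstacles shape the rest. The machine has no products, quotients or logarithms; hence the
  potential is scaled by \<open>k * k\<close> and rounded, costs are compared as
  \<open>k * c\<close> against \<open>l * D\<close>, and the phase factor is found by counting. And
  the output is a table with one row per scenario, so scenarios that look alike must receive the
  same decision. The output is deterministic. A randomized competitor is an average of deterministic
  ones, so it suffices to compare with each of those. The constant 1100 is 11 times 100: summing the
  phases gives 11, and the phase factor plus two is at most \<open>100 * ln k\<close>.\<close>

section \<open>Matroids\<close>

context matroid
begin

abbreviation "rk \<equiv> matroid_rank indep"

lemma indep_finite: "indep X \<Longrightarrow> finite X"
  using indep_subset_carrier finite_carrier finite_subset by blast

lemma finite_indep_cards: "finite {card Y |Y. Y \<subseteq> X \<and> indep Y}"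
proof (rule finite_subset)
  show "{card Y |Y. Y \<subseteq> X \<and> indep Y} \<subseteq> {..card carrier}"
    using card_mono[OF finite_carrier indep_subset_carrier] by auto
qed simp

lemma card_le_rank: "Y \<subseteq> X \<Longrightarrow> indep Y \<Longrightarrow> card Y \<le> rk X"
  unfolding matroid_rank_def by (rule Max_ge[OF finite_indep_cards]) auto

lemma rank_attained: obtains Y where "Y \<subseteq> X" "indep Y" "card Y = rk X"
proof -
  have "rk X \<in> {card Y |Y. Y \<subseteq> X \<and> indep Y}"
    unfolding matroid_rank_def
    by (rule Max_in[OF finite_indep_cards]) (use indep_empty in auto)
  with that show ?thesis by auto
qed

lemma rank_mono: "X \<subseteq> X' \<Longrightarrow> rk X \<le> rk X'"
  by (metis card_le_rank order_trans rank_attained)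

lemma rank_Int_carrier: "rk (X \<inter> carrier) = rk X"
proof -
  have "{card Y |Y. Y \<subseteq> X \<inter> carrier \<and> indep Y} = {card Y |Y. Y \<subseteq> X \<and> indep Y}"
    using indep_subset_carrier by blast
  then show ?thesis by (simp add: matroid_rank_def)
qed

lemma rank_le_rank_carrier: "rk X \<le> rk carrier"
  using rank_mono[of "X \<inter> carrier" carrier] by (simp add: rank_Int_carrier)

lemma rank_le_card: "finite X \<Longrightarrow> rk X \<le> card X"
  by (metis card_mono rank_attained)

lemma extend_to_rank:
  assumes "indep Y" "Y \<subseteq> X"
  obtains Z where "Y \<subseteq> Z" "Z \<subseteq> X" "indep Z" "card Z = rk X"
proof -
  have "\<exists>Z. Y \<subseteq> Z \<and> Z \<subseteq> X \<and> indep Z \<and> card Z = rk X"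
    using assms
  proof (induction "rk X - card Y" arbitrary: Y)
    case 0
    then show ?case using card_le_rank[of Y X] by (metis diff_is_0_eq le_antisym order_refl)
  next
    case (Suc d)
    obtain W where W: "W \<subseteq> X" "indep W" "card W = rk X" using rank_attained by blast
    with Suc have "card Y < card W" by linarith
    then obtain y where y: "y \<in> W - Y" "indep (insert y Y)" using augment Suc.prems W by blast
    have "card (insert y Y) = Suc (card Y)"
      using y Suc.prems indep_finite by (simp add: card_insert_if)
    then have "d = rk X - card (insert y Y)" using Suc(2) by linarith
    from Suc(1)[OF this y(2)] y(1) W(1) Suc.prems(2) show ?case by blast
  qed
  with that show ?thesis by blast
qed

text \<open>By augmentation an independent set that is too small is never maximal. This turns
  feasibility of a selection into a count, which the machine can check.\<close>

lemma matroid_basis_iff: "matroid_basis indep B \<longleftrightarrow> indep B \<and> card B = rk carrier"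
proof
  assume B: "matroid_basis indep B"
  then have i: "indep B" by (simp add: matroid_basis_def)
  obtain Z where "B \<subseteq> Z" "indep Z" "card Z = rk carrier"
    using extend_to_rank[OF i indep_subset_carrier[OF i]] by metis
  then show "indep B \<and> card B = rk carrier" using B by (auto simp: matroid_basis_def)
next
  assume B: "indep B \<and> card B = rk carrier"
  show "matroid_basis indep B"
    unfolding matroid_basis_def
  proof (intro conjI allI impI)
    fix X assume X: "indep X" "B \<subseteq> X"
    then have "card X \<le> card B" using B card_le_rank indep_subset_carrier by metis
    then show "X = B" using X card_seteq[OF indep_finite[OF X(1)]] by metis
  qed (use B in simp)
qed

text \<open>Submodularity in the summed form used by greedy arguments. A maximum independent
  \<open>Y\<close> in \<open>S\<close> is extended to a maximum independent set of
  \<open>S \<union> A\<close>; each new element \<open>z\<close> lies in \<open>A\<close> and has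
  marginal rank at least one over \<open>S\<close>, because \<open>insert z Y\<close> is
  independent.\<close>

lemma rank_Un_le:
  assumes "finite A"
  shows "rk (S \<union> A) \<le> rk S + (\<Sum>i\<in>A. rk (insert i S) - rk S)"
proof -
  obtain Y where Y: "Y \<subseteq> S" "indep Y" "card Y = rk S" using rank_attained by blast
  obtain Z where Z: "Y \<subseteq> Z" "Z \<subseteq> S \<union> A" "indep Z" "card Z = rk (S \<union> A)"
    using extend_to_rank[of Y "S \<union> A"] Y by blast
  have gain: "z \<in> A \<and> 1 \<le> rk (insert z S) - rk S" if z: "z \<in> Z - Y" for z
  proof -
    have "indep (insert z Y)" using indep_subset[OF Z(3)] z Z(1) by blast
    moreover have "card (insert z Y) = rk S + 1" using z Y indep_finite by (simp add: card_insert_if)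
    moreover have "insert z Y \<subseteq> insert z S" using Y by blast
    ultimately have "rk S + 1 \<le> rk (insert z S)" using card_le_rank by metis
    moreover from this have "z \<notin> S" by (auto simp: insert_absorb)
    ultimately show ?thesis using z Z by auto
  qed
  have "rk (S \<union> A) = card Y + card (Z - Y)"
    using Z Y by (metis card_Un_disjoint Diff_disjoint Un_Diff_cancel Un_absorb1 indep_finite finite_Diff)
  also have "card (Z - Y) \<le> (\<Sum>i\<in>Z - Y. rk (insert i S) - rk S)"
    using sum_mono[of "Z - Y" "\<lambda>_. 1::nat" "\<lambda>i. rk (insert i S) - rk S"] gain by simp
  also have "\<dots> \<le> (\<Sum>i\<in>A. rk (insert i S) - rk S)"
    by (rule sum_mono2) (use assms gain in auto)
  finally show ?thesis using Y by simp
qed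

end

subsection \<open>Cheapest bases\<close>

text \<open>A strict total order refining \<open>c\<close>: ties go to the smaller element, so that
  the greedy basis is unique. The second disjunct has the shape of the comparison that the machine
  performs.\<close>

definition cheaper :: "('a::linorder \<Rightarrow> real) \<Rightarrow> 'a \<Rightarrow> 'a \<Rightarrow> bool" where
  "cheaper c x y \<longleftrightarrow> c x < c y \<or> \<not> c y < c x \<and> x < y"

text \<open>Kruskal's greedy basis without a loop: an element is kept iff it raises the rank of
  everything before it. Each membership test takes two rank queries and needs no sorting.\<close>

definition cheapest_basis :: "('a set \<Rightarrow> bool) \<Rightarrow> ('a::linorder \<Rightarrow> real) \<Rightarrow> 'a set \<Rightarrow> 'a set" where
  "cheapest_basis indep c S =
     {b \<in> S. matroid_rank indep {x \<in> S. cheaper c x b}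
               < matroid_rank indep (insert b {x \<in> S. cheaper c x b})}"

lemma cheapest_basis_subset: "cheapest_basis indep c S \<subseteq> S"
  by (auto simp: cheapest_basis_def)

lemma cheapest_basis_cong:
  assumes "\<And>x. x \<in> S \<Longrightarrow> c x = c' x"
  shows "cheapest_basis indep c S = cheapest_basis indep c' S"
proof -
  have "{x \<in> S. cheaper c x b} = {x \<in> S. cheaper c' x b}" if "b \<in> S" for b
    using assms that by (auto simp: cheaper_def)
  then show ?thesis by (auto simp: cheapest_basis_def)
qed

lemma finite_has_most_expensive:
  assumes "finite X" "X \<noteq> {}"
  obtains b where "b \<in> X" "\<And>x. x \<in> X \<Longrightarrow> x \<noteq> b \<Longrightarrow> cheaper c x b"
proof -
  let ?Y = "{x \<in> X. c x = Max (c ` X)}"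
  have Y: "finite ?Y" "?Y \<noteq> {}"
    using assms Max_in[of "c ` X"] by (auto simp: image_iff)
  have b: "Max ?Y \<in> ?Y" by (rule Max_in[OF Y])
  show ?thesis
  proof (rule that)
    show "Max ?Y \<in> X" using b by simp
    fix x assume x: "x \<in> X" "x \<noteq> Max ?Y"
    have le: "c x \<le> Max (c ` X)" using x assms by simp
    have "x < Max ?Y" if "c x = Max (c ` X)"
      using Max_ge[OF Y(1), of x] x that by auto
    moreover have "c (Max ?Y) = Max (c ` X)" using b by simp
    ultimately show "cheaper c x (Max ?Y)" using le by (fastforce simp: cheaper_def)
  qed
qed

locale ordered_matroid = matroid carrier indep
  for carrier :: "'a::linorder set" and indep
begin

text \<open>Induction on an initial segment of the order, removing its most expensive element
  \<open>b\<close>. The elements of \<open>S\<close> before \<open>b\<close> are exactly the rest of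
  the segment, so the test deciding membership of \<open>b\<close> compares the ranks of the segment
  with and without \<open>b\<close>.\<close>

lemma cheapest_basis_segment:
  assumes "finite X" "X \<subseteq> S" "\<And>x y. x \<in> X \<Longrightarrow> y \<in> S \<Longrightarrow> cheaper c y x \<Longrightarrow> y \<in> X"
  shows "indep (cheapest_basis indep c S \<inter> X) \<and> card (cheapest_basis indep c S \<inter> X) = rk X"
  using assms
proof (induction "card X" arbitrary: X)
  case 0
  then show ?case using rank_le_card[of "{}"] indep_empty by simp
next
  case (Suc d)
  then have "X \<noteq> {}" by auto
  obtain b where b: "b \<in> X" "\<And>x. x \<in> X \<Longrightarrow> x \<noteq> b \<Longrightarrow> cheaper c x b"
    using finite_has_most_expensive[OF Suc.prems(1) \<open>X \<noteq> {}\<close>] by metis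
  let ?G = "cheapest_basis indep c S" and ?X = "X - {b}"
  have before: "{x \<in> S. cheaper c x b} = ?X"
  proof (intro equalityI subsetI)
    fix x assume "x \<in> {x \<in> S. cheaper c x b}"
    then show "x \<in> ?X" using Suc.prems(3)[OF b(1)] by (auto simp: cheaper_def)
  qed (use b(2) Suc.prems(2) in blast)
  have "indep (?G \<inter> ?X) \<and> card (?G \<inter> ?X) = rk ?X"
  proof (rule Suc.hyps(1))
    fix x y assume xy: "x \<in> ?X" "y \<in> S" "cheaper c y x"
    moreover have "cheaper c x b" using b xy by blast
    ultimately show "y \<in> ?X" using Suc.prems(3)[of x y] by (auto simp: cheaper_def)
  qed (use Suc b in auto)
  then have IH: "indep (?G \<inter> ?X)" "card (?G \<inter> ?X) = rk ?X" by auto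
  have X: "insert b ?X = X" using b by blast
  have inG: "b \<in> ?G \<longleftrightarrow> rk ?X < rk X"
    using subsetD[OF Suc.prems(2) b(1)] unfolding cheapest_basis_def mem_Collect_eq before X by simp
  show ?case
  proof (cases "rk ?X < rk X")
    case False
    then have "rk ?X = rk X" using rank_mono[of ?X X] by auto
    moreover have "?G \<inter> X = ?G \<inter> ?X" using False inG by blast
    ultimately show ?thesis using IH by simp
  next
    case True
    obtain Z where Z: "Z \<subseteq> X" "indep Z" "card Z = rk X" using rank_attained by blast
    obtain y where y: "y \<in> Z - (?G \<inter> ?X)" "indep (insert y (?G \<inter> ?X))"
      using augment[OF IH(1) Z(2)] IH Z True by auto
    have cy: "card (insert y (?G \<inter> ?X)) = Suc (rk ?X)"
      using y IH indep_finite by (simp add: card_insert_if)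
    \<comment> \<open>Any other \<open>y\<close> would give an independent subset of
      \<open>?X\<close> that is larger than \<open>rk ?X\<close>.\<close>
    have "y = b"
    proof (rule ccontr)
      assume "y \<noteq> b"
      then have "insert y (?G \<inter> ?X) \<subseteq> ?X" using y Z by blast
      from card_le_rank[OF this y(2)] cy show False by simp
    qed
    moreover have "?G \<inter> X = insert b (?G \<inter> ?X)" using inG True b by blast
    ultimately have *: "indep (?G \<inter> X)" "card (?G \<inter> X) = Suc (rk ?X)" using y cy by auto
    moreover have "rk X \<le> Suc (rk ?X)"
    proof -
      have "indep (Z - {b})" using indep_subset[OF Z(2)] by blast
      then have "card (Z - {b}) \<le> rk ?X" using Z(1) by (intro card_le_rank) auto
      then show ?thesis using Z(3) diff_card_le_card_Diff[of "{b}" Z] by simp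
    qed
    ultimately show ?thesis using True by linarith
  qed
qed

lemma indep_cheapest_basis:
  assumes "finite S"
  shows "indep (cheapest_basis indep c S)" "card (cheapest_basis indep c S) = rk S"
  using cheapest_basis_segment[of S S c] assms
  by (simp_all add: Int_absorb2 cheapest_basis_subset)

text \<open>A cost threshold cuts out an initial segment of the order. The greedy basis is thus
  maximum at all thresholds simultaneously, which is the form in which its optimality is
  used.\<close>

lemma card_cheapest_basis_le:
  assumes "finite S"
  shows "card {i \<in> cheapest_basis indep c S. c i \<le> \<theta>} = rk {i \<in> S. c i \<le> \<theta>}"
proof -
  have "cheapest_basis indep c S \<inter> {i \<in> S. c i \<le> \<theta>} = {i \<in> cheapest_basis indep c S. c i \<le> \<theta>}"
    using cheapest_basis_subset by blast
  with cheapest_basis_segment[of "{i \<in> S. c i \<le> \<theta>}" S c] assms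
  show ?thesis by (force simp: cheaper_def)
qed

end

text \<open>Listing both sets by increasing cost, the domination at all thresholds favours
  \<open>A\<close> position by position. The induction strips a most expensive element off each
  side.\<close>

lemma sum_le_if_dominated:
  fixes c :: "'a \<Rightarrow> real"
  assumes "finite A" "finite B" "card A = card B"
    and "\<And>\<theta>. card {b \<in> B. c b \<le> \<theta>} \<le> card {a \<in> A. c a \<le> \<theta>}"
  shows "sum c A \<le> sum c B"
  using assms
proof (induction "card A" arbitrary: A B)
  case 0
  then show ?case by simp
next
  case (Suc d)
  then have ne: "c ` A \<noteq> {}" "c ` B \<noteq> {}" by auto
  have "Max (c ` A) \<in> c ` A" "Max (c ` B) \<in> c ` B"
    using Suc.prems ne by (auto intro!: Max_in)
  then obtain a b where a: "a \<in> A" "c a = Max (c ` A)" and b: "b \<in> B" "c b = Max (c ` B)"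
    by auto
  have maxa: "c x \<le> c a" if "x \<in> A" for x using that a Suc.prems by simp
  have maxb: "c x \<le> c b" if "x \<in> B" for x using that b Suc.prems by simp
  \<comment> \<open>At threshold \<open>c b\<close> all of \<open>B\<close> is counted, hence all of
    \<open>A\<close>.\<close>
  have "{x \<in> B. c x \<le> c b} = B" using maxb by blast
  then have "card A \<le> card {x \<in> A. c x \<le> c b}" using Suc.prems(3) Suc.prems(4)[of "c b"] by simp
  then have "{x \<in> A. c x \<le> c b} = A" using Suc.prems(1) by (intro card_seteq) auto
  then have ab: "c a \<le> c b" using a(1) by blast
  have "sum c (A - {a}) \<le> sum c (B - {b})"
  proof (rule Suc.hyps(1))
    show "d = card (A - {a})" "card (A - {a}) = card (B - {b})"
      using Suc a b by (auto simp: card_Diff_singleton)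
    fix \<theta>
    show "card {x \<in> B - {b}. c x \<le> \<theta>} \<le> card {x \<in> A - {a}. c x \<le> \<theta>}"
    proof (cases "c a \<le> \<theta>")
      case True
      then have "{x \<in> A - {a}. c x \<le> \<theta>} = A - {a}" using maxa by fastforce
      moreover have "card {x \<in> B - {b}. c x \<le> \<theta>} \<le> card (B - {b})"
        using Suc.prems by (intro card_mono) auto
      ultimately show ?thesis using Suc.prems a b by (simp add: card_Diff_singleton)
    next
      case False
      then have "{x \<in> A - {a}. c x \<le> \<theta>} = {x \<in> A. c x \<le> \<theta>}"
        and "{x \<in> B - {b}. c x \<le> \<theta>} = {x \<in> B. c x \<le> \<theta>}" using ab by auto
      then show ?thesis using Suc.prems(4) by simp
    qed
  qed (use Suc.prems in auto)
  then show ?case using ab a b Suc.prems by (simp add: sum.remove[of A a] sum.remove[of B b])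
qed

text \<open>More boxes mean larger ranks at every threshold. Once the rank is full, further probing
  therefore never makes the cheapest basis dearer.\<close>

lemma (in ordered_matroid) sum_cheapest_basis_antimono:
  assumes "finite S'" "S \<subseteq> S'" "rk S = rk S'"
  shows "sum c (cheapest_basis indep c S') \<le> sum c (cheapest_basis indep c S)"
proof (rule sum_le_if_dominated)
  have S: "finite S" using assms finite_subset by blast
  show "finite (cheapest_basis indep c S')" "finite (cheapest_basis indep c S)"
    using S assms indep_cheapest_basis(1) indep_finite by blast+
  show "card (cheapest_basis indep c S') = card (cheapest_basis indep c S)"
    using S assms by (simp add: indep_cheapest_basis)
  show "card {b \<in> cheapest_basis indep c S. c b \<le> \<theta>}
      \<le> card {a \<in> cheapest_basis indep c S'. c a \<le> \<theta>}" for \<theta>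
    unfolding card_cheapest_basis_le[OF S] card_cheapest_basis_le[OF assms(1)]
    using assms by (intro rank_mono) auto
qed

section \<open>Coverage within a budget\<close>

text \<open>The integral over cost thresholds, discretized at the multiples \<open>l * D / k\<close>
  and multiplied out to avoid division. With \<open>k + 1\<close> levels, a set without full rank at
  the top level reaches at most \<open>(k + 1) * (k - 1)\<close>, which is less than
  \<open>k * k\<close>; so the threshold \<open>k * k\<close> also certifies that a basis is
  present.\<close>

definition level_rank :: "('a set \<Rightarrow> bool) \<Rightarrow> nat \<Rightarrow> ('a \<Rightarrow> real) \<Rightarrow> nat \<Rightarrow> 'a set \<Rightarrow> nat" where
  "level_rank indep k c D S =
     (\<Sum>l\<in>{1..k+1}. matroid_rank indep {i \<in> S. real k * c i \<le> real (l * D)})"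

lemma card_eq_sum_of_bool:
  "finite A \<Longrightarrow> real (card {a \<in> A. P a}) = (\<Sum>a\<in>A. of_bool (P a))"
  by (simp add: Int_def)

text \<open>With the next lemma: an element of scaled cost \<open>x\<close> is absent from
  \<open>x\<close> levels up to an error of at most one. The upper bound shows that cheap bases pass
  the threshold, the lower bound that passing it yields a cheap basis.\<close>

lemma card_levels_below:
  fixes x :: real
  assumes "0 \<le> x"
  shows "real (card {l \<in> {1..K::nat}. \<not> x \<le> real l}) \<le> x"
proof -
  have "{l \<in> {1..K}. \<not> x \<le> real l} \<subseteq> {1..nat \<lfloor>x\<rfloor>}"
  proof
    fix l assume "l \<in> {l \<in> {1..K}. \<not> x \<le> real l}"
    then have "1 \<le> l" "real l \<le> x" by auto
    then show "l \<in> {1..nat \<lfloor>x\<rfloor>}" using le_nat_floor by auto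
  qed
  from card_mono[OF _ this] have "card {l \<in> {1..K}. \<not> x \<le> real l} \<le> nat \<lfloor>x\<rfloor>" by simp
  also have "real (nat \<lfloor>x\<rfloor>) \<le> x" using assms by (simp add: of_nat_nat)
  finally show ?thesis by simp
qed

lemma card_levels_below_ge:
  fixes x :: real
  assumes "x \<le> real K"
  shows "x \<le> 1 + real (card {l \<in> {1..K}. \<not> x \<le> real l})"
proof (cases "x \<le> 0")
  case False
  let ?q = "nat (\<lceil>x\<rceil> - 1)"
  have "{1..?q} \<subseteq> {l \<in> {1..K}. \<not> x \<le> real l}"
  proof
    fix l assume l: "l \<in> {1..?q}"
    then have "int l \<le> \<lceil>x\<rceil> - 1" by auto
    then have "real l < x" by linarith
    then show "l \<in> {l \<in> {1..K}. \<not> x \<le> real l}" using l assms by auto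
  qed
  from card_mono[OF _ this] have "?q \<le> card {l \<in> {1..K}. \<not> x \<le> real l}" by simp
  moreover have "x \<le> 1 + real ?q" using False by linarith
  ultimately show ?thesis by linarith
qed simp

context matroid
begin

lemma level_rank_mono:
  assumes "S \<subseteq> S'" "D \<le> D'"
  shows "level_rank indep k c D S \<le> level_rank indep k c D' S'"
  unfolding level_rank_def
proof (intro sum_mono rank_mono subsetI)
  fix l i assume i: "i \<in> {i \<in> S. real k * c i \<le> real (l * D)}"
  have "real (l * D) \<le> real (l * D')" using assms(2) by (intro of_nat_mono mult_le_mono2)
  then show "i \<in> {i \<in> S'. real k * c i \<le> real (l * D')}" using i assms(1) by auto
qed

text \<open>\<open>rank_Un_le\<close> on each level. An element of \<open>A\<close> too expensive
  for a level has marginal zero there, and monotonicity lets the truncated differences add up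
  exactly.\<close>

lemma level_rank_Un_le:
  assumes "finite A"
  shows "level_rank indep k c D (S \<union> A)
    \<le> level_rank indep k c D S + (\<Sum>i\<in>A. level_rank indep k c D (insert i S) - level_rank indep k c D S)"
proof -
  let ?L = "\<lambda>l X. {i \<in> X. real k * c i \<le> real (l * D)}"
  have mono: "rk (?L l S) \<le> rk (?L l (insert i S))" for l i by (intro rank_mono) auto
  have step: "rk (?L l (S \<union> A)) \<le> rk (?L l S) + (\<Sum>i\<in>A. rk (?L l (insert i S)) - rk (?L l S))" for l
  proof -
    have "rk (?L l (S \<union> A)) = rk (?L l S \<union> ?L l A)" by (rule arg_cong[where f = rk]) auto
    also have "\<dots> \<le> rk (?L l S) + (\<Sum>i\<in>?L l A. rk (insert i (?L l S)) - rk (?L l S))"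
      using assms by (intro rank_Un_le) auto
    also have "(\<Sum>i\<in>?L l A. rk (insert i (?L l S)) - rk (?L l S))
        = (\<Sum>i\<in>?L l A. rk (?L l (insert i S)) - rk (?L l S))"
      by (intro sum.cong refl arg_cong2[where f = minus] arg_cong[where f = rk]) auto
    also have "\<dots> \<le> (\<Sum>i\<in>A. rk (?L l (insert i S)) - rk (?L l S))"
      using assms by (intro sum_mono2) auto
    finally show ?thesis by simp
  qed
  have "level_rank indep k c D (S \<union> A)
      \<le> (\<Sum>l\<in>{1..k+1}. rk (?L l S) + (\<Sum>i\<in>A. rk (?L l (insert i S)) - rk (?L l S)))"
    unfolding level_rank_def by (intro sum_mono step)
  also have "\<dots> = level_rank indep k c D S
      + (\<Sum>i\<in>A. \<Sum>l\<in>{1..k+1}. rk (?L l (insert i S)) - rk (?L l S))"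
    unfolding level_rank_def sum.distrib by (subst sum.swap) simp
  also have "(\<Sum>i\<in>A. \<Sum>l\<in>{1..k+1}. rk (?L l (insert i S)) - rk (?L l S))
      = (\<Sum>i\<in>A. level_rank indep k c D (insert i S) - level_rank indep k c D S)"
    unfolding level_rank_def by (intro sum.cong refl sum_subtractf_nat mono)
  finally show ?thesis .
qed

text \<open>Double counting of pairs of an element of \<open>B\<close> and a level. Of the
  \<open>(k + 1) * k\<close> pairs, those whose level lies below the scaled cost of the element are
  lost; the scaled costs sum to at most \<open>k\<close>, so at least \<open>k * k\<close> pairs
  remain.\<close>

lemma level_rank_ge_if_cheap_indep:
  assumes B: "indep B" "B \<subseteq> S" "card B = k" and D: "0 < D"
    and cost: "\<And>b. b \<in> B \<Longrightarrow> 0 \<le> c b" "sum c B \<le> real D"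
  shows "k * k \<le> level_rank indep k c D S"
proof -
  let ?x = "\<lambda>b. real k * c b / real D"
  have fin: "finite B" using B indep_finite by blast
  have iff: "real k * c b \<le> real (l * D) \<longleftrightarrow> ?x b \<le> real l" for b l
    using D by (simp add: field_simps)
  have "real ((k + 1) * k) - real k
      \<le> (\<Sum>l\<in>{1..k+1}. real k) - (\<Sum>b\<in>B. real (card {l \<in> {1..k+1}. \<not> ?x b \<le> real l}))"
  proof -
    have "(\<Sum>b\<in>B. real (card {l \<in> {1..k+1}. \<not> ?x b \<le> real l})) \<le> (\<Sum>b\<in>B. ?x b)"
      by (intro sum_mono card_levels_below) (use cost D in auto)
    also have "\<dots> = real k * sum c B / real D"
      by (simp add: sum_distrib_left sum_divide_distrib)
    also have "\<dots> \<le> real k"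
      using mult_left_mono[OF cost(2), of "real k"] D by (simp add: field_simps)
    finally have "(\<Sum>b\<in>B. real (card {l \<in> {1..k+1}. \<not> ?x b \<le> real l})) \<le> real k" .
    moreover have "(\<Sum>l\<in>{1..k+1}. real k) = real ((k + 1) * k)" by (simp add: algebra_simps)
    ultimately show ?thesis by linarith
  qed
  also have "(\<Sum>b\<in>B. real (card {l \<in> {1..k+1}. \<not> ?x b \<le> real l}))
      = (\<Sum>b\<in>B. \<Sum>l\<in>{1..k+1}. of_bool (\<not> ?x b \<le> real l))"
    by (intro sum.cong refl card_eq_sum_of_bool) simp
  also have "\<dots> = (\<Sum>l\<in>{1..k+1}. \<Sum>b\<in>B. of_bool (\<not> ?x b \<le> real l))" by (rule sum.swap)
  also have "(\<Sum>l\<in>{1..k+1}. real k) - \<dots>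
      = (\<Sum>l\<in>{1..k+1}. real k - (\<Sum>b\<in>B. of_bool (\<not> ?x b \<le> real l)))"
    by (simp only: sum_subtractf)
  also have "\<dots> \<le> (\<Sum>l\<in>{1..k+1}. real (rk {i \<in> S. real k * c i \<le> real (l * D)}))"
  proof (intro sum_mono)
    fix l
    have "real k - (\<Sum>b\<in>B. of_bool (\<not> ?x b \<le> real l)) = (\<Sum>b\<in>B. of_bool (?x b \<le> real l))"
      using B(3) by (simp add: of_bool_not_iff sum_subtractf)
    also have "\<dots> = real (card {b \<in> B. ?x b \<le> real l})"
      using fin by (simp add: Int_def)
    also have "card {b \<in> B. ?x b \<le> real l} \<le> rk {i \<in> S. real k * c i \<le> real (l * D)}"
      using B(2) iff by (intro card_le_rank indep_subset[OF B(1)]) blast+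
    finally show "real k - (\<Sum>b\<in>B. of_bool (\<not> ?x b \<le> real l))
        \<le> real (rk {i \<in> S. real k * c i \<le> real (l * D)})" by simp
  qed
  also have "\<dots> = real (level_rank indep k c D S)" by (simp add: level_rank_def)
  finally have "real (k * k) \<le> real (level_rank indep k c D S)" by (simp add: algebra_simps)
  then show ?thesis by (simp only: of_nat_le_iff)
qed

end

text \<open>The converse, up to a factor of two: rounding accounts for at most one unit of
  \<open>D / k\<close> in each of the \<open>k\<close> basis elements, hence for at most another
  \<open>D\<close> in total.\<close>

lemma (in ordered_matroid) cheapest_basis_if_level_rank_ge:
  assumes S: "finite S" and k: "k = rk carrier" "0 < k" and D: "0 < D"
    and lev: "k * k \<le> level_rank indep k c D S"
  shows "rk S = k" "sum c (cheapest_basis indep c S) \<le> 2 * real D"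
proof -
  let ?L = "\<lambda>l X. {i \<in> X. real k * c i \<le> real (l * D)}"
  let ?G = "cheapest_basis indep c S"
  have le_k: "rk X \<le> k" for X using k rank_le_rank_carrier by simp
  \<comment> \<open>Besides giving full rank, this bounds every scaled cost in the basis by
    \<open>k + 1\<close>, as \<open>card_levels_below_ge\<close> requires.\<close>
  have top: "rk (?L (k+1) S) = k"
  proof (rule ccontr)
    assume "rk (?L (k+1) S) \<noteq> k"
    then have lt: "rk (?L (k+1) S) \<le> k - 1" using le_k[of "?L (k+1) S"] by linarith
    have "rk (?L l S) \<le> k - 1" if "l \<in> {1..k+1}" for l
    proof -
      have "real (l * D) \<le> real ((k+1) * D)" using that
        by (metis atLeastAtMost_iff mult_le_mono1 of_nat_mono)
      then have "?L l S \<subseteq> ?L (k+1) S" by auto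
      from rank_mono[OF this] lt show ?thesis by linarith
    qed
    then have "level_rank indep k c D S \<le> (\<Sum>l\<in>{1..k+1}. k - 1)"
      unfolding level_rank_def by (intro sum_mono)
    also have "\<dots> < k * k" using k(2) by (cases k) auto
    finally show False using lev by simp
  qed
  show rkS: "rk S = k" using rank_mono[of "?L (k+1) S" S] top le_k[of S] by fastforce
  have G: "finite ?G" "card ?G = k"
    using indep_cheapest_basis[OF S] indep_finite rkS by auto
  let ?x = "\<lambda>b. real k * c b / real D"
  have iff: "real k * c b \<le> real (l * D) \<longleftrightarrow> ?x b \<le> real l" for b l
    using D by (simp add: field_simps)
  have iff': "real k * c b \<le> real (l * D) \<longleftrightarrow> c b \<le> real (l * D) / real k" for b l
    using k(2) by (simp add: field_simps)
  have GL: "card (?L l ?G) = rk (?L l S)" for l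
    unfolding iff' by (rule card_cheapest_basis_le[OF S])
  have "?L (k+1) ?G = ?G"
    by (rule card_subset_eq) (use G GL[of "k+1"] top in auto)
  then have x_le: "?x g \<le> real (k+1)" if "g \<in> ?G" for g using that iff[of g "k+1"] by blast
  have "real k * sum c ?G / real D = (\<Sum>g\<in>?G. ?x g)"
    by (simp add: sum_distrib_left sum_divide_distrib)
  also have "\<dots> \<le> (\<Sum>g\<in>?G. 1 + real (card {l \<in> {1..k+1}. \<not> ?x g \<le> real l}))"
    by (intro sum_mono card_levels_below_ge x_le)
  also have "\<dots> = real k + (\<Sum>g\<in>?G. \<Sum>l\<in>{1..k+1}. of_bool (\<not> ?x g \<le> real l))"
    unfolding sum.distrib card_eq_sum_of_bool[OF finite_atLeastAtMost] using G(2) by simp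
  also have "(\<Sum>g\<in>?G. \<Sum>l\<in>{1..k+1}. of_bool (\<not> ?x g \<le> real l) :: real)
      = (\<Sum>l\<in>{1..k+1}. \<Sum>g\<in>?G. of_bool (\<not> ?x g \<le> real l))"
    by (rule sum.swap)
  also have "\<dots> = (\<Sum>l\<in>{1..k+1}. real k - real (rk (?L l S)))"
  proof (intro sum.cong refl)
    fix l
    have "(\<Sum>g\<in>?G. of_bool (\<not> ?x g \<le> real l)) = real (card ?G) - real (card {g \<in> ?G. ?x g \<le> real l})"
      using G by (simp add: of_bool_not_iff sum_subtractf Int_def)
    also have "{g \<in> ?G. ?x g \<le> real l} = ?L l ?G" using iff by auto
    finally show "(\<Sum>g\<in>?G. of_bool (\<not> ?x g \<le> real l)) = real k - real (rk (?L l S))"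
      using G GL by simp
  qed
  also have "\<dots> = real ((k+1) * k) - real (level_rank indep k c D S)"
    by (simp add: sum_subtractf level_rank_def algebra_simps)
  also have "real k + \<dots> \<le> 2 * real k"
  proof -
    have "real (k * k) \<le> real (level_rank indep k c D S)" using lev by (simp only: of_nat_le_iff)
    then show ?thesis by (simp add: algebra_simps)
  qed
  finally show "sum c ?G \<le> 2 * real D" using k(2) D by (simp add: field_simps)
qed

section \<open>The potential\<close>

text \<open>A harmonic number scaled by \<open>M\<close>, with the summands rounded down because the machine cannot divide.
  Rounding costs at most a factor of two as long as \<open>x \<le> M\<close>.\<close>

definition pot :: "nat \<Rightarrow> nat \<Rightarrow> nat" where
  "pot M x = (\<Sum>y\<in>{1..x}. M div y)"

lemma pot_0 [simp]: "pot M 0 = 0"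
  by (simp add: pot_def)

lemma pot_mono: "x \<le> y \<Longrightarrow> pot M x \<le> pot M y"
  unfolding pot_def by (intro sum_mono2) auto

text \<open>Every summand that disappears has an index of at most \<open>x\<close>, so it is at
  least \<open>M div x\<close>.\<close>

lemma pot_diff_ge:
  assumes "x' \<le> x"
  shows "(x - x') * (M div x) \<le> pot M x - pot M x'"
proof -
  have "{1..x} = {1..x'} \<union> {x'<..x}" using assms by auto
  then have "pot M x = pot M x' + (\<Sum>y\<in>{x'<..x}. M div y)"
    unfolding pot_def by (simp only:) (intro sum.union_disjoint; auto)
  moreover have "(\<Sum>y\<in>{x'<..x}. M div x) \<le> (\<Sum>y\<in>{x'<..x}. M div y)"
    by (intro sum_mono div_le_mono2) auto
  ultimately show ?thesis by simp
qed

text \<open>The remainder \<open>M mod x\<close> is below \<open>x\<close>, and \<open>x\<close> is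
  at most \<open>x * (M div x)\<close> because the quotient is positive.\<close>

lemma le_twice_mult_div:
  assumes "0 < x" "x \<le> (M::nat)"
  shows "M \<le> 2 * (x * (M div x))"
proof -
  have "1 \<le> M div x" using assms by (simp add: Suc_le_eq div_greater_zero_iff)
  then have "x \<le> x * (M div x)" using mult_le_mono2[of 1 "M div x" x] by simp
  moreover have "M = x * (M div x) + M mod x" "M mod x < x" using assms by auto
  ultimately show ?thesis by linarith
qed

lemma pot_le_square: "pot M M \<le> M * M"
proof -
  have "pot M M \<le> (\<Sum>y\<in>{1..M}. M)" unfolding pot_def by (intro sum_mono) simp
  then show ?thesis by simp
qed

lemma le_pot: "0 < M \<Longrightarrow> M \<le> pot M M"
proof -
  assume "0 < M"
  then have "pot M 1 \<le> pot M M" by (intro pot_mono) simp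
  then show ?thesis by (simp add: pot_def)
qed

text \<open>The new summand \<open>1 / (N + 1)\<close> is at most \<open>ln (N + 1) - ln N\<close>,
  by \<open>ln x \<le> x - 1\<close> at \<open>x = N / (N + 1)\<close>.\<close>

lemma sum_inverse_le_ln: "0 < N \<Longrightarrow> (\<Sum>y\<in>{1..N}. 1 / real y) \<le> 1 + ln (real N)"
proof (induction N rule: nat_induct_non_zero)
  case (Suc N)
  have "ln (real N / real (Suc N)) \<le> real N / real (Suc N) - 1"
    using Suc by (intro ln_le_minus_one) simp
  also have "\<dots> = - 1 / real (Suc N)" by (simp add: field_simps)
  finally have "1 / real (Suc N) \<le> ln (real (Suc N)) - ln (real N)"
    using Suc by (simp add: ln_div)
  then show ?case using Suc by simp
qed simp

lemma pot_le_ln: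
  assumes "0 < M"
  shows "real (pot M M) \<le> real M * (1 + ln (real M))"
proof -
  have "real (pot M M) \<le> (\<Sum>y\<in>{1..M}. real M * (1 / real y))"
    unfolding pot_def of_nat_sum by (intro sum_mono) (simp add: of_nat_div_le_of_nat)
  also have "\<dots> = real M * (\<Sum>y\<in>{1..M}. 1 / real y)" by (simp only: sum_distrib_left)
  also have "\<dots> \<le> real M * (1 + ln (real M))"
    using sum_inverse_le_ln[OF assms] by (intro mult_left_mono) auto
  finally show ?thesis .
qed

text \<open>Truncated subtraction caps the submodular function at its threshold, so that zero means
  covered within budget \<open>D\<close>.\<close>

definition deficit :: "search_instance \<Rightarrow> nat \<Rightarrow> nat \<Rightarrow> nat set \<Rightarrow> nat" where
  "deficit I s D S = instance_rank I * instance_rank I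
     - level_rank (indep_sets I) (instance_rank I) (\<lambda>i. box_cost I i s) D S"

definition potential :: "search_instance \<Rightarrow> nat \<Rightarrow> nat set \<Rightarrow> nat" where
  "potential I D S =
     (\<Sum>s<num_scenarios I. pot (instance_rank I * instance_rank I) (deficit I s D S))"

definition phase_budget :: "nat \<Rightarrow> nat \<Rightarrow> nat" where
  "phase_budget \<alpha> t = 2 ^ (LEAST j. t < \<alpha> * 2 ^ j)"

text \<open>A predicate rather than a function: ties are left open, so the analysis applies to
  whichever greedy order the program produces.\<close>

definition greedy_order :: "search_instance \<Rightarrow> nat \<Rightarrow> nat list \<Rightarrow> bool" where
  "greedy_order I \<alpha> xs \<longleftrightarrow> distinct xs \<and> set xs = boxes I \<and>
     (\<forall>t<num_boxes I. \<forall>i\<in>boxes I - set (take t xs).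
        potential I (phase_budget \<alpha> t) (insert (xs ! t) (set (take t xs)))
          \<le> potential I (phase_budget \<alpha> t) (insert i (set (take t xs))))"

lemma phase_budget_0: "t < \<alpha> \<Longrightarrow> phase_budget \<alpha> t = 1"
  unfolding phase_budget_def by (subst Least_eq_0) auto

lemma phase_budget_Suc:
  assumes "\<alpha> * 2 ^ j \<le> t" "t < \<alpha> * 2 ^ Suc j"
  shows "phase_budget \<alpha> t = 2 ^ Suc j"
proof -
  have "(LEAST j. t < \<alpha> * 2 ^ j) = Suc j"
  proof (rule Least_equality)
    fix i assume i: "t < \<alpha> * 2 ^ i"
    show "Suc j \<le> i"
    proof (rule ccontr)
      assume "\<not> Suc j \<le> i"
      then have "\<alpha> * 2 ^ i \<le> \<alpha> * 2 ^ j" by (intro mult_le_mono2 power_increasing) auto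
      with i assms show False by simp
    qed
  qed (use assms in simp)
  then show ?thesis by (simp add: phase_budget_def)
qed

section \<open>Deficits, the potential, and the gain of a covering set\<close>

locale search =
  fixes I :: search_instance
  assumes problem: "search_problem I" and rank_pos: "0 < instance_rank I"
begin

abbreviation "n \<equiv> num_boxes I"
abbreviation "m \<equiv> num_scenarios I"
abbreviation "k \<equiv> instance_rank I"
abbreviation "cost s \<equiv> \<lambda>i. box_cost I i s"

sublocale ordered_matroid "boxes I" "indep_sets I"
  using problem by (simp add: search_problem_def ordered_matroid_def)

lemma k_eq: "k = rk (boxes I)" by (simp add: instance_rank_def)

lemma card_boxes: "card (boxes I) = n" by (simp add: boxes_def)

lemma k_le_n: "k \<le> n"
  using rank_le_card[OF finite_carrier] by (simp add: k_eq card_boxes)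

lemma m_pos: "0 < m" using problem by (auto simp: search_problem_def num_scenarios_def)

lemma cost_nonneg: "s < m \<Longrightarrow> i \<in> boxes I \<Longrightarrow> 0 \<le> cost s i"
  using problem by (simp add: search_problem_def)

lemma deficit_antimono: "S \<subseteq> S' \<Longrightarrow> D \<le> D' \<Longrightarrow> deficit I s D' S' \<le> deficit I s D S"
  unfolding deficit_def by (intro diff_le_mono2 level_rank_mono)

lemma deficit_le: "deficit I s D S \<le> k * k" by (simp add: deficit_def)

text \<open>Submodularity survives the cap. If a single element of \<open>A\<close> clears the
  deficit, its own gain is the whole deficit; otherwise no gain is truncated and
  \<open>level_rank_Un_le\<close> applies directly.\<close>

lemma deficit_le_gain:
  assumes A: "finite A" "deficit I s D A = 0"
  shows "deficit I s D S \<le> (\<Sum>i\<in>A. deficit I s D S - deficit I s D (insert i S))"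
proof (cases "\<exists>i\<in>A. deficit I s D (insert i S) = 0")
  case True
  then obtain i where "i \<in> A" "deficit I s D (insert i S) = 0" by blast
  then show ?thesis
    using member_le_sum[of i A "\<lambda>i. deficit I s D S - deficit I s D (insert i S)"] A by simp
next
  case False
  let ?f = "level_rank (indep_sets I) k (cost s) D"
  have "?f (S \<union> A) \<le> ?f S + (\<Sum>i\<in>A. ?f (insert i S) - ?f S)"
    by (rule level_rank_Un_le[OF A(1)])
  moreover have "k * k \<le> ?f (S \<union> A)"
    using A(2) level_rank_mono[of A "S \<union> A" D D k "cost s"] by (simp add: deficit_def)
  moreover have "(\<Sum>i\<in>A. ?f (insert i S) - ?f S)
      = (\<Sum>i\<in>A. deficit I s D S - deficit I s D (insert i S))"
  proof (intro sum.cong refl)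
    fix i assume "i \<in> A"
    then have "?f (insert i S) < k * k" using False by (auto simp: deficit_def)
    moreover have "?f S \<le> ?f (insert i S)" by (intro level_rank_mono) auto
    ultimately show "?f (insert i S) - ?f S = deficit I s D S - deficit I s D (insert i S)"
      by (simp add: deficit_def)
  qed
  ultimately show ?thesis by (simp add: deficit_def)
qed

text \<open>The elements of \<open>A\<close> together gain at least the deficit \<open>d\<close>,
  and each unit gained is worth at least \<open>k * k div d\<close>. The product is at least half of
  \<open>k * k\<close>, whatever \<open>d\<close> is.\<close>

lemma pot_gain:
  assumes A: "finite A" "deficit I s D A = 0" and S: "0 < deficit I s D S"
  shows "k * k \<le> 2 * (\<Sum>i\<in>A. pot (k * k) (deficit I s D S) - pot (k * k) (deficit I s D (insert i S)))"
proof -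
  let ?d = "deficit I s D S"
  have "k * k \<le> 2 * (?d * (k * k div ?d))" using S deficit_le by (intro le_twice_mult_div)
  also have "?d * (k * k div ?d) \<le> (\<Sum>i\<in>A. ?d - deficit I s D (insert i S)) * (k * k div ?d)"
    using deficit_le_gain[OF A] by (intro mult_le_mono1)
  also have "\<dots> \<le> (\<Sum>i\<in>A. pot (k * k) ?d - pot (k * k) (deficit I s D (insert i S)))"
    unfolding sum_distrib_right by (intro sum_mono pot_diff_ge deficit_antimono) auto
  finally show ?thesis by simp
qed

lemma potential_antimono: "S \<subseteq> S' \<Longrightarrow> potential I D S' \<le> potential I D S"
  unfolding potential_def by (intro sum_mono pot_mono deficit_antimono) auto

lemma potential_gain:
  assumes A: "finite A"
  shows "k * k * card {s \<in> {..<m}. 0 < deficit I s D S \<and> deficit I s D A = 0}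
     \<le> 2 * (\<Sum>i\<in>A. potential I D S - potential I D (insert i S))"
proof -
  let ?P = "\<lambda>s S. pot (k * k) (deficit I s D S)"
  let ?N = "{s \<in> {..<m}. 0 < deficit I s D S \<and> deficit I s D A = 0}"
  have mono: "?P s (insert i S) \<le> ?P s S" for s i by (intro pot_mono deficit_antimono) auto
  have "k * k * card ?N = (\<Sum>s\<in>?N. k * k)" by simp
  also have "\<dots> \<le> (\<Sum>s\<in>?N. 2 * (\<Sum>i\<in>A. ?P s S - ?P s (insert i S)))"
    using A by (intro sum_mono pot_gain) auto
  also have "\<dots> \<le> (\<Sum>s<m. 2 * (\<Sum>i\<in>A. ?P s S - ?P s (insert i S)))"
    by (intro sum_mono2) auto
  also have "\<dots> = 2 * (\<Sum>i\<in>A. \<Sum>s<m. ?P s S - ?P s (insert i S))"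
    by (subst sum.swap) (simp only: sum_distrib_left)
  also have "(\<Sum>i\<in>A. \<Sum>s<m. ?P s S - ?P s (insert i S))
      = (\<Sum>i\<in>A. potential I D S - potential I D (insert i S))"
    unfolding potential_def by (intro sum.cong refl sum_subtractf_nat mono)
  finally show ?thesis .
qed

end

subsection \<open>Progress of the greedy order\<close>

text \<open>The factor 16 makes a phase long enough to leave uncovered at most a quarter of the scenarios that
  were uncovered before it and that the order to compare with covers within the budget.\<close>

locale greedy_search = search +
  fixes \<alpha> :: nat and xs :: "nat list"
  assumes greedy: "greedy_order I \<alpha> xs"
    and \<alpha>: "16 * pot (instance_rank I * instance_rank I) (instance_rank I * instance_rank I)
      \<le> \<alpha> * (instance_rank I * instance_rank I)"
begin

abbreviation "probed t \<equiv> set (take t xs)"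
abbreviation "uncovered D S \<equiv> {s \<in> {..<m}. 0 < deficit I s D S}"

lemma xs: "distinct xs" "set xs = boxes I" "length xs = n"
  using greedy distinct_card[of xs] card_boxes by (auto simp: greedy_order_def)

lemma probed_Suc: "t < n \<Longrightarrow> probed (Suc t) = insert (xs ! t) (probed t)"
  using xs by (simp add: take_Suc_conv_app_nth)

lemma probed_mono: "t \<le> t' \<Longrightarrow> probed t \<subseteq> probed t'"
  by (rule set_take_subset_set_take)

lemma probed_all: "n \<le> t \<Longrightarrow> probed t = boxes I" using xs by simp

text \<open>The greedy box gains at least the average over \<open>A\<close>, which has at most
  \<open>D\<close> elements; elements of \<open>A\<close> probed earlier gain nothing. Multiplying
  by \<open>2 * D\<close> and adding the remaining potential on the left avoids division and
  truncated subtraction.\<close>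

lemma greedy_step:
  assumes A: "A \<subseteq> boxes I" "card A \<le> D" and D: "phase_budget \<alpha> t = D"
  shows "k * k * card {s \<in> {..<m}. 0 < deficit I s D (probed t) \<and> deficit I s D A = 0}
      + 2 * D * potential I D (probed (Suc t)) \<le> 2 * D * potential I D (probed t)"
proof (cases "t < n")
  case True
  let ?g = "potential I D (probed t) - potential I D (probed (Suc t))"
  have le: "potential I D (probed (Suc t)) \<le> potential I D (probed t)"
    by (intro potential_antimono probed_mono) simp
  have fin: "finite A" using A finite_carrier finite_subset by blast
  have "k * k * card {s \<in> {..<m}. 0 < deficit I s D (probed t) \<and> deficit I s D A = 0}
     \<le> 2 * (\<Sum>i\<in>A. potential I D (probed t) - potential I D (insert i (probed t)))"
    by (rule potential_gain[OF fin])
  also have "\<dots> \<le> 2 * (\<Sum>i\<in>A. ?g)"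
  proof (intro mult_le_mono2 sum_mono)
    fix i assume "i \<in> A"
    show "potential I D (probed t) - potential I D (insert i (probed t)) \<le> ?g"
    proof (cases "i \<in> probed t")
      case False
      then have "potential I D (insert (xs ! t) (probed t)) \<le> potential I D (insert i (probed t))"
        using greedy True \<open>i \<in> A\<close> A(1) unfolding greedy_order_def D[symmetric] by blast
      then show ?thesis using probed_Suc[OF True] by simp
    qed (simp add: insert_absorb)
  qed
  also have "\<dots> \<le> 2 * (D * ?g)" using A(2) by simp
  also have "\<dots> + 2 * D * potential I D (probed (Suc t)) = 2 * D * potential I D (probed t)"
    using le by (simp add: diff_mult_distrib2)
  finally show ?thesis by simp
next
  case False
  then have "probed t = boxes I" "probed (Suc t) = boxes I" using probed_all by auto
  \<comment> \<open>After the last box the order stands still, but then everything that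
    \<open>A\<close> covers is covered and the count is zero.\<close>
  moreover have "\<not> (0 < deficit I s D (boxes I) \<and> deficit I s D A = 0)" for s
    using deficit_antimono[OF A(1) order_refl[of D], of s] by linarith
  ultimately show ?thesis by simp
qed

text \<open>\<open>greedy_step\<close> telescopes over the phase. A scenario uncovered at the end
  was uncovered at every time \<open>t\<close> of the phase, so it is either counted in
  \<open>?N t\<close> or missed by \<open>A\<close> too.\<close>

lemma phase_progress:
  assumes A: "A \<subseteq> boxes I" "card A \<le> D" and "a \<le> b"
    and D: "\<And>t. a \<le> t \<Longrightarrow> t < b \<Longrightarrow> phase_budget \<alpha> t = D"
  shows "k * k * (b - a) * card (uncovered D (probed b))
    \<le> 2 * D * (card (uncovered D (probed a)) * pot (k * k) (k * k))
      + k * k * (b - a) * card (uncovered D A)"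
proof -
  let ?N = "\<lambda>t. {s \<in> {..<m}. 0 < deficit I s D (probed t) \<and> deficit I s D A = 0}"
  have "k * k * (\<Sum>t\<in>{a..<b}. card (?N t)) + 2 * D * potential I D (probed b)
      \<le> 2 * D * potential I D (probed a)"
    using \<open>a \<le> b\<close> D
  proof (induction b rule: dec_induct)
    case (step b)
    have "k * k * card (?N b) + 2 * D * potential I D (probed (Suc b)) \<le> 2 * D * potential I D (probed b)"
      using step by (intro greedy_step A) auto
    moreover have "k * k * (\<Sum>t\<in>{a..<b}. card (?N t)) + 2 * D * potential I D (probed b)
      \<le> 2 * D * potential I D (probed a)" using step by auto
    ultimately show ?case using step(1) by (simp add: add_mult_distrib2)
  qed simp
  moreover have "potential I D (probed a) \<le> card (uncovered D (probed a)) * pot (k * k) (k * k)"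
  proof -
    have "potential I D (probed a) \<le> (\<Sum>s<m. if 0 < deficit I s D (probed a) then pot (k * k) (k * k) else 0)"
      unfolding potential_def by (intro sum_mono) (auto simp: pot_mono deficit_le)
    then show ?thesis by (simp add: sum.If_cases Int_def)
  qed
  then have "2 * D * potential I D (probed a) \<le> 2 * D * (card (uncovered D (probed a)) * pot (k * k) (k * k))"
    by (rule mult_le_mono2)
  moreover have "k * k * (b - a) * card (uncovered D (probed b))
      \<le> k * k * (\<Sum>t\<in>{a..<b}. card (?N t)) + k * k * (b - a) * card (uncovered D A)"
  proof -
    have "(b - a) * card (uncovered D (probed b)) = (\<Sum>t\<in>{a..<b}. card (uncovered D (probed b)))"
      by simp
    also have "\<dots> \<le> (\<Sum>t\<in>{a..<b}. card (?N t) + card (uncovered D A))"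
    proof (intro sum_mono)
      fix t assume t: "t \<in> {a..<b}"
      have "uncovered D (probed b) \<subseteq> ?N t \<union> uncovered D A"
      proof
        fix s assume s: "s \<in> uncovered D (probed b)"
        have "deficit I s D (probed b) \<le> deficit I s D (probed t)"
          using t by (intro deficit_antimono probed_mono) auto
        then show "s \<in> ?N t \<union> uncovered D A" using s by auto
      qed
      then have "card (uncovered D (probed b)) \<le> card (?N t \<union> uncovered D A)"
        by (intro card_mono) auto
      also have "\<dots> \<le> card (?N t) + card (uncovered D A)" by (rule card_Un_le)
      finally show "card (uncovered D (probed b)) \<le> card (?N t) + card (uncovered D A)" .
    qed
    also have "\<dots> = (\<Sum>t\<in>{a..<b}. card (?N t)) + (b - a) * card (uncovered D A)"
      by (simp add: sum.distrib)
    finally have "k * k * ((b - a) * card (uncovered D (probed b)))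
      \<le> k * k * ((\<Sum>t\<in>{a..<b}. card (?N t)) + (b - a) * card (uncovered D A))"
      by (rule mult_le_mono2)
    then show ?thesis by (simp add: algebra_simps)
  qed
  ultimately show ?thesis by linarith
qed

abbreviation "missed j \<equiv> card (uncovered (2 ^ j) (probed (\<alpha> * 2 ^ j)))"

lemma \<alpha>_ge: "16 \<le> \<alpha>"
proof -
  have "16 * (k * k) \<le> \<alpha> * (k * k)" using \<alpha> le_pot[of "k * k"] rank_pos by (meson le_trans mult_le_mono2 nat_0_less_mult_iff)
  then show ?thesis using rank_pos by (simp only: mult_le_cancel2) simp
qed

text \<open>For \<open>j > 0\<close> the budget is \<open>2 ^ j\<close> and the phase lasts
  \<open>\<alpha> * 2 ^ (j - 1)\<close> steps, so \<open>2 * D\<close> is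
  \<open>4 / \<alpha>\<close> times its length; the factor 16 in the choice of
  \<open>\<alpha>\<close> then leaves a quarter. The first phase starts at time zero, so it is twice
  as long relative to its budget.\<close>

lemma quarter_missed:
  assumes A: "A \<subseteq> boxes I" "card A \<le> 2 ^ j"
  shows "4 * missed j \<le> (if j = 0 then m else missed (j - 1)) + 4 * card (uncovered (2 ^ j) A)"
proof -
  have cancel: "4 * u \<le> w + 4 * v"
    if "k * k * \<alpha> * u \<le> 4 * (w * pot (k * k) (k * k)) + k * k * \<alpha> * v" for u v w
  proof -
    have "16 * (w * pot (k * k) (k * k)) \<le> w * (\<alpha> * (k * k))"
      using mult_le_mono2[OF \<alpha>, of w] by (simp only: mult.left_commute)
    moreover have "4 * (k * k * \<alpha> * u) \<le> 16 * (w * pot (k * k) (k * k)) + 4 * (k * k * \<alpha> * v)"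
      using that by linarith
    moreover have "w * (\<alpha> * (k * k)) = k * k * \<alpha> * w" by (simp only: ac_simps)
    ultimately have "(k * k * \<alpha>) * (4 * u) \<le> (k * k * \<alpha>) * (w + 4 * v)"
      by (simp only: distrib_left mult.left_commute[of 4])
    moreover have "0 < k * k * \<alpha>" using rank_pos \<alpha>_ge by simp
    ultimately show ?thesis by (metis mult_le_cancel1)
  qed
  show ?thesis
  proof (cases j)
    case 0
    have "card (uncovered 1 (probed 0)) \<le> card {..<m}" by (intro card_mono) auto
    then have "2 * (card (uncovered 1 (probed 0)) * pot (k * k) (k * k)) \<le> 4 * (m * pot (k * k) (k * k))"
      by (intro mult_le_mono) auto
    moreover have "k * k * (\<alpha> - 0) * card (uncovered 1 (probed \<alpha>))
        \<le> 2 * 1 * (card (uncovered 1 (probed 0)) * pot (k * k) (k * k)) + k * k * (\<alpha> - 0) * card (uncovered 1 A)"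
      by (rule phase_progress) (use A 0 phase_budget_0 in auto)
    ultimately have "k * k * \<alpha> * card (uncovered 1 (probed \<alpha>))
        \<le> 4 * (m * pot (k * k) (k * k)) + k * k * \<alpha> * card (uncovered 1 A)"
      unfolding diff_zero by linarith
    from cancel[OF this] show ?thesis using 0 by simp
  next
    case (Suc i)
    let ?a = "\<alpha> * 2 ^ i" and ?b = "\<alpha> * 2 ^ Suc i" and ?D = "2 ^ Suc i :: nat"
    have "k * k * (?b - ?a) * card (uncovered ?D (probed ?b))
        \<le> 2 * ?D * (card (uncovered ?D (probed ?a)) * pot (k * k) (k * k))
          + k * k * (?b - ?a) * card (uncovered ?D A)"
      by (rule phase_progress) (use A Suc phase_budget_Suc[of \<alpha> i] in auto)
    \<comment> \<open>What the preceding phase covered within half the budget is also covered within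
      the present one.\<close>
    also have "card (uncovered ?D (probed ?a)) \<le> missed i"
    proof (rule card_mono)
      have "deficit I s ?D (probed ?a) \<le> deficit I s (2 ^ i) (probed ?a)" for s
        by (intro deficit_antimono) auto
      then show "uncovered ?D (probed ?a) \<subseteq> uncovered (2 ^ i) (probed ?a)"
        using less_le_trans by blast
    qed simp
    finally have "2 ^ i * (k * k * \<alpha> * missed (Suc i))
        \<le> 2 ^ i * (4 * (missed i * pot (k * k) (k * k)) + k * k * \<alpha> * card (uncovered ?D A))"
      by (simp add: algebra_simps)
    then have "k * k * \<alpha> * missed (Suc i)
        \<le> 4 * (missed i * pot (k * k) (k * k)) + k * k * \<alpha> * card (uncovered ?D A)"
      by (simp only: mult_le_cancel1) simp
    from cancel[OF this] show ?thesis using Suc by simp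
  qed
qed

end

section \<open>Summing the cover times over the phases\<close>

lemma sum_powers_below:
  fixes \<tau> :: real
  assumes "0 < \<tau>"
  shows "(\<Sum>j<J. if 2 ^ j < \<tau> then 2 ^ j else 0) \<le> 2 * \<tau>"
proof (induction J)
  case (Suc J)
  show ?case
  proof (cases "2 ^ J < \<tau>")
    case True
    have "(\<Sum>j<J. if 2 ^ j < \<tau> then 2 ^ j else 0) \<le> (\<Sum>j<J. 2 ^ j :: real)"
      by (intro sum_mono) auto
    also have "\<dots> \<le> 2 ^ J" by (induction J) auto
    finally show ?thesis using True by simp
  qed (use Suc in simp)
qed (use assms in simp)

context greedy_search
begin

definition cover_phase :: "nat \<Rightarrow> nat" where
  "cover_phase s = (LEAST j. deficit I s (2 ^ j) (probed (\<alpha> * 2 ^ j)) = 0)"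

text \<open>To be read with \<open>\<tau>\<close> as the cost of a competitor and \<open>A j\<close>
  as the boxes among its first \<open>2 ^ j\<close> probes. Let \<open>U j\<close> be the number
  missed by phase \<open>j\<close>, and \<open>V j\<close> the number with
  \<open>2 ^ j < \<tau> s\<close>. Weighting \<open>U j \<le> U (j - 1) / 4 + V j\<close> by
  \<open>2 ^ j\<close> makes the \<open>U\<close> terms on the right at most half of those on the
  left, so the recurrence can be solved for their sum.\<close>

lemma sum_cover_phase_le:
  fixes \<tau> :: "nat \<Rightarrow> real"
  assumes A: "\<And>j. A j \<subseteq> boxes I" "\<And>j. card (A j) \<le> 2 ^ j"
    and \<tau>: "\<And>s. s < m \<Longrightarrow> 1 \<le> \<tau> s"
    and cover: "\<And>s j. s < m \<Longrightarrow> \<tau> s \<le> 2 ^ j \<Longrightarrow> deficit I s (2 ^ j) (A j) = 0"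
  shows "2 * (\<Sum>s<m. 2 ^ cover_phase s) \<le> 11 * (\<Sum>s<m. \<tau> s)"
    and "s < m \<Longrightarrow> deficit I s (2 ^ cover_phase s) (probed (\<alpha> * 2 ^ cover_phase s)) = 0"
proof -
  \<comment> \<open>The \<open>LEAST\<close> in \<open>cover_phase\<close> needs a witness: for
    large \<open>j\<close> all boxes are probed and the budget exceeds
    \<open>\<tau> s\<close>.\<close>
  have ex: "\<exists>j. deficit I s (2 ^ j) (probed (\<alpha> * 2 ^ j)) = 0" if s: "s < m" for s
  proof -
    obtain j where j: "max (real n) (\<tau> s) < 2 ^ j" using real_arch_pow[of 2 "max (real n) (\<tau> s)"] by auto
    have "1 * 2 ^ j \<le> \<alpha> * 2 ^ j" using \<alpha>_ge by (intro mult_le_mono1) simp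
    moreover have "n \<le> 2 ^ j" using j by (simp add: of_nat_less_numeral_power_cancel_iff)
    ultimately have "probed (\<alpha> * 2 ^ j) = boxes I" by (intro probed_all) linarith
    moreover have "deficit I s (2 ^ j) (boxes I) \<le> deficit I s (2 ^ j) (A j)"
      using A by (intro deficit_antimono) auto
    ultimately show ?thesis using cover[OF s, of j] j by (intro exI[of _ j]) simp
  qed
  show "deficit I s (2 ^ cover_phase s) (probed (\<alpha> * 2 ^ cover_phase s)) = 0" if "s < m" for s
    unfolding cover_phase_def by (rule LeastI_ex[OF ex[OF that]])
  define J where "J = Suc (\<Sum>s<m. cover_phase s)"
  have J: "cover_phase s < J" if "s < m" for s
    unfolding J_def using member_le_sum[of s "{..<m}" cover_phase] that by (simp add: le_imp_less_Suc)
  \<comment> \<open>A scenario is charged \<open>2 ^ j\<close> for every phase \<open>j\<close>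
    before its cover phase, all of which leave it uncovered; the extra one sums to
    \<open>m\<close>.\<close>
  have geo: "(2::real) ^ p = 1 + (\<Sum>j<p. 2 ^ j)" for p :: nat by (induction p) auto
  let ?U = "\<lambda>j. real (missed j)"
  let ?V = "\<lambda>j. real (card {s \<in> {..<m}. 2 ^ j < \<tau> s})"
  have "(\<Sum>s<m. (2::real) ^ cover_phase s)
      \<le> (\<Sum>s<m. 1 + (\<Sum>j<J. 2 ^ j * of_bool (0 < deficit I s (2 ^ j) (probed (\<alpha> * 2 ^ j)))))"
  proof (intro sum_mono)
    fix s assume "s \<in> {..<m}"
    then have "s < m" by simp
    have "(\<Sum>j<cover_phase s. (2::real) ^ j)
        = (\<Sum>j<cover_phase s. 2 ^ j * of_bool (0 < deficit I s (2 ^ j) (probed (\<alpha> * 2 ^ j))))"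
      by (intro sum.cong refl) (auto simp: cover_phase_def dest: not_less_Least)
    also have "\<dots> \<le> (\<Sum>j<J. 2 ^ j * of_bool (0 < deficit I s (2 ^ j) (probed (\<alpha> * 2 ^ j))))"
      using J[OF \<open>s < m\<close>] by (intro sum_mono2) auto
    finally show "(2::real) ^ cover_phase s
        \<le> 1 + (\<Sum>j<J. 2 ^ j * of_bool (0 < deficit I s (2 ^ j) (probed (\<alpha> * 2 ^ j))))"
      using geo[of "cover_phase s"] by simp
  qed
  also have "\<dots> = real m + (\<Sum>j<J. 2 ^ j * ?U j)"
    unfolding sum.distrib by (subst sum.swap) (simp add: sum_distrib_left[symmetric] Int_def)
  finally have phases: "(\<Sum>s<m. (2::real) ^ cover_phase s) \<le> real m + (\<Sum>j<J. 2 ^ j * ?U j)" .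
  have "4 * ?U j \<le> (if j = 0 then real m else ?U (j - 1)) + 4 * ?V j" for j
  proof -
    have "uncovered (2 ^ j) (A j) \<subseteq> {s \<in> {..<m}. 2 ^ j < \<tau> s}"
    proof
      fix s assume s: "s \<in> uncovered (2 ^ j) (A j)"
      then have "\<not> \<tau> s \<le> 2 ^ j" using cover[of s j] by auto
      then show "s \<in> {s \<in> {..<m}. 2 ^ j < \<tau> s}" using s by simp
    qed
    then have "card (uncovered (2 ^ j) (A j)) \<le> card {s \<in> {..<m}. 2 ^ j < \<tau> s}"
      by (intro card_mono) auto
    then have "4 * missed j \<le> (if j = 0 then m else missed (j - 1)) + 4 * card {s \<in> {..<m}. 2 ^ j < \<tau> s}"
      using quarter_missed[OF A(1) A(2), of j] by linarith
    then have "real (4 * missed j)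
        \<le> real ((if j = 0 then m else missed (j - 1)) + 4 * card {s \<in> {..<m}. 2 ^ j < \<tau> s})"
      by (rule of_nat_mono)
    then show ?thesis by (simp split: if_splits)
  qed
  then have "(\<Sum>j<J. 2 ^ j * (4 * ?U j))
      \<le> (\<Sum>j<J. 2 ^ j * ((if j = 0 then real m else ?U (j - 1)) + 4 * ?V j))"
    by (intro sum_mono mult_left_mono) auto
  also have "\<dots> = (\<Sum>j<J. 2 ^ j * (if j = 0 then real m else ?U (j - 1))) + 4 * (\<Sum>j<J. 2 ^ j * ?V j)"
    by (simp add: distrib_left sum.distrib sum_distrib_left mult.left_commute)
  also have "(\<Sum>j<J. 2 ^ j * (if j = 0 then real m else ?U (j - 1)))
      = real m + (\<Sum>j<J-1. 2 ^ Suc j * ?U j)"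
    unfolding J_def by (subst sum.lessThan_Suc_shift) simp
  also have "(\<Sum>j<J-1. 2 ^ Suc j * ?U j) \<le> (\<Sum>j<J. 2 ^ Suc j * ?U j)"
    by (intro sum_mono2) auto
  also have "\<dots> = 2 * (\<Sum>j<J. 2 ^ j * ?U j)" by (simp add: sum_distrib_left mult.assoc)
  also have "(\<Sum>j<J. 2 ^ j * (4 * ?U j)) = 4 * (\<Sum>j<J. 2 ^ j * ?U j)"
    by (simp add: sum_distrib_left mult.left_commute)
  finally have missed: "2 * (\<Sum>j<J. 2 ^ j * ?U j) \<le> real m + 4 * (\<Sum>j<J. 2 ^ j * ?V j)" by linarith
  have "(\<Sum>j<J. 2 ^ j * ?V j) = (\<Sum>j<J. \<Sum>s<m. if 2 ^ j < \<tau> s then 2 ^ j else 0)"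
    by (intro sum.cong refl) (simp add: sum.If_cases Int_def)
  also have "\<dots> = (\<Sum>s<m. \<Sum>j<J. if 2 ^ j < \<tau> s then 2 ^ j else 0)" by (rule sum.swap)
  also have "\<dots> \<le> (\<Sum>s<m. 2 * \<tau> s)" 
  proof (intro sum_mono sum_powers_below)
    fix s assume "s \<in> {..<m}" then show "0 < \<tau> s" using \<tau>[of s] by simp
  qed
  finally have "(\<Sum>j<J. 2 ^ j * ?V j) \<le> 2 * (\<Sum>s<m. \<tau> s)" by (simp add: sum_distrib_left)
  moreover have "real m \<le> (\<Sum>s<m. \<tau> s)" using sum_mono[of "{..<m}" "\<lambda>_. 1" \<tau>] \<tau> by simp
  \<comment> \<open>By \<open>phases\<close> and \<open>missed\<close>, the left side is at most
    \<open>2 * m + m\<close> plus four times the sum of the \<open>2 ^ j * ?V j\<close>. These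
    contribute 3 and 8 times the sum of \<open>\<tau>\<close>.\<close>
  ultimately show "2 * (\<Sum>s<m. 2 ^ cover_phase s) \<le> 11 * (\<Sum>s<m. \<tau> s)"
    using phases missed by linarith
qed

end

subsection \<open>Stopping\<close>

definition prefix_basis :: "search_instance \<Rightarrow> nat list \<Rightarrow> nat \<Rightarrow> nat \<Rightarrow> nat set" where
  "prefix_basis I xs s t = cheapest_basis (indep_sets I) (\<lambda>i. box_cost I i s) (set (take t xs))"

text \<open>The ski-rental rule, with full rank tested by cardinality. Once all boxes are probed,
  stopping is allowed whatever the basis costs, so that a first stopping time always exists.\<close>

definition may_stop :: "search_instance \<Rightarrow> nat list \<Rightarrow> nat \<Rightarrow> nat \<Rightarrow> bool" where
  "may_stop I xs s t \<longleftrightarrow> num_boxes I \<le> t \<or>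
     card (prefix_basis I xs s t) = instance_rank I \<and>
     (\<Sum>i\<in>prefix_basis I xs s t. box_cost I i s) \<le> real t"

definition first_stop :: "search_instance \<Rightarrow> nat list \<Rightarrow> nat \<Rightarrow> nat" where
  "first_stop I xs s = (LEAST t. may_stop I xs s t)"

lemma may_stop_first_stop: "may_stop I xs s (first_stop I xs s)"
  unfolding first_stop_def by (rule LeastI[of _ "num_boxes I"]) (simp add: may_stop_def)

lemma first_stop_le: "may_stop I xs s t \<Longrightarrow> first_stop I xs s \<le> t"
  unfolding first_stop_def by (rule Least_le)

lemma first_stop_le_num_boxes: "first_stop I xs s \<le> num_boxes I"
  by (rule first_stop_le) (simp add: may_stop_def)

lemma observed_take:
  assumes "observed I xs s t = observed I xs s' t" "t' \<le> t"
  shows "observed I xs s t' = observed I xs s' t'"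
proof -
  have "observed I xs u t' = take t' (observed I xs u t)" for u
    using assms(2) by (simp add: observed_def take_map min_absorb1)
  then show ?thesis using assms(1) by simp
qed

lemma prefix_basis_cong:
  assumes "observed I xs s t = observed I xs s' t"
  shows "prefix_basis I xs s t = prefix_basis I xs s' t"
    and "(\<Sum>i\<in>prefix_basis I xs s t. box_cost I i s) = (\<Sum>i\<in>prefix_basis I xs s' t. box_cost I i s')"
proof -
  have eq: "box_cost I i s = box_cost I i s'" if "i \<in> set (take t xs)" for i
    using assms that by (simp add: observed_def)
  show *: "prefix_basis I xs s t = prefix_basis I xs s' t"
    unfolding prefix_basis_def by (intro cheapest_basis_cong eq)
  show "(\<Sum>i\<in>prefix_basis I xs s t. box_cost I i s) = (\<Sum>i\<in>prefix_basis I xs s' t. box_cost I i s')"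
    unfolding *[symmetric]
  proof (intro sum.cong refl eq)
    fix i assume "i \<in> prefix_basis I xs s t"
    then show "i \<in> set (take t xs)"
      unfolding prefix_basis_def by (rule subsetD[OF cheapest_basis_subset])
  qed
qed

lemma may_stop_cong:
  "observed I xs s t = observed I xs s' t \<Longrightarrow> may_stop I xs s t \<longleftrightarrow> may_stop I xs s' t"
  using prefix_basis_cong[of I xs s t s'] by (simp add: may_stop_def)

text \<open>Agreement is assumed only up to the stop of \<open>s'\<close>. Since \<open>s\<close>
  may stop there too, it stops no later, and up to its own stop the observations agree, which gives
  the other direction.\<close>

lemma first_stop_cong:
  assumes "observed I xs s (first_stop I xs s') = observed I xs s' (first_stop I xs s')"
  shows "first_stop I xs s = first_stop I xs s'"
proof (rule antisym)
  show le: "first_stop I xs s \<le> first_stop I xs s'"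
    using may_stop_cong[OF assms] may_stop_first_stop by (intro first_stop_le) blast
  show "first_stop I xs s' \<le> first_stop I xs s"
    using may_stop_cong[OF observed_take[OF assms le]] may_stop_first_stop by (intro first_stop_le) blast
qed

section \<open>The decision table and its cost\<close>

lemma map_of_map_pairs_eq_Some:
  assumes "\<And>s. s \<in> set ss \<Longrightarrow> f s = y \<Longrightarrow> g s = z" "s \<in> set ss" "f s = y"
  shows "map_of (map (\<lambda>s. (f s, g s)) ss) y = Some z"
  using assms by (induction ss) auto

lemma map_of_map_pairs_eq_None:
  "map_of (map (\<lambda>s. (f s, g s)) ss) y = None \<longleftrightarrow> (\<forall>s\<in>set ss. f s \<noteq> y)"
  by (induction ss) auto

context search
begin

text \<open>Rows of the table with equal keys must not conflict. A key is an observation list and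
  its length is the stopping time, so equal keys mean equal times and, as the basis depends only on
  observed costs, equal selections.\<close>

lemma table_strategy:
  assumes xs: "distinct xs" "set xs = boxes I"
    and order: "\<And>j. j < n \<Longrightarrow> nmem \<sigma> ''order'' j 0 = xs ! j"
    and stop: "\<And>s. s < m \<Longrightarrow> nmem \<sigma> ''stop'' s 0 = first_stop I xs s"
    and select: "\<And>s. s < m \<Longrightarrow>
      {i \<in> boxes I. nmem \<sigma> ''select'' s i \<noteq> 0} = prefix_basis I xs s (first_stop I xs s)"
  shows "output_strategy I \<sigma> \<in> pa_strategies I"
    and "s < m \<Longrightarrow> total_cost I (output_strategy I \<sigma>) s
      = real (first_stop I xs s) + (\<Sum>i\<in>prefix_basis I xs s (first_stop I xs s). cost s i)"
proof -
  let ?\<pi> = "output_strategy I \<sigma>"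
  let ?T = "first_stop I xs"
  have len: "length xs = n" using xs distinct_card[of xs] card_boxes by simp
  have "map (\<lambda>j. nmem \<sigma> ''order'' j 0) [0..<n] = xs"
    by (rule nth_equalityI) (use order len in auto)
  then have \<pi>: "probe_order ?\<pi> = xs"
    "decide ?\<pi> = map_of (map (\<lambda>s. (observed I xs s (?T s), prefix_basis I xs s (?T s))) [0..<m])"
    using stop select by (auto simp: output_strategy_def Let_def intro!: arg_cong[where f = map_of])
  have at_stop: "decision_at I ?\<pi> s (?T s) = Some (prefix_basis I xs s (?T s))" if s: "s < m" for s
    unfolding decision_at_def \<pi>
  proof (rule map_of_map_pairs_eq_Some)
    fix s' assume s': "observed I xs s' (?T s') = observed I xs s (?T s)"
    have "length (observed I xs u (?T u)) = ?T u" for u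
      using first_stop_le_num_boxes[of I xs u] len by (simp add: observed_def)
    then have "?T s' = ?T s" using s' by metis
    then show "prefix_basis I xs s' (?T s') = prefix_basis I xs s (?T s)"
      using s' prefix_basis_cong(1)[of I xs s' "?T s" s] by simp
  qed (use s in auto)
  \<comment> \<open>An earlier match would be the row of some \<open>s'\<close> that stops at
    \<open>t\<close> and looks like \<open>s\<close> until then; by \<open>first_stop_cong\<close>,
    \<open>s\<close> would stop at \<open>t\<close> as well.\<close>
  have before: "?T s \<le> t" if s: "decision_at I ?\<pi> s t \<noteq> None" for s t
  proof (rule ccontr)
    assume t: "\<not> ?T s \<le> t"
    obtain s' where s': "observed I xs s' (?T s') = observed I xs s t"
      using s unfolding decision_at_def \<pi> map_of_map_pairs_eq_None by auto
    have "length (observed I xs s' (?T s')) = ?T s'" "length (observed I xs s t) = t"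
      using first_stop_le_num_boxes[of I xs s'] first_stop_le_num_boxes[of I xs s] t len
      by (simp_all add: observed_def)
    then have t_eq: "t = ?T s'" using s' by simp
    have "?T s = ?T s'" by (rule first_stop_cong) (use s' t_eq in simp)
    then show False using t t_eq by simp
  qed
  have T: "stop_time I ?\<pi> s = ?T s" if "s < m" for s
    unfolding stop_time_def
  proof (rule Least_equality)
    show "decision_at I ?\<pi> s (?T s) \<noteq> None" using at_stop[OF that] by simp
  qed (rule before)
  have sel: "selected I ?\<pi> s = prefix_basis I xs s (?T s)" if "s < m" for s
    unfolding selected_def T[OF that] at_stop[OF that] by simp
  show "s < m \<Longrightarrow> total_cost I ?\<pi> s
      = real (?T s) + (\<Sum>i\<in>prefix_basis I xs s (?T s). cost s i)"
    by (simp add: total_cost_def T sel)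
  have basis: "matroid_basis (indep_sets I) (prefix_basis I xs s (?T s))" for s
  proof -
    have "card (prefix_basis I xs s (?T s)) = k"
    proof (cases "n \<le> ?T s")
      case True
      then have "set (take (?T s) xs) = boxes I" using xs len by simp
      then show ?thesis by (simp add: prefix_basis_def indep_cheapest_basis k_eq finite_carrier)
    next
      case False
      then show ?thesis using may_stop_first_stop[of I xs s] by (simp add: may_stop_def)
    qed
    then show ?thesis
      by (simp add: matroid_basis_iff prefix_basis_def indep_cheapest_basis k_eq)
  qed
  show "?\<pi> \<in> pa_strategies I"
    unfolding pa_strategies_def
  proof (intro CollectI conjI allI impI)
    fix s assume s: "s < m"
    show "\<exists>t\<le>n. decision_at I ?\<pi> s t \<noteq> None"
      using at_stop[OF s] first_stop_le_num_boxes by blast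
    show "selected I ?\<pi> s \<subseteq> set (take (stop_time I ?\<pi> s) (probe_order ?\<pi>))"
      unfolding T[OF s] sel[OF s] \<pi> prefix_basis_def by (rule cheapest_basis_subset)
    show "matroid_basis (indep_sets I) (selected I ?\<pi> s)" unfolding sel[OF s] by (rule basis)
  qed (use \<pi> xs in auto)
qed

text \<open>From time \<open>t\<close> on, a basis of cost at most \<open>2 * D\<close> is at hand.
  If the rule stops by then, the basis costs no more than the time spent, or all boxes are probed
  and it is the basis of time \<open>t\<close>. If it stops later, the time one step before was
  still below the basis cost, hence below \<open>2 * D\<close>.\<close>

lemma stop_cost_le:
  assumes xs: "set xs = boxes I" "length xs = n" and s: "s < m"
    and t: "1 \<le> t" and D: "0 < D" and cov: "deficit I s D (set (take t xs)) = 0"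
  shows "real (first_stop I xs s) + (\<Sum>i\<in>prefix_basis I xs s (first_stop I xs s). cost s i)
    \<le> 2 * (real t + 2 * real D)"
proof -
  let ?T = "first_stop I xs s"
  let ?B = "\<lambda>t. \<Sum>i\<in>prefix_basis I xs s t. cost s i"
  have "k * k \<le> level_rank (indep_sets I) k (cost s) D (set (take t xs))"
    using cov by (simp add: deficit_def)
  then have full: "rk (set (take t xs)) = k" and Bt: "?B t \<le> 2 * real D"
    using cheapest_basis_if_level_rank_ge[of "set (take t xs)" k D "cost s"] k_eq rank_pos D
    by (simp_all add: prefix_basis_def)
  have full': "rk (set (take u xs)) = k" and anti: "?B u \<le> ?B t" if "t \<le> u" for u
  proof -
    have sub: "set (take t xs) \<subseteq> set (take u xs)" using that by (rule set_take_subset_set_take)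
    show r: "rk (set (take u xs)) = k"
      using rank_mono[OF sub] rank_le_rank_carrier[of "set (take u xs)"] full k_eq by simp
    show "?B u \<le> ?B t"
      unfolding prefix_basis_def using sub r full by (intro sum_cheapest_basis_antimono) auto
  qed
  have B_nonneg: "0 \<le> ?B u" for u
  proof (intro sum_nonneg)
    fix i assume "i \<in> prefix_basis I xs s u"
    then have "i \<in> set xs"
      unfolding prefix_basis_def using cheapest_basis_subset[of _ _ "set (take u xs)"] by (meson in_set_takeD subsetD)
    then show "0 \<le> cost s i" using cost_nonneg[OF s] xs by simp
  qed
  consider "n \<le> ?T" "?T \<le> t" | "?T < n" "?T \<le> t" | "t < ?T" by linarith
  then show ?thesis
  proof cases
    case 1
    then have "prefix_basis I xs s ?T = prefix_basis I xs s t"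
      using xs by (simp add: prefix_basis_def)
    then show ?thesis using 1 Bt by simp
  next
    case 2
    then have "?B ?T \<le> real ?T" using may_stop_first_stop[of I xs s] by (simp add: may_stop_def)
    then show ?thesis using 2 by simp
  next
    \<comment> \<open>The rank is full at \<open>u\<close>, so not stopping there can only mean that
      the basis was too expensive. The extra step from \<open>u\<close> to \<open>?T\<close> is
      absorbed by \<open>1 \<le> t\<close>.\<close>
    case 3
    then obtain u where u: "?T = Suc u" "t \<le> u" by (cases ?T) auto
    then have "\<not> may_stop I xs s u" using first_stop_le[of I xs s u] by auto
    then have "real u < ?B u"
      using full'[OF u(2)] by (auto simp: may_stop_def prefix_basis_def indep_cheapest_basis not_le)
    also have "\<dots> \<le> 2 * real D" using anti[OF u(2)] Bt by simp
    finally have "real ?T \<le> 2 * real D + 1" using u(1) by simp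
    moreover have "?B ?T \<le> 2 * real D" using anti[of ?T] 3 Bt by simp
    ultimately show ?thesis using t by simp
  qed
qed

text \<open>The total cost bounds both the stopping time and the price of the selected basis, so the
  single number \<open>D\<close> can serve as time limit and as budget.\<close>

lemma pa_strategy_covers:
  assumes \<pi>: "\<pi> \<in> pa_strategies I" and s: "s < m"
  shows "1 \<le> total_cost I \<pi> s"
    and "total_cost I \<pi> s \<le> real D \<Longrightarrow> deficit I s D (set (take D (probe_order \<pi>))) = 0"
proof -
  let ?B = "selected I \<pi> s" and ?t = "stop_time I \<pi> s"
  have B: "?B \<subseteq> set (take ?t (probe_order \<pi>))" "indep_sets I ?B" "card ?B = k"
    using \<pi> s unfolding pa_strategies_def matroid_basis_iff k_eq by blast+
  have nonneg: "0 \<le> cost s i" if "i \<in> ?B" for i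
    using cost_nonneg[OF s] indep_subset_carrier[OF B(2)] that by blast
  then have sum: "0 \<le> sum (cost s) ?B" by (intro sum_nonneg)
  have "k \<le> card (set (take ?t (probe_order \<pi>)))" using card_mono[OF _ B(1)] B(3) by simp
  also have "\<dots> \<le> ?t" using card_length[of "take ?t (probe_order \<pi>)"] by simp
  finally have "k \<le> ?t" .
  then have t: "1 \<le> ?t" using rank_pos by linarith
  with sum show "1 \<le> total_cost I \<pi> s" by (simp add: total_cost_def)
  assume le: "total_cost I \<pi> s \<le> real D"
  then have "?t \<le> D" "sum (cost s) ?B \<le> real D" using sum by (simp_all add: total_cost_def)
  then have "k * k \<le> level_rank (indep_sets I) k (cost s) D (set (take D (probe_order \<pi>)))"
    using t \<open>?t \<le> D\<close>
      order_trans[OF B(1) set_take_subset_set_take[of ?t D "probe_order \<pi>"]]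
    by (intro level_rank_ge_if_cheap_indep[OF B(2) _ B(3) _ nonneg]) simp_all
  then show "deficit I s D (set (take D (probe_order \<pi>))) = 0" by (simp add: deficit_def)
qed

end

lemma (in greedy_search) stop_cost_le_any_strategy:
  assumes \<pi>: "\<pi> \<in> pa_strategies I"
  shows "(\<Sum>s<m. real (first_stop I xs s) + (\<Sum>i\<in>prefix_basis I xs s (first_stop I xs s). cost s i))
    \<le> 11 * (real \<alpha> + 2) * (\<Sum>s<m. total_cost I \<pi> s)"
proof -
  let ?A = "\<lambda>j. set (take (2 ^ j) (probe_order \<pi>))"
  have A: "?A j \<subseteq> boxes I" "card (?A j) \<le> 2 ^ j" for j
  proof -
    have "set (probe_order \<pi>) = boxes I" using \<pi> by (simp add: pa_strategies_def)
    then show "?A j \<subseteq> boxes I" using set_take_subset[of "2 ^ j" "probe_order \<pi>"] by simp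
    show "card (?A j) \<le> 2 ^ j" by (rule order_trans[OF card_length]) simp
  qed
  have cover: "s < m \<Longrightarrow> total_cost I \<pi> s \<le> 2 ^ j \<Longrightarrow> deficit I s (2 ^ j) (?A j) = 0" for s j
    using pa_strategy_covers(2)[OF \<pi>, of s "2 ^ j"] by simp
  have phases: "2 * (\<Sum>s<m. 2 ^ cover_phase s) \<le> 11 * (\<Sum>s<m. total_cost I \<pi> s)"
    "s < m \<Longrightarrow> deficit I s (2 ^ cover_phase s) (probed (\<alpha> * 2 ^ cover_phase s)) = 0" for s
    using sum_cover_phase_le[of ?A "total_cost I \<pi>"] A cover pa_strategy_covers(1)[OF \<pi>] by blast+
  have "(\<Sum>s<m. real (first_stop I xs s) + (\<Sum>i\<in>prefix_basis I xs s (first_stop I xs s). cost s i))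
      \<le> (\<Sum>s<m. 2 * ((real \<alpha> + 2) * 2 ^ cover_phase s))"
  proof (intro sum_mono)
    fix s assume "s \<in> {..<m}"
    then have s: "s < m" by simp
    have "1 * 1 \<le> \<alpha> * 2 ^ cover_phase s" using \<alpha>_ge by (intro mult_le_mono) auto
    with stop_cost_le[OF xs(2,3) s, of "\<alpha> * 2 ^ cover_phase s" "2 ^ cover_phase s"] phases(2)[OF s]
    show "real (first_stop I xs s) + (\<Sum>i\<in>prefix_basis I xs s (first_stop I xs s). cost s i)
        \<le> 2 * ((real \<alpha> + 2) * 2 ^ cover_phase s)"
      by (simp add: algebra_simps)
  qed
  \<comment> \<open>The two lost by the stopping rule is the factor kept on the left of
    \<open>sum_cover_phase_le\<close>.\<close>
  also have "\<dots> = (real \<alpha> + 2) * (2 * (\<Sum>s<m. 2 ^ cover_phase s))"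
    by (simp add: sum_distrib_left mult.left_commute)
  also have "\<dots> \<le> (real \<alpha> + 2) * (11 * (\<Sum>s<m. total_cost I \<pi> s))"
    using phases(1) by (intro mult_left_mono) auto
  finally show ?thesis by (simp only: ac_simps)
qed

section \<open>Comparison with randomized strategies\<close>

text \<open>These bounds provide integrability. The support of a randomized strategy may be
  infinite, since decision rules can differ on lists that are never observed.\<close>

lemma (in search) bounds_scenario_average_cost:
  assumes \<pi>: "\<pi> \<in> pa_strategies I"
  shows "0 \<le> scenario_average_cost I \<pi>"
    and "scenario_average_cost I \<pi> \<le> (\<Sum>s<m. real n + sum (cost s) (boxes I)) / real m"
proof -
  have "0 \<le> total_cost I \<pi> s \<and> total_cost I \<pi> s \<le> real n + sum (cost s) (boxes I)" if s: "s < m" for s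
  proof
    show "0 \<le> total_cost I \<pi> s" using pa_strategy_covers(1)[OF \<pi> s] by simp
    have "\<exists>t\<le>n. decision_at I \<pi> s t \<noteq> None" and "indep_sets I (selected I \<pi> s)"
      using \<pi> s unfolding pa_strategies_def matroid_basis_iff by blast+
    then obtain t where "t \<le> n" "decision_at I \<pi> s t \<noteq> None" by blast
    then have "stop_time I \<pi> s \<le> n"
      unfolding stop_time_def using Least_le[of "\<lambda>t. decision_at I \<pi> s t \<noteq> None" t] by linarith
    moreover have "sum (cost s) (selected I \<pi> s) \<le> sum (cost s) (boxes I)"
      using indep_subset_carrier[OF \<open>indep_sets I (selected I \<pi> s)\<close>] cost_nonneg[OF s]
      by (intro sum_mono2 finite_carrier) auto
    ultimately show "total_cost I \<pi> s \<le> real n + sum (cost s) (boxes I)"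
      by (simp add: total_cost_def)
  qed
  then show "0 \<le> scenario_average_cost I \<pi>"
    "scenario_average_cost I \<pi> \<le> (\<Sum>s<m. real n + sum (cost s) (boxes I)) / real m"
    unfolding scenario_average_cost_def
    by (auto intro!: divide_right_mono divide_nonneg_nonneg sum_nonneg sum_mono)
qed

lemma (in search) le_pa_opt:
  assumes ex: "pa_strategies I \<noteq> {}"
    and le: "\<And>\<pi>. \<pi> \<in> pa_strategies I \<Longrightarrow> c \<le> scenario_average_cost I \<pi>"
  shows "c \<le> pa_opt I"
  unfolding pa_opt_def
proof (rule cINF_greatest)
  obtain \<pi> where "\<pi> \<in> pa_strategies I" using ex by blast
  then have "return_pmf \<pi> \<in> randomized_pa_strategies I" by (simp add: randomized_pa_strategies_def)
  then show "randomized_pa_strategies I \<noteq> {}" by blast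
next
  fix Q assume "Q \<in> randomized_pa_strategies I"
  then have Q: "\<pi> \<in> pa_strategies I" if "\<pi> \<in> set_pmf Q" for \<pi>
    using that by (auto simp: randomized_pa_strategies_def)
  \<comment> \<open>Without integrability the expectation would be the default value 0.\<close>
  have "integrable Q (scenario_average_cost I)"
    by (rule measure_pmf.integrable_const_bound[where B = "(\<Sum>s<m. real n + sum (cost s) (boxes I)) / real m"])
      (auto simp: AE_measure_pmf_iff dest!: Q intro: bounds_scenario_average_cost
        simp: abs_of_nonneg[OF bounds_scenario_average_cost(1)])
  then show "c \<le> expected_total_cost I Q"
    unfolding expected_total_cost_def
    by (rule measure_pmf.integral_ge_const) (auto simp: AE_measure_pmf_iff dest!: Q intro: le)
qed

lemma (in greedy_search) table_strategy_cost_le: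
  assumes \<pi>: "\<pi> \<in> pa_strategies I"
    and cost: "\<And>s. s < m \<Longrightarrow> total_cost I \<pi> s
      = real (first_stop I xs s) + (\<Sum>i\<in>prefix_basis I xs s (first_stop I xs s). cost s i)"
  shows "expected_total_cost I (return_pmf \<pi>) \<le> 11 * (real \<alpha> + 2) * pa_opt I"
proof -
  have "scenario_average_cost I \<pi> / (11 * (real \<alpha> + 2)) \<le> pa_opt I"
  proof (rule le_pa_opt)
    fix \<pi>' assume "\<pi>' \<in> pa_strategies I"
    then have "(\<Sum>s<m. total_cost I \<pi> s) \<le> 11 * (real \<alpha> + 2) * (\<Sum>s<m. total_cost I \<pi>' s)"
      using stop_cost_le_any_strategy cost by (simp cong: sum.cong_simp)
    then have "scenario_average_cost I \<pi> \<le> 11 * (real \<alpha> + 2) * scenario_average_cost I \<pi>'"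
      using m_pos by (simp add: scenario_average_cost_def divide_simps)
    then show "scenario_average_cost I \<pi> / (11 * (real \<alpha> + 2)) \<le> scenario_average_cost I \<pi>'"
      by (subst pos_divide_le_eq) (auto simp: mult.commute)
  qed (use \<pi> in blast)
  then have "scenario_average_cost I \<pi> \<le> 11 * (real \<alpha> + 2) * pa_opt I"
    by (subst (asm) pos_divide_le_eq) (auto simp: mult.commute)
  then show ?thesis by (simp add: expected_total_cost_def)
qed

lemma phase_factor_le_ln:
  assumes k: "2 \<le> (k::nat)" and \<alpha>: "\<alpha> * (k * k) \<le> 16 * pot (k * k) (k * k) + 16 * (k * k)"
  shows "11 * (real \<alpha> + 2) \<le> 1100 * ln (real k)"
proof -
  have kk: "0 < real (k * k)" using k by simp
  have "real (\<alpha> * (k * k)) \<le> real (16 * pot (k * k) (k * k) + 16 * (k * k))"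
    using \<alpha> by (rule of_nat_mono)
  also have "\<dots> = 16 * real (pot (k * k) (k * k)) + 16 * real (k * k)" by simp
  also have "\<dots> \<le> 16 * (real (k * k) * (1 + ln (real (k * k)))) + 16 * real (k * k)"
    using pot_le_ln[of "k * k"] k by simp
  also have "\<dots> = (32 + 16 * ln (real (k * k))) * real (k * k)" by (simp only: algebra_simps)
  finally have "real \<alpha> * real (k * k) \<le> (32 + 16 * ln (real (k * k))) * real (k * k)" by simp
  then have "real \<alpha> \<le> 32 + 16 * ln (real (k * k))" by (rule mult_right_le_imp_le[OF _ kk])
  also have "ln (real (k * k)) = 2 * ln (real k)" using k by (simp add: ln_mult)
  finally have "real \<alpha> \<le> 32 + 32 * ln (real k)" by simp
  moreover have "1 / 2 \<le> ln (real k)"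
  proof -
    have "ln (1 / 2 :: real) \<le> 1 / 2 - 1" by (rule ln_le_minus_one) simp
    then have "1 / 2 \<le> ln (2 :: real)" by (simp add: ln_div)
    also have "\<dots> \<le> ln (real k)" using k by simp
    finally show ?thesis .
  qed
  \<comment> \<open>Since \<open>1 \<le> 2 * ln k\<close>, the term \<open>34 + 32 * ln k\<close> is
    at most \<open>(68 + 32) * ln k\<close>.\<close>
  ultimately show ?thesis by argo
qed

section \<open>Deterministic execution in bounded time\<close>

text \<open>Runs without coin flips: every step is a point distribution. In the semantics
  \<open>Skip\<close> steps to itself; excluding that makes \<open>Skip\<close> final and lets runs
  be lifted under \<open>Seq\<close>, which discards a finished first component.\<close>

inductive nsteps :: "(nat set \<Rightarrow> nat) \<Rightarrow> nat \<Rightarrow> com \<Rightarrow> memory \<Rightarrow> com \<Rightarrow> memory \<Rightarrow> bool" for r where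
  nsteps_0: "nsteps r 0 c \<sigma> c \<sigma>"
| nsteps_Suc: "c \<noteq> Skip \<Longrightarrow> step r c \<sigma> = return_pmf (c', \<sigma>') \<Longrightarrow> nsteps r t c' \<sigma>' c'' \<sigma>''
    \<Longrightarrow> nsteps r (Suc t) c \<sigma> c'' \<sigma>''"

lemma nsteps_trans:
  "nsteps r t c \<sigma> c' \<sigma>' \<Longrightarrow> nsteps r t' c' \<sigma>' c'' \<sigma>'' \<Longrightarrow> nsteps r (t + t') c \<sigma> c'' \<sigma>''"
  by (induction rule: nsteps.induct) (auto intro: nsteps.intros)

lemma nsteps_1: "c \<noteq> Skip \<Longrightarrow> step r c \<sigma> = return_pmf (c', \<sigma>') \<Longrightarrow> nsteps r 1 c \<sigma> c' \<sigma>'"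
  by (metis One_nat_def nsteps_0 nsteps_Suc)

lemma nsteps_Seq: "nsteps r t c \<sigma> c' \<sigma>' \<Longrightarrow> nsteps r t (Seq c d) \<sigma> (Seq c' d) \<sigma>'"
  by (induction rule: nsteps.induct) (auto intro!: nsteps.intros)

lemma steps_Skip: "steps r T Skip \<sigma> = return_pmf (Skip, \<sigma>)"
  by (induction T) (simp_all add: bind_return_pmf)

text \<open>A halted configuration repeats itself, so a halting run of length \<open>t\<close> fixes
  the outcome for every larger number of steps.\<close>

lemma steps_if_nsteps:
  "nsteps r t c \<sigma> Skip \<sigma>' \<Longrightarrow> t \<le> T \<Longrightarrow> steps r T c \<sigma> = return_pmf (Skip, \<sigma>')"
proof (induction t c \<sigma> Skip \<sigma>' arbitrary: T rule: nsteps.induct)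
  case (nsteps_0 \<sigma>)
  show ?case by (rule steps_Skip)
next
  case (nsteps_Suc c \<sigma> c' \<sigma>' t \<sigma>'')
  then obtain T' where "T = Suc T'" "t \<le> T'" by (cases T) auto
  with nsteps_Suc show ?case by (simp add: bind_return_pmf)
qed

text \<open>Bounds the running time provided that every loop, each time it is entered, makes at most \<open>B\<close>
  iterations.\<close>

fun time_bound :: "nat \<Rightarrow> com \<Rightarrow> nat" where
  "time_bound B (Seq c d) = time_bound B c + 1 + time_bound B d"
| "time_bound B (Cond b c d) = 1 + time_bound B c + time_bound B d"
| "time_bound B (While b c) = B * (time_bound B c + 2) + 1"
| "time_bound B c = 1"

lemma time_bound_polynomial: "\<exists>a d. \<forall>B. time_bound B c \<le> a * B ^ d + a"
proof -
  have mono: "a * B ^ d + a \<le> a' * Suc B ^ d'" if "2 * a \<le> a'" "d \<le> d'" for a a' d d' B :: nat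
  proof -
    have "B ^ d \<le> Suc B ^ d'" "1 \<le> Suc B ^ d'"
      using order_trans[OF power_mono[of B "Suc B" d] power_increasing[OF that(2), of "Suc B"]] by auto
    then have "a * B ^ d + a * 1 \<le> a * Suc B ^ d' + a * Suc B ^ d'"
      by (intro add_mono mult_le_mono2)
    also have "\<dots> = 2 * a * Suc B ^ d'" by simp
    also have "\<dots> \<le> a' * Suc B ^ d'" using that by (intro mult_le_mono1)
    finally show ?thesis by simp
  qed
  \<comment> \<open>Bounds of this form are closed under sums and products because
    \<open>Suc B\<close> is at least one; only afterwards are they turned into polynomials in
    \<open>B\<close>.\<close>
  have "\<exists>a d. \<forall>B. time_bound B c \<le> a * Suc B ^ d"
  proof (induction c)
    case (Seq c1 c2)
    then obtain a1 d1 a2 d2 where *: "\<And>B. time_bound B c1 \<le> a1 * Suc B ^ d1"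
      "\<And>B. time_bound B c2 \<le> a2 * Suc B ^ d2" by blast
    show ?case
    proof (intro exI allI)
      fix B
      have "a1 * Suc B ^ d1 \<le> a1 * Suc B ^ (d1 + d2)" "a2 * Suc B ^ d2 \<le> a2 * Suc B ^ (d1 + d2)"
        "1 \<le> 1 * Suc B ^ (d1 + d2)"
        by (intro mult_le_mono2 power_increasing; simp)+ simp
      then show "time_bound B (Seq c1 c2) \<le> (a1 + a2 + 1) * Suc B ^ (d1 + d2)"
        using *[of B] by (simp only: time_bound.simps distrib_right)
    qed
  next
    case (Cond b c1 c2)
    then obtain a1 d1 a2 d2 where *: "\<And>B. time_bound B c1 \<le> a1 * Suc B ^ d1"
      "\<And>B. time_bound B c2 \<le> a2 * Suc B ^ d2" by blast
    show ?case
    proof (intro exI allI)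
      fix B
      have "a1 * Suc B ^ d1 \<le> a1 * Suc B ^ (d1 + d2)" "a2 * Suc B ^ d2 \<le> a2 * Suc B ^ (d1 + d2)"
        "1 \<le> 1 * Suc B ^ (d1 + d2)"
        by (intro mult_le_mono2 power_increasing; simp)+ simp
      then show "time_bound B (Cond b c1 c2) \<le> (a1 + a2 + 1) * Suc B ^ (d1 + d2)"
        using *[of B] by (simp only: time_bound.simps distrib_right)
    qed
  next
    case (While b c)
    then obtain a d where *: "\<And>B. time_bound B c \<le> a * Suc B ^ d" by blast
    show ?case
    proof (intro exI allI)
      fix B
      have "B * (time_bound B c + 2) + 1 \<le> Suc B * (time_bound B c + 2)" by simp
      also have "\<dots> \<le> Suc B * (a * Suc B ^ d + 2 * Suc B ^ d)"
        using *[of B] by (intro mult_le_mono2 add_mono) auto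
      finally show "time_bound B (While b c) \<le> (a + 2) * Suc B ^ Suc d"
        by (simp only: time_bound.simps power_Suc distrib_left distrib_right ac_simps)
    qed
  qed (auto intro!: exI[of _ 1])
  then obtain a d where *: "\<And>B. time_bound B c \<le> a * Suc B ^ d" by blast
  have "Suc B ^ d \<le> 2 ^ d * B ^ d + 2 ^ d" for B
  proof (cases "B = 0")
    case False
    then have "Suc B ^ d \<le> (2 * B) ^ d" by (intro power_mono) auto
    then show ?thesis by (simp add: power_mult_distrib)
  qed (simp add: trans_le_add2)
  then have "a * Suc B ^ d \<le> a * (2 ^ d * B ^ d + 2 ^ d)" for B by (rule mult_le_mono2)
  then have "time_bound B c \<le> a * 2 ^ d * B ^ d + a * 2 ^ d" for B
    using order_trans[OF *[of B]] by (simp only: distrib_left mult.assoc)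
  then show ?thesis by blast
qed

text \<open>Total correctness with the running time built in, so that the only timing obligation
  left to a proof is the iteration bound of each loop.\<close>

definition wp :: "(nat set \<Rightarrow> nat) \<Rightarrow> nat \<Rightarrow> com \<Rightarrow> (memory \<Rightarrow> bool) \<Rightarrow> memory \<Rightarrow> bool" where
  "wp r B c Q \<sigma> \<longleftrightarrow> (\<exists>\<sigma>' t. t \<le> time_bound B c \<and> nsteps r t c \<sigma> Skip \<sigma>' \<and> Q \<sigma>')"

lemma wp_mono: "wp r B c Q \<sigma> \<Longrightarrow> (\<And>\<sigma>'. Q \<sigma>' \<Longrightarrow> Q' \<sigma>') \<Longrightarrow> wp r B c Q' \<sigma>"
  unfolding wp_def by blast

lemma wp_Skip: "Q \<sigma> \<Longrightarrow> wp r B Skip Q \<sigma>"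
  unfolding wp_def by (intro exI[of _ \<sigma>] exI[of _ 0]) (simp add: nsteps_0)

lemma wp_step: 
  assumes "c \<noteq> Skip" "step r c \<sigma> = return_pmf (Skip, \<sigma>')" "1 \<le> time_bound B c" "Q \<sigma>'"
  shows "wp r B c Q \<sigma>"
  unfolding wp_def using assms nsteps_1[OF assms(1,2)] by blast

lemma wp_NSet: "Q (nwrite a (nval e1 \<sigma>) (nval e2 \<sigma>) (nval e \<sigma>) \<sigma>) \<Longrightarrow> wp r B (NSet a e1 e2 e) Q \<sigma>"
  by (rule wp_step) simp_all

lemma wp_RSet: "Q (rwrite a (nval e1 \<sigma>) (nval e2 \<sigma>) (rval e \<sigma>) \<sigma>) \<Longrightarrow> wp r B (RSet a e1 e2 e) Q \<sigma>"
  by (rule wp_step) simp_all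

lemma wp_Query:
  "Q (nwrite a (nval e1 \<sigma>) (nval e2 \<sigma>) (r {i. nmem \<sigma> q (nval e \<sigma>) i \<noteq> 0}) \<sigma>)
    \<Longrightarrow> wp r B (Query a e1 e2 q e) Q \<sigma>"
  by (rule wp_step) simp_all

lemma wp_Seq: "wp r B c (wp r B d Q) \<sigma> \<Longrightarrow> wp r B (Seq c d) Q \<sigma>"
proof -
  assume "wp r B c (wp r B d Q) \<sigma>"
  then obtain \<sigma>' t \<sigma>'' t' where *: "t \<le> time_bound B c" "nsteps r t c \<sigma> Skip \<sigma>'"
    "t' \<le> time_bound B d" "nsteps r t' d \<sigma>' Skip \<sigma>''" "Q \<sigma>''" by (auto simp: wp_def)
  have "nsteps r 1 (Seq Skip d) \<sigma>' d \<sigma>'" by (rule nsteps_1) simp_all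
  from nsteps_trans[OF nsteps_Seq[OF *(2)] nsteps_trans[OF this *(4)]]
  have "nsteps r (t + (1 + t')) (Seq c d) \<sigma> Skip \<sigma>''" .
  moreover have "t + (1 + t') \<le> time_bound B (Seq c d)" using * by simp
  ultimately show ?thesis using *(5) unfolding wp_def by blast
qed

lemma wp_Cond:
  assumes "bval b \<sigma> \<Longrightarrow> wp r B c Q \<sigma>" "\<not> bval b \<sigma> \<Longrightarrow> wp r B d Q \<sigma>"
  shows "wp r B (Cond b c d) Q \<sigma>"
proof -
  let ?c = "if bval b \<sigma> then c else d"
  have "wp r B ?c Q \<sigma>" using assms by simp
  then obtain \<sigma>' t where *: "t \<le> time_bound B ?c" "nsteps r t ?c \<sigma> Skip \<sigma>'" "Q \<sigma>'"
    by (auto simp: wp_def)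
  have "nsteps r 1 (Cond b c d) \<sigma> ?c \<sigma>" by (rule nsteps_1) simp_all
  from nsteps_trans[OF this *(2)] have "nsteps r (1 + t) (Cond b c d) \<sigma> Skip \<sigma>'" .
  moreover have "1 + t \<le> time_bound B (Cond b c d)" using *(1) by (simp split: if_splits)
  ultimately show ?thesis using *(3) unfolding wp_def by blast
qed

lemma wp_While:
  assumes R: "R 0 \<sigma>"
    and bound: "N \<le> B"
    and continue: "\<And>i \<sigma>. i < N \<Longrightarrow> R i \<sigma> \<Longrightarrow> bval b \<sigma> \<and> wp r B c (R (Suc i)) \<sigma>"
    and exit: "\<And>\<sigma>. R N \<sigma> \<Longrightarrow> \<not> bval b \<sigma> \<and> Q \<sigma>"
  shows "wp r B (While b c) Q \<sigma>"
proof -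
  \<comment> \<open>An iteration takes two steps beyond its body, for the test and for discarding
    the finished body; the failing test at the end adds one.\<close>
  have "\<exists>\<sigma>' t. t \<le> (N - i) * (time_bound B c + 2) + 1 \<and> nsteps r t (While b c) \<sigma> Skip \<sigma>' \<and> Q \<sigma>'"
    if "i \<le> N" "R i \<sigma>" for i \<sigma>
    using that
  proof (induction "N - i" arbitrary: i \<sigma>)
    case 0
    then have "\<not> bval b \<sigma> \<and> Q \<sigma>" using exit by simp
    moreover from this have "nsteps r 1 (While b c) \<sigma> Skip \<sigma>" by (intro nsteps_1) simp_all
    ultimately show ?case by (intro exI[of _ \<sigma>] exI[of _ 1]) simp
  next
    case (Suc d)
    then have "bval b \<sigma>" "wp r B c (R (Suc i)) \<sigma>" using continue[of i \<sigma>] by auto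
    then obtain \<sigma>' t where t: "t \<le> time_bound B c" "nsteps r t c \<sigma> Skip \<sigma>'" "R (Suc i) \<sigma>'"
      by (auto simp: wp_def)
    obtain \<sigma>'' t' where t': "t' \<le> (N - Suc i) * (time_bound B c + 2) + 1"
      "nsteps r t' (While b c) \<sigma>' Skip \<sigma>''" "Q \<sigma>''"
      using Suc.hyps(1)[of "Suc i" \<sigma>'] Suc.hyps(2) t(3)
      by (metis Suc_leI Suc_diff_Suc Suc_inject zero_less_Suc zero_less_diff)
    have 1: "nsteps r 1 (While b c) \<sigma> (Seq c (While b c)) \<sigma>"
      using \<open>bval b \<sigma>\<close> by (intro nsteps_1) simp_all
    have 2: "nsteps r 1 (Seq Skip (While b c)) \<sigma>' (While b c) \<sigma>'" by (intro nsteps_1) simp_all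
    have "nsteps r (1 + (t + (1 + t'))) (While b c) \<sigma> Skip \<sigma>''"
      using nsteps_trans[OF 1 nsteps_trans[OF nsteps_Seq[OF t(2)] nsteps_trans[OF 2 t'(2)]]] .
    moreover have "N - i = Suc (N - Suc i)" using Suc.hyps(2) by simp
    then have "1 + (t + (1 + t')) \<le> (N - i) * (time_bound B c + 2) + 1"
      using t(1) t'(1) by simp
    ultimately show ?case using t'(3) by blast
  qed
  from this[of 0 \<sigma>] R obtain \<sigma>' t where
    *: "t \<le> N * (time_bound B c + 2) + 1" "nsteps r t (While b c) \<sigma> Skip \<sigma>'" "Q \<sigma>'"
    by auto
  moreover have "N * (time_bound B c + 2) + 1 \<le> time_bound B (While b c)"
    unfolding time_bound.simps by (intro add_mono mult_le_mono1 bound order_refl)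
  ultimately show ?thesis unfolding wp_def using le_trans by blast
qed

abbreviation Var :: "array_name \<Rightarrow> nexp" where
  "Var x \<equiv> NGet x (Const 0) (Const 0)"

abbreviation Assign :: "array_name \<Rightarrow> nexp \<Rightarrow> com" where
  "Assign x e \<equiv> NSet x (Const 0) (Const 0) e"

definition For :: "array_name \<Rightarrow> nat \<Rightarrow> nexp \<Rightarrow> com \<Rightarrow> com" where
  "For x lo e c = Seq (Assign x (Const lo))
     (While (NLess (Var x) e) (Seq c (Assign x (NPlus (Var x) (Const 1)))))"

text \<open>The invariant is indexed by the counter and restored after the increment that ends an
  iteration. It must also pin down the value of \<open>e\<close>, which every test evaluates
  anew.\<close>

lemma wp_For:
  assumes le: "lo \<le> hi" "hi - lo \<le> B"
    and init: "R lo (nwrite x 0 0 lo \<sigma>)"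
    and inv: "\<And>i \<sigma>. R i \<sigma> \<Longrightarrow> nmem \<sigma> x 0 0 = i \<and> nval e \<sigma> = hi"
    and body: "\<And>i \<sigma>. lo \<le> i \<Longrightarrow> i < hi \<Longrightarrow> R i \<sigma>
      \<Longrightarrow> wp r B c (\<lambda>\<sigma>'. R (Suc i) (nwrite x 0 0 (Suc (nmem \<sigma>' x 0 0)) \<sigma>')) \<sigma>"
    and exit: "\<And>\<sigma>. R hi \<sigma> \<Longrightarrow> Q \<sigma>"
  shows "wp r B (For x lo e c) Q \<sigma>"
  unfolding For_def
proof (intro wp_Seq wp_NSet wp_While[where N = "hi - lo" and R = "\<lambda>i. R (lo + i)"])
  fix i \<sigma> assume i: "i < hi - lo" and R: "R (lo + i) \<sigma>"
  show "bval (NLess (Var x) e) \<sigma> \<and>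
      wp r B (Seq c (Assign x (NPlus (Var x) (Const 1)))) (R (lo + Suc i)) \<sigma>"
  proof (intro conjI wp_Seq)
    show "bval (NLess (Var x) e) \<sigma>" using inv[OF R] i by simp
    show "wp r B c (wp r B (Assign x (NPlus (Var x) (Const 1))) (R (lo + Suc i))) \<sigma>"
    proof (rule wp_mono[OF body[OF _ _ R]])
      fix \<sigma>' assume "R (Suc (lo + i)) (nwrite x 0 0 (Suc (nmem \<sigma>' x 0 0)) \<sigma>')"
      then show "wp r B (Assign x (NPlus (Var x) (Const 1))) (R (lo + Suc i)) \<sigma>'"
        by (intro wp_NSet) simp
    qed (use i in auto)
  qed
next
  fix \<sigma> assume "R (lo + (hi - lo)) \<sigma>"
  then have "R hi \<sigma>" using le by simp
  then show "\<not> bval (NLess (Var x) e) \<sigma> \<and> Q \<sigma>" using inv exit by fastforce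
qed (use le init in auto)

section \<open>Memory updates and frame conditions\<close>

lemma nmem_nwrite [simp]:
  "nmem (nwrite a i j v \<sigma>) a' i' j' = (if a' = a \<and> i' = i \<and> j' = j then v else nmem \<sigma> a' i' j')"
  by (simp add: nwrite_def)

lemma rmem_nwrite [simp]: "rmem (nwrite a i j v \<sigma>) = rmem \<sigma>"
  by (simp add: nwrite_def)

lemma rmem_rwrite [simp]:
  "rmem (rwrite a i j v \<sigma>) a' i' j' = (if a' = a \<and> i' = i \<and> j' = j then v else rmem \<sigma> a' i' j')"
  by (simp add: rwrite_def)

lemma nmem_rwrite [simp]: "nmem (rwrite a i j v \<sigma>) = nmem \<sigma>"
  by (simp add: rwrite_def)

text \<open>A frame condition at the granularity of whole arrays, so that a set of names says what a
  subprogram may change.\<close>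

definition agree :: "array_name set \<Rightarrow> memory \<Rightarrow> memory \<Rightarrow> bool" where
  "agree A \<sigma> \<sigma>' \<longleftrightarrow> (\<forall>a. a \<notin> A \<longrightarrow> nmem \<sigma>' a = nmem \<sigma> a \<and> rmem \<sigma>' a = rmem \<sigma> a)"

lemma agree_refl: "agree A \<sigma> \<sigma>"
  by (simp add: agree_def)

lemma agree_trans: "agree A \<sigma> \<sigma>' \<Longrightarrow> agree A' \<sigma>' \<sigma>'' \<Longrightarrow> A' \<subseteq> A \<Longrightarrow> agree A \<sigma> \<sigma>''"
  by (auto simp: agree_def subset_iff)

lemma agree_nwrite: "agree A \<sigma> \<sigma>' \<Longrightarrow> a \<in> A \<Longrightarrow> agree A \<sigma> (nwrite a i j v \<sigma>')"
  by (auto simp: agree_def nwrite_def)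

lemma agree_rwrite: "agree A \<sigma> \<sigma>' \<Longrightarrow> a \<in> A \<Longrightarrow> agree A \<sigma> (rwrite a i j v \<sigma>')"
  by (auto simp: agree_def rwrite_def)

lemma agree_nmem: "agree A \<sigma> \<sigma>' \<Longrightarrow> a \<notin> A \<Longrightarrow> nmem \<sigma>' a = nmem \<sigma> a"
  by (simp add: agree_def)

lemma agree_rmem: "agree A \<sigma> \<sigma>' \<Longrightarrow> a \<notin> A \<Longrightarrow> rmem \<sigma>' a = rmem \<sigma> a"
  by (simp add: agree_def)

section \<open>The algorithm\<close>

abbreviation Or :: "bexp \<Rightarrow> bexp \<Rightarrow> bexp" where
  "Or a b \<equiv> Neg (Conj (Neg a) (Neg b))"

abbreviation NLe :: "nexp \<Rightarrow> nexp \<Rightarrow> bexp" where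
  "NLe a b \<equiv> Neg (NLess b a)"

abbreviation RLe :: "rexp \<Rightarrow> rexp \<Rightarrow> bexp" where
  "RLe a b \<equiv> Neg (RLess b a)"

abbreviation For_boxes :: "array_name \<Rightarrow> com \<Rightarrow> com" where
  "For_boxes x c \<equiv> For x 1 (NPlus (Var ''boxes'') (Const 1)) c"

abbreviation For_scenarios :: "array_name \<Rightarrow> com \<Rightarrow> com" where
  "For_scenarios x c \<equiv> For x 0 (Var ''scenarios'') c"

text \<open>The set to be queried is described by a test \<open>e\<close> on the variable
  \<open>b\<close>. Writing zeros as well as ones clears what an earlier query left at the
  boxes.\<close>

definition Rank_of :: "array_name \<Rightarrow> bexp \<Rightarrow> com" where
  "Rank_of a e = Seq
     (For_boxes ''b'' (Cond e (NSet ''q'' (Const 0) (Var ''b'') (Const 1))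
                              (NSet ''q'' (Const 0) (Var ''b'') (Const 0))))
     (Query a (Const 0) (Const 0) ''q'' (Const 0))"

definition Square :: com where
  "Square = Seq (Assign ''kk'' (Const 0))
     (For ''x'' 0 (Var ''k'') (Assign ''kk'' (NPlus (Var ''kk'') (Var ''k''))))"

text \<open>Multiplying by \<open>k\<close> in advance, through repeated addition, reduces the test
  \<open>k * c \<le> l * D\<close> to one comparison with an accumulated
  \<open>l * D\<close>.\<close>

definition Scale_costs :: com where
  "Scale_costs = For_boxes ''i'' (For_scenarios ''s''
     (Seq (RSet ''kc'' (Var ''i'') (Var ''s'') (OfNat (Const 0)))
     (For ''x'' 0 (Var ''k'') (RSet ''kc'' (Var ''i'') (Var ''s'')
        (RPlus (RGet ''kc'' (Var ''i'') (Var ''s'')) (RGet ''cost'' (Var ''i'') (Var ''s'')))))))"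

text \<open>Division by counting: \<open>acc\<close> runs through the multiples of \<open>x\<close>,
  and \<open>w\<close> counts those up to \<open>kk\<close>.\<close>

definition Tabulate_pot :: com where
  "Tabulate_pot = Seq (NSet ''pot'' (Const 0) (Const 0) (Const 0))
     (For ''x'' 1 (NPlus (Var ''kk'') (Const 1))
       (Seq (Assign ''w'' (Const 0)) (Seq (Assign ''acc'' (Const 0))
       (Seq (For ''y'' 1 (NPlus (Var ''kk'') (Const 1))
               (Seq (Assign ''acc'' (NPlus (Var ''acc'') (Var ''x'')))
               (Cond (NLe (Var ''acc'') (Var ''kk'')) (Assign ''w'' (NPlus (Var ''w'') (Const 1))) Skip)))
       (NSet ''pot'' (Const 0) (Var ''x'')
          (NPlus (NGet ''pot'' (Const 0) (NMinus (Var ''x'') (Const 1))) (Var ''w'')))))))"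

text \<open>Sixteen times the least number of copies of \<open>kk\<close> whose sum reaches
  \<open>pot kk kk\<close>; overshooting by at most one copy keeps the factor logarithmic.\<close>

definition Phase_factor :: com where
  "Phase_factor = Seq (Assign ''alpha'' (Const 0)) (Seq (Assign ''acc'' (Const 0))
     (For ''y'' 0 (Var ''kk'')
        (Cond (NLess (Var ''acc'') (NGet ''pot'' (Const 0) (Var ''kk'')))
           (Seq (Assign ''acc'' (NPlus (Var ''acc'') (Var ''kk'')))
                (Assign ''alpha'' (NPlus (Var ''alpha'') (Const 16))))
           Skip)))"

definition Prepare :: com where
  "Prepare = Seq (Rank_of ''k'' (NLess (Const 0) (Const 1)))
     (Seq Square (Seq Scale_costs (Seq Tabulate_pot Phase_factor)))"

context search
begin

definition loop_bound :: nat where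
  "loop_bound = n * n + n + m + 2"

abbreviation "WP \<equiv> wp (rank_oracle I) loop_bound"

lemma loop_bounds:
  "1 \<le> Suc n" "Suc n - 1 \<le> loop_bound"
  "0 \<le> m" "m - 0 \<le> loop_bound"
  "0 \<le> k" "k - 0 \<le> loop_bound"
  "0 \<le> k * k" "k * k - 0 \<le> loop_bound"
  "1 \<le> Suc (k * k)" "Suc (k * k) - 1 \<le> loop_bound"
  "1 \<le> k + 2" "k + 2 - 1 \<le> loop_bound"
  "0 \<le> n" "n - 0 \<le> loop_bound"
  "0 \<le> Suc n" "Suc n - 0 \<le> loop_bound"
  using mult_le_mono[OF k_le_n k_le_n] k_le_n by (auto simp: loop_bound_def)

lemmas wp_For_boxes = wp_For[OF loop_bounds(1,2)]
lemmas wp_For_scenarios = wp_For[OF loop_bounds(3,4)]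
lemmas wp_For_rank = wp_For[OF loop_bounds(5,6)]
lemmas wp_For_square = wp_For[OF loop_bounds(7,8)]
lemmas wp_For_square_1 = wp_For[OF loop_bounds(9,10)]
lemmas wp_For_levels = wp_For[OF loop_bounds(11,12)]
lemmas wp_For_probes = wp_For[OF loop_bounds(13,14)]
lemmas wp_For_stops = wp_For[OF loop_bounds(15,16)]

lemma wp_Rank_of:
  assumes n: "nmem \<sigma> ''boxes'' 0 0 = n"
    and e: "\<And>\<sigma>' b. agree {''q'', ''b''} \<sigma> \<sigma>' \<Longrightarrow> nmem \<sigma>' ''b'' 0 0 = b \<Longrightarrow> b \<in> boxes I
      \<Longrightarrow> bval e \<sigma>' \<longleftrightarrow> b \<in> X"
    and X: "X \<subseteq> boxes I"
  shows "WP (Rank_of a e) (\<lambda>\<sigma>'. agree {''q'', ''b'', a} \<sigma> \<sigma>' \<and> nmem \<sigma>' a 0 0 = rk X) \<sigma>"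
proof -
  let ?R = "\<lambda>b \<sigma>'. agree {''q'', ''b''} \<sigma> \<sigma>' \<and> nmem \<sigma>' ''b'' 0 0 = b \<and>
    (\<forall>j. 1 \<le> j \<and> j < b \<longrightarrow> (nmem \<sigma>' ''q'' 0 j \<noteq> 0 \<longleftrightarrow> j \<in> X))"
  show ?thesis
    unfolding Rank_of_def
  proof (intro wp_Seq, rule wp_For_boxes[where R = ?R])
    show "?R 1 (nwrite ''b'' 0 0 1 \<sigma>)" by (auto intro!: agree_nwrite agree_refl)
  next
    fix i \<sigma>' assume "?R i \<sigma>'"
    then show "nmem \<sigma>' ''b'' 0 0 = i \<and> nval (NPlus (Var ''boxes'') (Const 1)) \<sigma>' = Suc n"
      using n by (auto simp: agree_nmem)
  next
    fix i \<sigma>' assume i: "1 \<le> i" "i < Suc n" and R: "?R i \<sigma>'"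
    then have e': "bval e \<sigma>' \<longleftrightarrow> i \<in> X" using e[of \<sigma>' i] by (simp add: boxes_def)
    show "WP (Cond e (NSet ''q'' (Const 0) (Var ''b'') (Const 1)) (NSet ''q'' (Const 0) (Var ''b'') (Const 0)))
        (\<lambda>\<sigma>'. ?R (Suc i) (nwrite ''b'' 0 0 (Suc (nmem \<sigma>' ''b'' 0 0)) \<sigma>')) \<sigma>'"
      by (intro wp_Cond wp_NSet) (use R e' in \<open>auto intro!: agree_nwrite simp: less_Suc_eq\<close>)
  next
    fix \<sigma>' assume R: "?R (Suc n) \<sigma>'"
    \<comment> \<open>Entries of the row outside the boxes are unknown but harmless, since the
      oracle intersects with \<open>boxes I\<close>.\<close>
    have "{i. nmem \<sigma>' ''q'' 0 i \<noteq> 0} \<inter> boxes I = X"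
      using R X by (auto simp: boxes_def less_Suc_eq_le)
    then show "WP (Query a (Const 0) (Const 0) ''q'' (Const 0))
        (\<lambda>\<sigma>'. agree {''q'', ''b'', a} \<sigma> \<sigma>' \<and> nmem \<sigma>' a 0 0 = rk X) \<sigma>'"
      using R by (intro wp_Query)
        (auto simp: rank_oracle_def agree_def nwrite_def)
  qed
qed

definition input_ok :: "memory \<Rightarrow> bool" where
  "input_ok \<sigma> \<longleftrightarrow> nmem \<sigma> ''boxes'' 0 0 = n \<and> nmem \<sigma> ''scenarios'' 0 0 = m \<and>
     (\<forall>i\<in>boxes I. \<forall>s<m. rmem \<sigma> ''cost'' i s = cost s i)"

lemma wp_Square:
  assumes "nmem \<sigma> ''k'' 0 0 = k"
  shows "WP Square (\<lambda>\<sigma>'. agree {''kk'', ''x''} \<sigma> \<sigma>' \<and> nmem \<sigma>' ''kk'' 0 0 = k * k) \<sigma>"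
  unfolding Square_def
  by (intro wp_Seq wp_NSet, rule wp_For_rank[where R = "\<lambda>x \<sigma>'. agree {''kk'', ''x''} \<sigma> \<sigma>' \<and> nmem \<sigma>' ''x'' 0 0 = x \<and> nmem \<sigma>' ''kk'' 0 0 = x * k"])
    (use assms in \<open>auto simp: agree_nmem intro!: agree_nwrite agree_refl wp_NSet\<close>)


lemma wp_Scale_costs:
  assumes ok: "input_ok \<sigma>" and k: "nmem \<sigma> ''k'' 0 0 = k"
  shows "WP Scale_costs (\<lambda>\<sigma>'. agree {''kc'', ''i'', ''s'', ''x''} \<sigma> \<sigma>' \<and>
    (\<forall>i\<in>boxes I. \<forall>s<m. rmem \<sigma>' ''kc'' i s = real k * cost s i)) \<sigma>"
proof -
  let ?A = "{''kc'', ''i'', ''s'', ''x''}"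
  let ?R1 = "\<lambda>i \<sigma>'. agree ?A \<sigma> \<sigma>' \<and> nmem \<sigma>' ''i'' 0 0 = i \<and>
    (\<forall>j s. 1 \<le> j \<and> j < i \<and> s < m \<longrightarrow> rmem \<sigma>' ''kc'' j s = real k * cost s j)"
  let ?R2 = "\<lambda>i s \<sigma>'. ?R1 i \<sigma>' \<and> nmem \<sigma>' ''s'' 0 0 = s \<and>
    (\<forall>s'<s. rmem \<sigma>' ''kc'' i s' = real k * cost s' i)"
  let ?R3 = "\<lambda>i s x \<sigma>'. ?R2 i s \<sigma>' \<and> nmem \<sigma>' ''x'' 0 0 = x \<and> rmem \<sigma>' ''kc'' i s = real x * cost s i"
  have static: "nmem \<sigma>' ''boxes'' 0 0 = n" "nmem \<sigma>' ''scenarios'' 0 0 = m" "nmem \<sigma>' ''k'' 0 0 = k"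
    "\<And>i s. i \<in> boxes I \<Longrightarrow> s < m \<Longrightarrow> rmem \<sigma>' ''cost'' i s = cost s i" if "agree ?A \<sigma> \<sigma>'" for \<sigma>'
    using ok k agree_nmem[OF that] agree_rmem[OF that] by (simp_all add: input_ok_def)
  show ?thesis
    unfolding Scale_costs_def
  proof (rule wp_For_boxes[where R = ?R1])
    fix i \<sigma>1 assume i: "1 \<le> i" "i < Suc n" and R1: "?R1 i \<sigma>1"
    show "WP (For_scenarios ''s''
     (Seq (RSet ''kc'' (Var ''i'') (Var ''s'') (OfNat (Const 0)))
     (For ''x'' 0 (Var ''k'') (RSet ''kc'' (Var ''i'') (Var ''s'')
        (RPlus (RGet ''kc'' (Var ''i'') (Var ''s'')) (RGet ''cost'' (Var ''i'') (Var ''s'')))))))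
      (\<lambda>\<sigma>'. ?R1 (Suc i) (nwrite ''i'' 0 0 (Suc (nmem \<sigma>' ''i'' 0 0)) \<sigma>')) \<sigma>1"
    proof (rule wp_For_scenarios[where R = "?R2 i"])
      fix s \<sigma>2 assume s: "s < m" and R2: "?R2 i s \<sigma>2"
      show "WP (Seq (RSet ''kc'' (Var ''i'') (Var ''s'') (OfNat (Const 0)))
         (For ''x'' 0 (Var ''k'') (RSet ''kc'' (Var ''i'') (Var ''s'')
          (RPlus (RGet ''kc'' (Var ''i'') (Var ''s'')) (RGet ''cost'' (Var ''i'') (Var ''s''))))))
        (\<lambda>\<sigma>'. ?R2 i (Suc s) (nwrite ''s'' 0 0 (Suc (nmem \<sigma>' ''s'' 0 0)) \<sigma>')) \<sigma>2"
      proof (intro wp_Seq wp_RSet, rule wp_For_rank[where R = "?R3 i s"])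
        fix x \<sigma>3 assume R3: "?R3 i s x \<sigma>3"
        then show "WP (RSet ''kc'' (Var ''i'') (Var ''s'')
          (RPlus (RGet ''kc'' (Var ''i'') (Var ''s'')) (RGet ''cost'' (Var ''i'') (Var ''s''))))
          (\<lambda>\<sigma>'. ?R3 i s (Suc x) (nwrite ''x'' 0 0 (Suc (nmem \<sigma>' ''x'' 0 0)) \<sigma>')) \<sigma>3"
          using static[of \<sigma>3] i s
          by (intro wp_RSet) (auto simp: boxes_def algebra_simps intro!: agree_nwrite agree_rwrite)
      qed (use R2 static in \<open>auto simp: less_Suc_eq intro!: agree_nwrite agree_rwrite\<close>)
    next
      show "?R2 i 0 (nwrite ''s'' 0 0 0 \<sigma>1)" using R1 by (auto intro!: agree_nwrite)
    next
      fix \<sigma>2 assume R2: "?R2 i m \<sigma>2"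
      have "rmem \<sigma>2 ''kc'' j s = real k * cost s j" if "1 \<le> j" "j < Suc i" "s < m" for j s
        using R2 that by (cases "j = i") auto
      then show "?R1 (Suc i) (nwrite ''i'' 0 0 (Suc (nmem \<sigma>2 ''i'' 0 0)) \<sigma>2)"
        using R2 by (simp add: agree_nwrite)
    qed (use static in auto)
  qed (use static in \<open>auto simp: boxes_def less_Suc_eq_le intro!: agree_nwrite agree_refl\<close>)
qed

lemma wp_Tabulate_pot:
  assumes kk: "nmem \<sigma> ''kk'' 0 0 = k * k"
  shows "WP Tabulate_pot (\<lambda>\<sigma>'. agree {''pot'', ''x'', ''w'', ''acc'', ''y''} \<sigma> \<sigma>' \<and>
    (\<forall>x\<le>k * k. nmem \<sigma>' ''pot'' 0 x = pot (k * k) x)) \<sigma>"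
proof -
  let ?A = "{''pot'', ''x'', ''w'', ''acc'', ''y''}"
  let ?R1 = "\<lambda>x \<sigma>'. agree ?A \<sigma> \<sigma>' \<and> nmem \<sigma>' ''x'' 0 0 = x \<and> (\<forall>z<x. nmem \<sigma>' ''pot'' 0 z = pot (k * k) z)"
  let ?R2 = "\<lambda>x y \<sigma>'. ?R1 x \<sigma>' \<and> nmem \<sigma>' ''y'' 0 0 = y \<and>
    nmem \<sigma>' ''acc'' 0 0 = (y - 1) * x \<and> nmem \<sigma>' ''w'' 0 0 = min (y - 1) (k * k div x)"
  have static: "nmem \<sigma>' ''kk'' 0 0 = k * k" if "agree ?A \<sigma> \<sigma>'" for \<sigma>'
    using kk agree_nmem[OF that] by simp
  show ?thesis
    unfolding Tabulate_pot_def
  proof (intro wp_Seq wp_NSet, rule wp_For_square_1[where R = ?R1])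
    fix x \<sigma>1 assume x: "1 \<le> x" "x < Suc (k * k)" and R1: "?R1 x \<sigma>1"
    show "WP (Seq (Assign ''w'' (Const 0)) (Seq (Assign ''acc'' (Const 0))
       (Seq (For ''y'' 1 (NPlus (Var ''kk'') (Const 1))
               (Seq (Assign ''acc'' (NPlus (Var ''acc'') (Var ''x'')))
               (Cond (NLe (Var ''acc'') (Var ''kk'')) (Assign ''w'' (NPlus (Var ''w'') (Const 1))) Skip)))
       (NSet ''pot'' (Const 0) (Var ''x'')
          (NPlus (NGet ''pot'' (Const 0) (NMinus (Var ''x'') (Const 1))) (Var ''w''))))))
       (\<lambda>\<sigma>'. ?R1 (Suc x) (nwrite ''x'' 0 0 (Suc (nmem \<sigma>' ''x'' 0 0)) \<sigma>')) \<sigma>1"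
    proof (intro wp_Seq wp_NSet, rule wp_For_square_1[where R = "?R2 x"])
      fix y \<sigma>2 assume y: "1 \<le> y" "y < Suc (k * k)" and R2: "?R2 x y \<sigma>2"
      \<comment> \<open>The left side is the multiple \<open>y * x\<close>, so the count grows
        exactly until it reaches the quotient.\<close>
      have fits: "(y - 1) * x + x \<le> k * k \<longleftrightarrow> y \<le> k * k div x"
        using y(1) x(1) by (cases y) (auto simp: less_eq_div_iff_mult_less_eq)
      show "WP (Seq (Assign ''acc'' (NPlus (Var ''acc'') (Var ''x'')))
           (Cond (NLe (Var ''acc'') (Var ''kk'')) (Assign ''w'' (NPlus (Var ''w'') (Const 1))) Skip))
         (\<lambda>\<sigma>'. ?R2 x (Suc y) (nwrite ''y'' 0 0 (Suc (nmem \<sigma>' ''y'' 0 0)) \<sigma>')) \<sigma>2"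
        using R2 static[of \<sigma>2] y fits
        by (intro wp_Seq wp_NSet wp_Cond wp_Skip)
          (auto simp: min_def diff_mult_distrib not_less intro!: agree_nwrite)
    next
      fix \<sigma>2 assume R2: "?R2 x (Suc (k * k)) \<sigma>2"
      have "pot (k * k) x = pot (k * k) (x - 1) + k * k div x" using x by (cases x) (auto simp: pot_def)
      moreover have "min (k * k) (k * k div x) = k * k div x" by (simp add: min_absorb2)
      ultimately show "WP (NSet ''pot'' (Const 0) (Var ''x'')
          (NPlus (NGet ''pot'' (Const 0) (NMinus (Var ''x'') (Const 1))) (Var ''w'')))
          (\<lambda>\<sigma>'. ?R1 (Suc x) (nwrite ''x'' 0 0 (Suc (nmem \<sigma>' ''x'' 0 0)) \<sigma>')) \<sigma>2"
        using R2 x by (intro wp_NSet) (auto simp: less_Suc_eq intro!: agree_nwrite)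
    next
      let ?\<sigma> = "nwrite ''w'' (nval (Const 0) \<sigma>1) (nval (Const 0) \<sigma>1) (nval (Const 0) \<sigma>1) \<sigma>1"
      show "?R2 x 1 (nwrite ''y'' 0 0 1
          (nwrite ''acc'' (nval (Const 0) ?\<sigma>) (nval (Const 0) ?\<sigma>) (nval (Const 0) ?\<sigma>) ?\<sigma>))"
        using R1 by (auto intro!: agree_nwrite)
    qed (use static in \<open>auto intro!: agree_nwrite\<close>)
  qed (use static in \<open>auto simp: less_Suc_eq_le intro!: agree_nwrite agree_refl\<close>)
qed

lemma wp_Phase_factor:
  assumes kk: "nmem \<sigma> ''kk'' 0 0 = k * k" and pot: "\<forall>x\<le>k * k. nmem \<sigma> ''pot'' 0 x = pot (k * k) x"
  shows "WP Phase_factor (\<lambda>\<sigma>'. agree {''alpha'', ''acc'', ''y''} \<sigma> \<sigma>' \<and>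
    16 * pot (k * k) (k * k) \<le> nmem \<sigma>' ''alpha'' 0 0 * (k * k) \<and>
    nmem \<sigma>' ''alpha'' 0 0 * (k * k) \<le> 16 * pot (k * k) (k * k) + 16 * (k * k)) \<sigma>"
proof -
  let ?A = "{''alpha'', ''acc'', ''y''}" and ?P = "pot (k * k) (k * k)"
  let ?R = "\<lambda>y \<sigma>'. agree ?A \<sigma> \<sigma>' \<and> nmem \<sigma>' ''y'' 0 0 = y \<and>
    nmem \<sigma>' ''alpha'' 0 0 * (k * k) = 16 * nmem \<sigma>' ''acc'' 0 0 \<and>
    nmem \<sigma>' ''acc'' 0 0 \<le> ?P + k * k \<and> (nmem \<sigma>' ''acc'' 0 0 < ?P \<longrightarrow> nmem \<sigma>' ''acc'' 0 0 = y * (k * k))"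
  have static: "nmem \<sigma>' ''kk'' 0 0 = k * k" "nmem \<sigma>' ''pot'' 0 (k * k) = ?P" if "agree ?A \<sigma> \<sigma>'" for \<sigma>'
    using kk pot agree_nmem[OF that] by simp_all
  show ?thesis
    unfolding Phase_factor_def
  proof (intro wp_Seq wp_NSet, rule wp_For_square[where R = ?R])
    fix y \<sigma>1 assume "?R y \<sigma>1"
    then show "WP (Cond (NLess (Var ''acc'') (NGet ''pot'' (Const 0) (Var ''kk'')))
           (Seq (Assign ''acc'' (NPlus (Var ''acc'') (Var ''kk'')))
                (Assign ''alpha'' (NPlus (Var ''alpha'') (Const 16)))) Skip)
        (\<lambda>\<sigma>'. ?R (Suc y) (nwrite ''y'' 0 0 (Suc (nmem \<sigma>' ''y'' 0 0)) \<sigma>')) \<sigma>1"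
      using static[of \<sigma>1]
      by (intro wp_Seq wp_NSet wp_Cond wp_Skip) (auto simp: distrib_right intro!: agree_nwrite)
  next
    fix \<sigma>1 assume R: "?R (k * k) \<sigma>1"
    \<comment> \<open>If \<open>acc\<close> still fell short, no iteration would have been idle and
      \<open>acc\<close> would be the square of \<open>k * k\<close>, which is at least
      \<open>?P\<close>.\<close>
    then have "?P \<le> nmem \<sigma>1 ''acc'' 0 0" using pot_le_square[of "k * k"] by force
    then show "agree ?A \<sigma> \<sigma>1 \<and> 16 * ?P \<le> nmem \<sigma>1 ''alpha'' 0 0 * (k * k) \<and>
      nmem \<sigma>1 ''alpha'' 0 0 * (k * k) \<le> 16 * ?P + 16 * (k * k)" using R by linarith
  qed (use static in \<open>auto intro!: agree_nwrite agree_refl\<close>)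
qed

definition prepared :: "memory \<Rightarrow> bool" where
  "prepared \<sigma> \<longleftrightarrow> input_ok \<sigma> \<and> nmem \<sigma> ''k'' 0 0 = k \<and> nmem \<sigma> ''kk'' 0 0 = k * k \<and>
     (\<forall>i\<in>boxes I. \<forall>s<m. rmem \<sigma> ''kc'' i s = real k * cost s i) \<and>
     (\<forall>x\<le>k * k. nmem \<sigma> ''pot'' 0 x = pot (k * k) x) \<and>
     16 * pot (k * k) (k * k) \<le> nmem \<sigma> ''alpha'' 0 0 * (k * k) \<and>
     nmem \<sigma> ''alpha'' 0 0 * (k * k) \<le> 16 * pot (k * k) (k * k) + 16 * (k * k)"

lemma prepared_agree:
  assumes "prepared \<sigma>" "agree A \<sigma> \<sigma>'"
    "A \<inter> {''boxes'', ''scenarios'', ''cost'', ''k'', ''kk'', ''kc'', ''pot'', ''alpha''} = {}"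
  shows "prepared \<sigma>'"
  using assms by (auto simp: prepared_def input_ok_def agree_nmem agree_rmem)

lemma wp_Prepare:
  assumes ok: "input_ok \<sigma>"
  shows "WP Prepare (\<lambda>\<sigma>'. prepared \<sigma>' \<and> nmem \<sigma>' ''p'' = nmem \<sigma> ''p'') \<sigma>"
  unfolding Prepare_def
proof (rule wp_Seq, rule wp_mono[OF wp_Rank_of])
  fix \<sigma>1 assume 1: "agree {''q'', ''b'', ''k''} \<sigma> \<sigma>1 \<and> nmem \<sigma>1 ''k'' 0 0 = rk (boxes I)"
  then have ok1: "input_ok \<sigma>1" "nmem \<sigma>1 ''k'' 0 0 = k"
    using ok by (auto simp: input_ok_def agree_nmem agree_rmem k_eq)
  show "WP (Seq Square (Seq Scale_costs (Seq Tabulate_pot Phase_factor)))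
      (\<lambda>\<sigma>'. prepared \<sigma>' \<and> nmem \<sigma>' ''p'' = nmem \<sigma> ''p'') \<sigma>1"
  proof (rule wp_Seq, rule wp_mono[OF wp_Square[OF ok1(2)]])
    fix \<sigma>2 assume 2: "agree {''kk'', ''x''} \<sigma>1 \<sigma>2 \<and> nmem \<sigma>2 ''kk'' 0 0 = k * k"
    then have ok2: "input_ok \<sigma>2" "nmem \<sigma>2 ''k'' 0 0 = k"
      using ok1 by (auto simp: input_ok_def agree_nmem agree_rmem)
    show "WP (Seq Scale_costs (Seq Tabulate_pot Phase_factor))
      (\<lambda>\<sigma>'. prepared \<sigma>' \<and> nmem \<sigma>' ''p'' = nmem \<sigma> ''p'') \<sigma>2"
    proof (rule wp_Seq, rule wp_mono[OF wp_Scale_costs[OF ok2]])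
      fix \<sigma>3 assume 3: "agree {''kc'', ''i'', ''s'', ''x''} \<sigma>2 \<sigma>3 \<and>
        (\<forall>i\<in>boxes I. \<forall>s<m. rmem \<sigma>3 ''kc'' i s = real k * cost s i)"
      then have ok3: "nmem \<sigma>3 ''kk'' 0 0 = k * k" using 2 by (auto simp: agree_nmem)
      show "WP (Seq Tabulate_pot Phase_factor) (\<lambda>\<sigma>'. prepared \<sigma>' \<and> nmem \<sigma>' ''p'' = nmem \<sigma> ''p'') \<sigma>3"
      proof (rule wp_Seq, rule wp_mono[OF wp_Tabulate_pot[OF ok3]])
        fix \<sigma>4 assume 4: "agree {''pot'', ''x'', ''w'', ''acc'', ''y''} \<sigma>3 \<sigma>4 \<and>
          (\<forall>x\<le>k * k. nmem \<sigma>4 ''pot'' 0 x = pot (k * k) x)"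
        then have ok4: "nmem \<sigma>4 ''kk'' 0 0 = k * k" using ok3 by (auto simp: agree_nmem)
        show "WP Phase_factor (\<lambda>\<sigma>'. prepared \<sigma>' \<and> nmem \<sigma>' ''p'' = nmem \<sigma> ''p'') \<sigma>4"
        proof (rule wp_mono[OF wp_Phase_factor[OF ok4]])
          fix \<sigma>5 assume 5: "agree {''alpha'', ''acc'', ''y''} \<sigma>4 \<sigma>5 \<and>
            16 * pot (k * k) (k * k) \<le> nmem \<sigma>5 ''alpha'' 0 0 * (k * k) \<and>
            nmem \<sigma>5 ''alpha'' 0 0 * (k * k) \<le> 16 * pot (k * k) (k * k) + 16 * (k * k)"
          show "prepared \<sigma>5 \<and> nmem \<sigma>5 ''p'' = nmem \<sigma> ''p''"
            using 1 2 3 4 5 ok2 by (auto simp: prepared_def input_ok_def agree_nmem agree_rmem)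
        qed (use 4 in blast)
      qed
    qed
  qed
qed (use ok in \<open>auto simp: input_ok_def\<close>)

end

section \<open>Computing the greedy order\<close>

definition Potential_of :: com where
  "Potential_of = Seq (Assign ''psi'' (Const 0)) (For_scenarios ''s''
     (Seq (Assign ''f'' (Const 0)) (Seq (Assign ''lD'' (Const 0))
     (Seq (For ''l'' 1 (NPlus (Var ''k'') (Const 2))
            (Seq (Assign ''lD'' (NPlus (Var ''lD'') (Var ''D'')))
            (Seq (Rank_of ''g''
                    (Conj (Or (NLess (Const 0) (NGet ''p'' (Const 0) (Var ''b'')))
                              (Conj (NLe (Var ''b'') (Var ''i'')) (NLe (Var ''i'') (Var ''b''))))
                          (RLe (RGet ''kc'' (Var ''b'') (Var ''s'')) (OfNat (Var ''lD'')))))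
                 (Assign ''f'' (NPlus (Var ''f'') (Var ''g''))))))
          (Assign ''psi'' (NPlus (Var ''psi'') (NGet ''pot'' (Const 0) (NMinus (Var ''kk'') (Var ''f'')))))))))"

text \<open>Boxes are numbered from one, so \<open>best = 0\<close> can stand for no candidate
  yet.\<close>

definition Pick :: com where
  "Pick = Seq (Assign ''best'' (Const 0)) (For_boxes ''i''
     (Cond (NLess (Const 0) (NGet ''p'' (Const 0) (Var ''i''))) Skip
       (Seq Potential_of
       (Cond (Or (NLess (Var ''best'') (Const 1)) (NLess (Var ''psi'') (Var ''bv'')))
         (Seq (Assign ''best'' (Var ''i'')) (Assign ''bv'' (Var ''psi''))) Skip))))"

text \<open>\<open>p[0,b]\<close> is one plus the position of box \<open>b\<close> in the order, and zero as long as \<open>b\<close> has none.\<close>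

definition Order :: com where
  "Order = Seq (Assign ''D'' (Const 1)) (Seq (Assign ''E'' (Var ''alpha''))
     (For ''t'' 0 (Var ''boxes'')
       (Seq (Cond (NLess (Var ''t'') (Var ''E'')) Skip
              (Seq (Assign ''D'' (NPlus (Var ''D'') (Var ''D'')))
                   (Assign ''E'' (NPlus (Var ''E'') (Var ''E'')))))
       (Seq Pick
       (Seq (NSet ''order'' (Var ''t'') (Const 0) (Var ''best''))
            (NSet ''p'' (Const 0) (Var ''best'') (NPlus (Var ''t'') (Const 1))))))))"

context search
begin

definition probed_boxes :: "memory \<Rightarrow> nat set" where
  "probed_boxes \<sigma> = {b \<in> boxes I. nmem \<sigma> ''p'' 0 b \<noteq> 0}"

lemma wp_Potential_of:
  assumes prep: "prepared \<sigma>" and i: "nmem \<sigma> ''i'' 0 0 \<in> boxes I"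
  shows "WP Potential_of (\<lambda>\<sigma>'. agree {''psi'', ''s'', ''f'', ''lD'', ''l'', ''q'', ''b'', ''g''} \<sigma> \<sigma>' \<and>
    nmem \<sigma>' ''psi'' 0 0
      = potential I (nmem \<sigma> ''D'' 0 0) (insert (nmem \<sigma> ''i'' 0 0) (probed_boxes \<sigma>))) \<sigma>"
proof -
  let ?A = "{''psi'', ''s'', ''f'', ''lD'', ''l'', ''q'', ''b'', ''g''}"
  define D where "D = nmem \<sigma> ''D'' 0 0"
  define S where "S = insert (nmem \<sigma> ''i'' 0 0) (probed_boxes \<sigma>)"
  define lev where "lev = (\<lambda>s l. rk {b \<in> S. real k * cost s b \<le> real (l * D)})"
  have S: "S \<subseteq> boxes I" using i by (auto simp: S_def probed_boxes_def)
  let ?R1 = "\<lambda>s \<sigma>'. agree ?A \<sigma> \<sigma>' \<and> nmem \<sigma>' ''s'' 0 0 = s \<and>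
    nmem \<sigma>' ''psi'' 0 0 = (\<Sum>u<s. pot (k * k) (deficit I u D S))"
  let ?R2 = "\<lambda>s l \<sigma>'. ?R1 s \<sigma>' \<and> nmem \<sigma>' ''l'' 0 0 = l \<and> nmem \<sigma>' ''lD'' 0 0 = (l - 1) * D \<and>
    nmem \<sigma>' ''f'' 0 0 = (\<Sum>u\<in>{1..<l}. lev s u)"
  have static: "prepared \<sigma>'" "nmem \<sigma>' ''D'' 0 0 = D" "nmem \<sigma>' ''p'' = nmem \<sigma> ''p''"
    "nmem \<sigma>' ''i'' 0 0 = nmem \<sigma> ''i'' 0 0" if "agree ?A \<sigma> \<sigma>'" for \<sigma>'
    using prepared_agree[OF prep that] agree_nmem[OF that] by (simp_all add: D_def)
  have prep': "nmem \<sigma>' ''boxes'' 0 0 = n" "nmem \<sigma>' ''scenarios'' 0 0 = m" "nmem \<sigma>' ''k'' 0 0 = k"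
    "nmem \<sigma>' ''kk'' 0 0 = k * k" "x \<le> k * k \<Longrightarrow> nmem \<sigma>' ''pot'' 0 x = pot (k * k) x"
    "b \<in> boxes I \<Longrightarrow> s < m \<Longrightarrow> rmem \<sigma>' ''kc'' b s = real k * cost s b"
    if "agree ?A \<sigma> \<sigma>'" for \<sigma>' x b s
    using static(1)[OF that] by (auto simp: prepared_def input_ok_def)
  show ?thesis
    unfolding Potential_of_def D_def[symmetric] S_def[symmetric]
  proof (intro wp_Seq wp_NSet, rule wp_For_scenarios[where R = ?R1])
    fix s \<sigma>1 assume s: "s < m" and R1: "?R1 s \<sigma>1"
    show "WP (Seq (Assign ''f'' (Const 0)) (Seq (Assign ''lD'' (Const 0))
     (Seq (For ''l'' 1 (NPlus (Var ''k'') (Const 2))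
            (Seq (Assign ''lD'' (NPlus (Var ''lD'') (Var ''D'')))
            (Seq (Rank_of ''g''
                    (Conj (Or (NLess (Const 0) (NGet ''p'' (Const 0) (Var ''b'')))
                              (Conj (NLe (Var ''b'') (Var ''i'')) (NLe (Var ''i'') (Var ''b''))))
                          (RLe (RGet ''kc'' (Var ''b'') (Var ''s'')) (OfNat (Var ''lD'')))))
                 (Assign ''f'' (NPlus (Var ''f'') (Var ''g''))))))
          (Assign ''psi'' (NPlus (Var ''psi'') (NGet ''pot'' (Const 0) (NMinus (Var ''kk'') (Var ''f''))))))))
        (\<lambda>\<sigma>'. ?R1 (Suc s) (nwrite ''s'' 0 0 (Suc (nmem \<sigma>' ''s'' 0 0)) \<sigma>')) \<sigma>1"
    proof (intro wp_Seq wp_NSet, rule wp_For_levels[where R = "?R2 s"])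
      let ?\<sigma> = "nwrite ''f'' (nval (Const 0) \<sigma>1) (nval (Const 0) \<sigma>1) (nval (Const 0) \<sigma>1) \<sigma>1"
      show "?R2 s 1 (nwrite ''l'' 0 0 1
          (nwrite ''lD'' (nval (Const 0) ?\<sigma>) (nval (Const 0) ?\<sigma>) (nval (Const 0) ?\<sigma>) ?\<sigma>))"
        using R1 by (auto intro!: agree_nwrite)
    next
      fix l \<sigma>2 assume l: "1 \<le> l" "l < k + 2" and R2: "?R2 s l \<sigma>2"
      then have ag: "agree ?A \<sigma> \<sigma>2" by blast
      let ?\<sigma>2 = "nwrite ''lD'' (nval (Const 0) \<sigma>2) (nval (Const 0) \<sigma>2) (nval (NPlus (Var ''lD'') (Var ''D'')) \<sigma>2) \<sigma>2"
      have lD: "nmem ?\<sigma>2 ''lD'' 0 0 = l * D"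
        using R2 static(2)[OF ag] l(1) by (cases l) auto
      show "WP (Seq (Assign ''lD'' (NPlus (Var ''lD'') (Var ''D'')))
            (Seq (Rank_of ''g''
                    (Conj (Or (NLess (Const 0) (NGet ''p'' (Const 0) (Var ''b'')))
                              (Conj (NLe (Var ''b'') (Var ''i'')) (NLe (Var ''i'') (Var ''b''))))
                          (RLe (RGet ''kc'' (Var ''b'') (Var ''s'')) (OfNat (Var ''lD'')))))
                 (Assign ''f'' (NPlus (Var ''f'') (Var ''g'')))))
          (\<lambda>\<sigma>'. ?R2 s (Suc l) (nwrite ''l'' 0 0 (Suc (nmem \<sigma>' ''l'' 0 0)) \<sigma>')) \<sigma>2"
      proof (rule wp_Seq, rule wp_NSet, rule wp_Seq,
          rule wp_mono[OF wp_Rank_of[where X = "{b \<in> S. real k * cost s b \<le> real (l * D)}"]])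
        show "nmem ?\<sigma>2 ''boxes'' 0 0 = n" using prep'(1)[OF ag] by simp
        show "{b \<in> S. real k * cost s b \<le> real (l * D)} \<subseteq> boxes I" using S by blast
      next
        fix \<sigma>3 b assume ag3: "agree {''q'', ''b''} ?\<sigma>2 \<sigma>3" and b: "nmem \<sigma>3 ''b'' 0 0 = b" "b \<in> boxes I"
        have "agree ?A \<sigma> \<sigma>3" by (rule agree_trans[OF _ ag3]) (auto intro: agree_nwrite ag)
        note st = static[OF this] prep'[OF this]
        have "nmem \<sigma>3 ''s'' 0 0 = s" "nmem \<sigma>3 ''lD'' 0 0 = l * D"
          using agree_nmem[OF ag3, of "''s''"] agree_nmem[OF ag3, of "''lD''"] R2 lD by auto
        moreover have "b \<in> S \<longleftrightarrow> nmem \<sigma> ''p'' 0 b \<noteq> 0 \<or> b = nmem \<sigma> ''i'' 0 0"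
          using b by (auto simp: S_def probed_boxes_def)
        ultimately show "bval (Conj (Or (NLess (Const 0) (NGet ''p'' (Const 0) (Var ''b'')))
                              (Conj (NLe (Var ''b'') (Var ''i'')) (NLe (Var ''i'') (Var ''b''))))
                          (RLe (RGet ''kc'' (Var ''b'') (Var ''s'')) (OfNat (Var ''lD'')))) \<sigma>3
            \<longleftrightarrow> b \<in> {b \<in> S. real k * cost s b \<le> real (l * D)}"
          using st b s by (simp add: not_less) linarith
      next
        fix \<sigma>3 assume 3: "agree {''q'', ''b'', ''g''} ?\<sigma>2 \<sigma>3 \<and>
          nmem \<sigma>3 ''g'' 0 0 = rk {b \<in> S. real k * cost s b \<le> real (l * D)}"
        then have ag3: "agree {''q'', ''b'', ''g''} ?\<sigma>2 \<sigma>3" by blast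
        have ag': "agree ?A \<sigma> \<sigma>3" by (rule agree_trans[OF _ ag3]) (auto intro: agree_nwrite ag)
        have "nmem \<sigma>3 ''s'' 0 0 = s" "nmem \<sigma>3 ''lD'' 0 0 = l * D" "nmem \<sigma>3 ''l'' 0 0 = l"
          "nmem \<sigma>3 ''f'' 0 0 = (\<Sum>u\<in>{1..<l}. lev s u)"
          "nmem \<sigma>3 ''psi'' 0 0 = (\<Sum>u<s. pot (k * k) (deficit I u D S))"
          using agree_nmem[OF ag3, of "''s''"] agree_nmem[OF ag3, of "''lD''"] agree_nmem[OF ag3, of "''l''"]
            agree_nmem[OF ag3, of "''f''"] agree_nmem[OF ag3, of "''psi''"] R2 lD by auto
        moreover have "nmem \<sigma>3 ''g'' 0 0 = lev s l" using 3 by (simp add: lev_def)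
        ultimately show "WP (Assign ''f'' (NPlus (Var ''f'') (Var ''g'')))
            (\<lambda>\<sigma>'. ?R2 s (Suc l) (nwrite ''l'' 0 0 (Suc (nmem \<sigma>' ''l'' 0 0)) \<sigma>')) \<sigma>3"
          using l ag' by (intro wp_NSet) (simp add: agree_nwrite)
      qed
    next
      fix \<sigma>2 assume R2: "?R2 s (k + 2) \<sigma>2"
      then have ag: "agree ?A \<sigma> \<sigma>2" by blast
      have "{1..<k + 2} = {1..k + 1}" by auto
      then have "nmem \<sigma>2 ''f'' 0 0 = level_rank (indep_sets I) k (cost s) D S"
        using R2 by (simp only: level_rank_def lev_def)
      then have "k * k - nmem \<sigma>2 ''f'' 0 0 = deficit I s D S" by (simp add: deficit_def)
      moreover have "nmem \<sigma>2 ''pot'' 0 (deficit I s D S) = pot (k * k) (deficit I s D S)"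
        using prep'(5)[OF ag] deficit_le by blast
      ultimately show "WP (Assign ''psi'' (NPlus (Var ''psi'') (NGet ''pot'' (Const 0) (NMinus (Var ''kk'') (Var ''f'')))))
          (\<lambda>\<sigma>'. ?R1 (Suc s) (nwrite ''s'' 0 0 (Suc (nmem \<sigma>' ''s'' 0 0)) \<sigma>')) \<sigma>2"
        using R2 prep'(4)[OF ag] by (intro wp_NSet) (simp add: agree_nwrite)
    qed (use prep' in auto)
  qed (use prep' in \<open>auto simp: potential_def intro!: agree_nwrite agree_refl\<close>)
qed

lemma wp_Pick:
  assumes prep: "prepared \<sigma>" and left: "probed_boxes \<sigma> \<noteq> boxes I"
  shows "WP Pick (\<lambda>\<sigma>'. agree {''best'', ''bv'', ''i'', ''psi'', ''s'', ''f'', ''lD'', ''l'', ''q'', ''b'', ''g''} \<sigma> \<sigma>' \<and>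
    nmem \<sigma>' ''best'' 0 0 \<in> boxes I - probed_boxes \<sigma> \<and>
    (\<forall>i\<in>boxes I - probed_boxes \<sigma>.
      potential I (nmem \<sigma> ''D'' 0 0) (insert (nmem \<sigma>' ''best'' 0 0) (probed_boxes \<sigma>))
        \<le> potential I (nmem \<sigma> ''D'' 0 0) (insert i (probed_boxes \<sigma>)))) \<sigma>"
proof -
  let ?A = "{''best'', ''bv'', ''i'', ''psi'', ''s'', ''f'', ''lD'', ''l'', ''q'', ''b'', ''g''}"
  define S where "S = probed_boxes \<sigma>"
  define \<Psi> where "\<Psi> = (\<lambda>i. potential I (nmem \<sigma> ''D'' 0 0) (insert i S))"
  let ?best = "\<lambda>\<sigma>'. nmem \<sigma>' ''best'' 0 0"
  \<comment> \<open>While \<open>best\<close> is zero, all boxes seen were probed already; as some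
    box is left, the loop cannot end in that state.\<close>
  let ?R = "\<lambda>i \<sigma>'. agree ?A \<sigma> \<sigma>' \<and> nmem \<sigma>' ''i'' 0 0 = i \<and>
    (if ?best \<sigma>' = 0 then {1..<i} \<subseteq> S
     else ?best \<sigma>' \<in> {1..<i} - S \<and> nmem \<sigma>' ''bv'' 0 0 = \<Psi> (?best \<sigma>') \<and>
       (\<forall>j\<in>{1..<i} - S. \<Psi> (?best \<sigma>') \<le> \<Psi> j))"
  have static: "prepared \<sigma>'" "nmem \<sigma>' ''D'' 0 0 = nmem \<sigma> ''D'' 0 0" "nmem \<sigma>' ''p'' = nmem \<sigma> ''p''"
    "nmem \<sigma>' ''boxes'' 0 0 = n" "probed_boxes \<sigma>' = S" if "agree ?A \<sigma> \<sigma>'" for \<sigma>'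
    using prepared_agree[OF prep that] agree_nmem[OF that] prep
    by (simp_all add: S_def probed_boxes_def prepared_def input_ok_def)
  show ?thesis
    unfolding Pick_def S_def[symmetric]
  proof (intro wp_Seq wp_NSet, rule wp_For_boxes[where R = ?R])
    fix i \<sigma>1 assume i: "1 \<le> i" "i < Suc n" and R: "?R i \<sigma>1"
    then have ag: "agree ?A \<sigma> \<sigma>1" and i': "nmem \<sigma>1 ''i'' 0 0 = i" "i \<in> boxes I" by (auto simp: boxes_def)
    have upto: "{1..<Suc i} = insert i {1..<i}" using i by auto
    show "WP (Cond (NLess (Const 0) (NGet ''p'' (Const 0) (Var ''i''))) Skip
       (Seq Potential_of
       (Cond (Or (NLess (Var ''best'') (Const 1)) (NLess (Var ''psi'') (Var ''bv'')))
         (Seq (Assign ''best'' (Var ''i'')) (Assign ''bv'' (Var ''psi''))) Skip)))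
       (\<lambda>\<sigma>'. ?R (Suc i) (nwrite ''i'' 0 0 (Suc (nmem \<sigma>' ''i'' 0 0)) \<sigma>')) \<sigma>1"
    proof (rule wp_Cond)
      assume "bval (NLess (Const 0) (NGet ''p'' (Const 0) (Var ''i''))) \<sigma>1"
      then have "i \<in> S" using i' static(3,5)[OF ag] by (auto simp: probed_boxes_def)
      then have "{1..<Suc i} - S = {1..<i} - S" "{1..<Suc i} \<subseteq> S \<longleftrightarrow> {1..<i} \<subseteq> S"
        unfolding upto by auto
      then show "WP Skip (\<lambda>\<sigma>'. ?R (Suc i) (nwrite ''i'' 0 0 (Suc (nmem \<sigma>' ''i'' 0 0)) \<sigma>')) \<sigma>1"
        using R by (intro wp_Skip) (auto simp: agree_nwrite split: if_splits)
    next
      assume "\<not> bval (NLess (Const 0) (NGet ''p'' (Const 0) (Var ''i''))) \<sigma>1"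
      then have new: "i \<notin> S" using i' static(3,5)[OF ag] by (auto simp: probed_boxes_def)
      show "WP (Seq Potential_of
         (Cond (Or (NLess (Var ''best'') (Const 1)) (NLess (Var ''psi'') (Var ''bv'')))
           (Seq (Assign ''best'' (Var ''i'')) (Assign ''bv'' (Var ''psi''))) Skip))
         (\<lambda>\<sigma>'. ?R (Suc i) (nwrite ''i'' 0 0 (Suc (nmem \<sigma>' ''i'' 0 0)) \<sigma>')) \<sigma>1"
      proof (rule wp_Seq, rule wp_mono[OF wp_Potential_of[OF static(1)[OF ag]]])
        show "nmem \<sigma>1 ''i'' 0 0 \<in> boxes I" using i' by simp
      next
        fix \<sigma>2 assume 2: "agree {''psi'', ''s'', ''f'', ''lD'', ''l'', ''q'', ''b'', ''g''} \<sigma>1 \<sigma>2 \<and>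
          nmem \<sigma>2 ''psi'' 0 0 = potential I (nmem \<sigma>1 ''D'' 0 0)
            (insert (nmem \<sigma>1 ''i'' 0 0) (probed_boxes \<sigma>1))"
        then have ag2: "agree {''psi'', ''s'', ''f'', ''lD'', ''l'', ''q'', ''b'', ''g''} \<sigma>1 \<sigma>2" by blast
        have ag': "agree ?A \<sigma> \<sigma>2" by (rule agree_trans[OF ag ag2]) auto
        have psi: "nmem \<sigma>2 ''psi'' 0 0 = \<Psi> i"
          using 2 static[OF ag] i' by (simp add: \<Psi>_def)
        have keep: "nmem \<sigma>2 ''best'' = nmem \<sigma>1 ''best''" "nmem \<sigma>2 ''bv'' = nmem \<sigma>1 ''bv''"
          "nmem \<sigma>2 ''i'' 0 0 = i"
          using agree_nmem[OF ag2] i' by simp_all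
        show "WP (Cond (Or (NLess (Var ''best'') (Const 1)) (NLess (Var ''psi'') (Var ''bv'')))
           (Seq (Assign ''best'' (Var ''i'')) (Assign ''bv'' (Var ''psi''))) Skip)
           (\<lambda>\<sigma>'. ?R (Suc i) (nwrite ''i'' 0 0 (Suc (nmem \<sigma>' ''i'' 0 0)) \<sigma>')) \<sigma>2"
        proof (rule wp_Cond)
          assume "bval (Or (NLess (Var ''best'') (Const 1)) (NLess (Var ''psi'') (Var ''bv''))) \<sigma>2"
          then have better: "?best \<sigma>1 = 0 \<or> \<Psi> i < nmem \<sigma>1 ''bv'' 0 0" using psi keep by auto
          have "\<forall>j\<in>{1..<Suc i} - S. \<Psi> i \<le> \<Psi> j"
          proof
            fix j assume "j \<in> {1..<Suc i} - S"
            then have "j = i \<or> j \<in> {1..<i} - S" unfolding upto by blast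
            then show "\<Psi> i \<le> \<Psi> j"
            proof
              assume j: "j \<in> {1..<i} - S"
              then have "?best \<sigma>1 \<noteq> 0" using R by (auto split: if_splits)
              then have "\<Psi> i < \<Psi> (?best \<sigma>1)" "\<Psi> (?best \<sigma>1) \<le> \<Psi> j" using better R j by simp_all
              then show ?thesis by simp
            qed simp
          qed
          then show "WP (Seq (Assign ''best'' (Var ''i'')) (Assign ''bv'' (Var ''psi'')))
             (\<lambda>\<sigma>'. ?R (Suc i) (nwrite ''i'' 0 0 (Suc (nmem \<sigma>' ''i'' 0 0)) \<sigma>')) \<sigma>2"
            using ag' keep psi new i
            by (intro wp_Seq wp_NSet) (simp add: agree_nwrite)
        next
          assume "\<not> bval (Or (NLess (Var ''best'') (Const 1)) (NLess (Var ''psi'') (Var ''bv''))) \<sigma>2"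
          then have worse: "?best \<sigma>1 \<noteq> 0" "nmem \<sigma>1 ''bv'' 0 0 \<le> \<Psi> i" using psi keep by auto
          then have R': "?best \<sigma>1 \<in> {1..<i} - S" "nmem \<sigma>1 ''bv'' 0 0 = \<Psi> (?best \<sigma>1)"
            "\<forall>j\<in>{1..<i} - S. \<Psi> (?best \<sigma>1) \<le> \<Psi> j" using R by auto
          have "\<forall>j\<in>{1..<Suc i} - S. \<Psi> (?best \<sigma>1) \<le> \<Psi> j"
            unfolding upto using R' worse(2) by auto
          moreover have "?best \<sigma>1 \<in> {1..<Suc i} - S" using R'(1) by auto
          ultimately show "WP Skip (\<lambda>\<sigma>'. ?R (Suc i) (nwrite ''i'' 0 0 (Suc (nmem \<sigma>' ''i'' 0 0)) \<sigma>')) \<sigma>2"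
            using ag' keep R'(2) worse(1) by (intro wp_Skip) (simp add: agree_nwrite)
        qed
      qed
    qed
  next
    fix \<sigma>1 assume R: "?R (Suc n) \<sigma>1"
    have eq: "{1..<Suc n} = boxes I" by (auto simp: boxes_def)
    have "\<not> boxes I \<subseteq> S" using left by (auto simp: S_def probed_boxes_def)
    then show "agree ?A \<sigma> \<sigma>1 \<and> ?best \<sigma>1 \<in> boxes I - S \<and>
        (\<forall>i\<in>boxes I - S. potential I (nmem \<sigma> ''D'' 0 0) (insert (?best \<sigma>1) S)
          \<le> potential I (nmem \<sigma> ''D'' 0 0) (insert i S))"
      using R unfolding eq \<Psi>_def by (auto split: if_splits)
  next
    show "?R 1 (nwrite ''i'' 0 0 1 (nwrite ''best'' (nval (Const 0) \<sigma>) (nval (Const 0) \<sigma>) (nval (Const 0) \<sigma>) \<sigma>))"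
      by (auto intro!: agree_nwrite agree_refl)
  qed (use static in auto)
qed

lemma wp_Order:
  assumes prep: "prepared \<sigma>" and p0: "\<And>b. nmem \<sigma> ''p'' 0 b = 0"
  shows "WP Order (\<lambda>\<sigma>'. prepared \<sigma>' \<and> nmem \<sigma>' ''alpha'' 0 0 = nmem \<sigma> ''alpha'' 0 0 \<and>
    (\<exists>xs. greedy_order I (nmem \<sigma> ''alpha'' 0 0) xs \<and>
      (\<forall>j<n. nmem \<sigma>' ''order'' j 0 = xs ! j \<and> nmem \<sigma>' ''p'' 0 (xs ! j) = Suc j))) \<sigma>"
proof -
  define \<alpha> where "\<alpha> = nmem \<sigma> ''alpha'' 0 0"
  let ?A = "{''D'', ''E'', ''t'', ''order'', ''p'', ''best'', ''bv'', ''i'', ''psi'', ''s'', ''f'', ''lD'', ''l'', ''q'', ''b'', ''g''}"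
  define greedy_at where "greedy_at = (\<lambda>t xs. \<forall>i\<in>boxes I - set (take t xs).
    potential I (phase_budget \<alpha> t) (insert (xs ! t) (set (take t xs)))
      \<le> potential I (phase_budget \<alpha> t) (insert i (set (take t xs))))"
  define good where "good = (\<lambda>t (\<sigma>' :: memory) xs. length xs = t \<and> distinct xs \<and> set xs \<subseteq> boxes I \<and>
    (\<forall>j<t. nmem \<sigma>' ''order'' j 0 = xs ! j \<and> nmem \<sigma>' ''p'' 0 (xs ! j) = Suc j) \<and>
    (\<forall>b. b \<notin> set xs \<longrightarrow> nmem \<sigma>' ''p'' 0 b = 0) \<and> (\<forall>u<t. greedy_at u xs))"
  define phase where "phase = (\<lambda>t (\<sigma>' :: memory) j. nmem \<sigma>' ''D'' 0 0 = 2 ^ j \<and> nmem \<sigma>' ''E'' 0 0 = \<alpha> * 2 ^ j \<and>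
    (j = 0 \<or> \<alpha> * 2 ^ (j - 1) \<le> t))"
  \<comment> \<open>Equality \<open>t = \<alpha> * 2 ^ j\<close> is allowed, because the passage to
    the next phase happens only at the start of the next iteration.\<close>
  let ?R = "\<lambda>t \<sigma>'. agree ?A \<sigma> \<sigma>' \<and> nmem \<sigma>' ''t'' 0 0 = t \<and> (\<exists>xs. good t \<sigma>' xs) \<and>
    (\<exists>j. phase t \<sigma>' j \<and> t \<le> \<alpha> * 2 ^ j)"
  have \<alpha>_pos: "0 < \<alpha>"
  proof -
    have "16 * (k * k) \<le> \<alpha> * (k * k)"
      using prep le_pot[of "k * k"] rank_pos unfolding prepared_def \<alpha>_def
      by (meson le_trans mult_le_mono2 nat_0_less_mult_iff)
    then show ?thesis using rank_pos by (cases \<alpha>) auto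
  qed
  have static: "prepared \<sigma>'" "nmem \<sigma>' ''boxes'' 0 0 = n" "nmem \<sigma>' ''alpha'' 0 0 = \<alpha>"
    if "agree ?A \<sigma> \<sigma>'" for \<sigma>'
  proof -
    show p: "prepared \<sigma>'" by (rule prepared_agree[OF prep that]) auto
    show "nmem \<sigma>' ''boxes'' 0 0 = n" using p by (simp add: prepared_def input_ok_def)
    show "nmem \<sigma>' ''alpha'' 0 0 = \<alpha>" using agree_nmem[OF that] by (simp add: \<alpha>_def)
  qed
  show ?thesis
    unfolding Order_def \<alpha>_def[symmetric]
  proof (intro wp_Seq wp_NSet, rule wp_For_probes[where R = ?R])
    let ?\<sigma>1 = "nwrite ''D'' (nval (Const 0) \<sigma>) (nval (Const 0) \<sigma>) (nval (Const 1) \<sigma>) \<sigma>"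
    let ?\<sigma>2 = "nwrite ''t'' 0 0 0 (nwrite ''E'' (nval (Const 0) ?\<sigma>1) (nval (Const 0) ?\<sigma>1) (nval (Var ''alpha'') ?\<sigma>1) ?\<sigma>1)"
    have "good 0 ?\<sigma>2 []" using p0 by (simp add: good_def)
    moreover have "phase 0 ?\<sigma>2 0" by (simp add: phase_def \<alpha>_def)
    moreover have "agree ?A \<sigma> ?\<sigma>2" by (auto intro!: agree_nwrite agree_refl)
    moreover have "nmem ?\<sigma>2 ''t'' 0 0 = 0" by simp
    ultimately show "?R 0 ?\<sigma>2" by blast
  next
    fix t \<sigma>1 assume t: "t < n" and R: "?R t \<sigma>1"
    then have ag: "agree ?A \<sigma> \<sigma>1" and t1: "nmem \<sigma>1 ''t'' 0 0 = t" by auto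
    obtain xs where xs: "good t \<sigma>1 xs" using R by blast
    obtain j where j: "phase t \<sigma>1 j" "t \<le> \<alpha> * 2 ^ j" using R by blast
    let ?phase = "Cond (NLess (Var ''t'') (Var ''E'')) Skip
              (Seq (Assign ''D'' (NPlus (Var ''D'') (Var ''D'')))
                   (Assign ''E'' (NPlus (Var ''E'') (Var ''E''))))"
    have phase_step: "WP ?phase (\<lambda>\<sigma>'. agree {''D'', ''E''} \<sigma>1 \<sigma>' \<and> (\<exists>j. phase t \<sigma>' j \<and> t < \<alpha> * 2 ^ j)) \<sigma>1"
    proof (rule wp_Cond)
      assume "bval (NLess (Var ''t'') (Var ''E'')) \<sigma>1"
      then have "t < \<alpha> * 2 ^ j" using j t1 by (simp add: phase_def)
      then show "WP Skip (\<lambda>\<sigma>'. agree {''D'', ''E''} \<sigma>1 \<sigma>' \<and> (\<exists>j. phase t \<sigma>' j \<and> t < \<alpha> * 2 ^ j)) \<sigma>1"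
        using j by (intro wp_Skip) (auto simp: agree_refl)
    next
      assume "\<not> bval (NLess (Var ''t'') (Var ''E'')) \<sigma>1"
      \<comment> \<open>Time advances by one, so the end of a phase is hit exactly and one doubling
        suffices.\<close>
      then have t_eq: "t = \<alpha> * 2 ^ j" using j t1 by (simp add: phase_def)
      let ?\<sigma>2 = "nwrite ''D'' (nval (Const 0) \<sigma>1) (nval (Const 0) \<sigma>1) (nval (NPlus (Var ''D'') (Var ''D'')) \<sigma>1) \<sigma>1"
      let ?\<sigma>3 = "nwrite ''E'' (nval (Const 0) ?\<sigma>2) (nval (Const 0) ?\<sigma>2) (nval (NPlus (Var ''E'') (Var ''E'')) ?\<sigma>2) ?\<sigma>2"
      have "phase t ?\<sigma>3 (Suc j)" using j(1) t_eq by (simp add: phase_def)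
      moreover have "t < \<alpha> * 2 ^ Suc j" using t_eq \<alpha>_pos by simp
      moreover have "agree {''D'', ''E''} \<sigma>1 ?\<sigma>3" by (auto intro!: agree_nwrite agree_refl)
      ultimately show "WP (Seq (Assign ''D'' (NPlus (Var ''D'') (Var ''D''))) (Assign ''E'' (NPlus (Var ''E'') (Var ''E''))))
          (\<lambda>\<sigma>'. agree {''D'', ''E''} \<sigma>1 \<sigma>' \<and> (\<exists>j. phase t \<sigma>' j \<and> t < \<alpha> * 2 ^ j)) \<sigma>1"
        by (intro wp_Seq wp_NSet) blast
    qed
    show "WP (Seq ?phase (Seq Pick
       (Seq (NSet ''order'' (Var ''t'') (Const 0) (Var ''best''))
            (NSet ''p'' (Const 0) (Var ''best'') (NPlus (Var ''t'') (Const 1))))))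
       (\<lambda>\<sigma>'. ?R (Suc t) (nwrite ''t'' 0 0 (Suc (nmem \<sigma>' ''t'' 0 0)) \<sigma>')) \<sigma>1"
    proof (rule wp_Seq, rule wp_mono[OF phase_step])
      fix \<sigma>2 assume "agree {''D'', ''E''} \<sigma>1 \<sigma>2 \<and> (\<exists>j. phase t \<sigma>2 j \<and> t < \<alpha> * 2 ^ j)"
      then obtain j where ag2: "agree {''D'', ''E''} \<sigma>1 \<sigma>2" and j: "phase t \<sigma>2 j" "t < \<alpha> * 2 ^ j" by blast
      have ag2': "agree ?A \<sigma> \<sigma>2" by (rule agree_trans[OF ag ag2]) auto
      have eq2: "nmem \<sigma>2 ''order'' = nmem \<sigma>1 ''order''" "nmem \<sigma>2 ''p'' = nmem \<sigma>1 ''p''" "nmem \<sigma>2 ''t'' 0 0 = t"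
        using agree_nmem[OF ag2] t1 by simp_all
      have xs2: "good t \<sigma>2 xs" using xs by (simp add: good_def eq2)
      have D: "nmem \<sigma>2 ''D'' 0 0 = phase_budget \<alpha> t"
      proof (cases j)
        case 0
        then show ?thesis using j phase_budget_0 by (simp add: phase_def)
      next
        case (Suc i)
        then show ?thesis using j phase_budget_Suc[of \<alpha> i t] by (simp add: phase_def)
      qed
      have probed: "probed_boxes \<sigma>2 = set xs"
      proof -
        have "nmem \<sigma>2 ''p'' 0 b \<noteq> 0 \<longleftrightarrow> b \<in> set xs" for b
          using xs2 by (auto simp: good_def in_set_conv_nth)
        then show ?thesis using xs2 by (auto simp: probed_boxes_def good_def)
      qed
      have "card (set xs) < card (boxes I)" using xs2 t by (simp add: good_def distinct_card card_boxes)
      then have left: "probed_boxes \<sigma>2 \<noteq> boxes I" using probed by auto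
      show "WP (Seq Pick (Seq (NSet ''order'' (Var ''t'') (Const 0) (Var ''best''))
            (NSet ''p'' (Const 0) (Var ''best'') (NPlus (Var ''t'') (Const 1)))))
         (\<lambda>\<sigma>'. ?R (Suc t) (nwrite ''t'' 0 0 (Suc (nmem \<sigma>' ''t'' 0 0)) \<sigma>')) \<sigma>2"
      proof (rule wp_Seq, rule wp_mono[OF wp_Pick[OF static(1)[OF ag2'] left]], unfold D probed)
        let ?P = "{''best'', ''bv'', ''i'', ''psi'', ''s'', ''f'', ''lD'', ''l'', ''q'', ''b'', ''g''}"
        fix \<sigma>3 assume 3: "agree ?P \<sigma>2 \<sigma>3 \<and> nmem \<sigma>3 ''best'' 0 0 \<in> boxes I - set xs \<and>
          (\<forall>i\<in>boxes I - set xs. potential I (phase_budget \<alpha> t) (insert (nmem \<sigma>3 ''best'' 0 0) (set xs))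
            \<le> potential I (phase_budget \<alpha> t) (insert i (set xs)))"
        define x where "x = nmem \<sigma>3 ''best'' 0 0"
        have ag3: "agree ?P \<sigma>2 \<sigma>3" and x: "x \<in> boxes I - set xs"
          and best: "\<forall>i\<in>boxes I - set xs. potential I (phase_budget \<alpha> t) (insert x (set xs))
            \<le> potential I (phase_budget \<alpha> t) (insert i (set xs))" using 3 by (auto simp: x_def)
        have ag3': "agree ?A \<sigma> \<sigma>3" by (rule agree_trans[OF ag2' ag3]) auto
        have eq3: "nmem \<sigma>3 ''order'' = nmem \<sigma>2 ''order''" "nmem \<sigma>3 ''p'' = nmem \<sigma>2 ''p''"
          "nmem \<sigma>3 ''t'' 0 0 = t" "nmem \<sigma>3 ''D'' = nmem \<sigma>2 ''D''" "nmem \<sigma>3 ''E'' = nmem \<sigma>2 ''E''"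
          using agree_nmem[OF ag3] eq2 by simp_all
        let ?\<sigma>4 = "nwrite ''order'' t 0 x \<sigma>3"
        let ?\<sigma>5 = "nwrite ''t'' 0 0 (Suc t) (nwrite ''p'' 0 x (Suc t) ?\<sigma>4)"
        have len: "length xs = t" using xs2 by (simp add: good_def)
        have "greedy_at u (xs @ [x])" if "u < Suc t" for u
        proof (cases "u = t")
          case True
          then show ?thesis using best len by (simp add: greedy_at_def nth_append)
        next
          case False
          then have "u < t" using that by simp
          then have "greedy_at u xs" using xs2 by (simp add: good_def)
          then show ?thesis using \<open>u < t\<close> len by (simp add: greedy_at_def nth_append)
        qed
        moreover have "nmem ?\<sigma>5 ''order'' j 0 = (xs @ [x]) ! j \<and> nmem ?\<sigma>5 ''p'' 0 ((xs @ [x]) ! j) = Suc j"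
          if "j < Suc t" for j
        proof (cases "j = t")
          case True
          then show ?thesis using len by (simp add: nth_append)
        next
          case False
          then have "j < t" using that by simp
          moreover from this have "xs ! j \<noteq> x" using x len nth_mem[of j xs] by auto
          ultimately show ?thesis using xs2 len by (simp add: good_def nth_append eq3)
        qed
        moreover have "nmem ?\<sigma>5 ''p'' 0 b = 0" if "b \<notin> set (xs @ [x])" for b
          using that xs2 by (simp add: good_def eq3)
        ultimately have "good (Suc t) ?\<sigma>5 (xs @ [x])"
          using xs2 x by (simp add: good_def)
        moreover have "phase (Suc t) ?\<sigma>5 j" using j(1) by (auto simp: phase_def eq3)
        moreover have "agree ?A \<sigma> ?\<sigma>5" by (intro agree_nwrite ag3') auto
        moreover have "nmem ?\<sigma>5 ''t'' 0 0 = Suc t" by simp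
        ultimately have R': "?R (Suc t) ?\<sigma>5" using j(2) by (metis Suc_leI)
        have vals: "nval (Var ''t'') \<sigma>3 = t" "nval (Const 0) \<sigma>3 = 0" "nval (Var ''best'') \<sigma>3 = x"
          "nval (Const 0) ?\<sigma>4 = 0" "nval (Var ''best'') ?\<sigma>4 = x" "nval (NPlus (Var ''t'') (Const 1)) ?\<sigma>4 = Suc t"
          "nmem (nwrite ''p'' 0 x (Suc t) ?\<sigma>4) ''t'' 0 0 = t"
          using eq3 by (simp_all add: x_def)
        show "WP (Seq (NSet ''order'' (Var ''t'') (Const 0) (Var ''best''))
              (NSet ''p'' (Const 0) (Var ''best'') (NPlus (Var ''t'') (Const 1))))
           (\<lambda>\<sigma>'. ?R (Suc t) (nwrite ''t'' 0 0 (Suc (nmem \<sigma>' ''t'' 0 0)) \<sigma>')) \<sigma>3"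
          by (intro wp_Seq wp_NSet) (unfold vals, rule R')
      qed
    qed
  next
    fix \<sigma>1 assume R: "?R n \<sigma>1"
    then have ag: "agree ?A \<sigma> \<sigma>1" by blast
    obtain xs where xs: "good n \<sigma>1 xs" using R by blast
    then have "set xs = boxes I"
      using card_subset_eq[OF finite_carrier, of "set xs"] by (simp add: good_def distinct_card card_boxes)
    then have "greedy_order I \<alpha> xs" using xs by (simp add: good_def greedy_order_def greedy_at_def)
    then show "prepared \<sigma>1 \<and> nmem \<sigma>1 ''alpha'' 0 0 = \<alpha> \<and> (\<exists>xs. greedy_order I \<alpha> xs \<and>
      (\<forall>j<n. nmem \<sigma>1 ''order'' j 0 = xs ! j \<and> nmem \<sigma>1 ''p'' 0 (xs ! j) = Suc j))"
      using static[OF ag] xs by (auto simp: good_def)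
  qed (use static in auto)
qed

end

section \<open>Computing the stopping times and selections\<close>

abbreviation Before :: bexp where
  "Before \<equiv> Conj (NLe (NGet ''p'' (Const 0) (Var ''b'')) (Var ''t''))
     (Or (RLess (RGet ''cost'' (Var ''b'') (Var ''s'')) (RGet ''cost'' (Var ''c'') (Var ''s'')))
         (Conj (RLe (RGet ''cost'' (Var ''b'') (Var ''s'')) (RGet ''cost'' (Var ''c'') (Var ''s'')))
               (NLess (Var ''b'') (Var ''c''))))"

definition Basis_step :: com where
  "Basis_step = Seq (NSet ''h'' (Const 0) (Var ''c'') (Const 0))
     (Cond (NLe (NGet ''p'' (Const 0) (Var ''c'')) (Var ''t''))
        (Seq (Rank_of ''u'' Before)
        (Seq (Rank_of ''v'' (Or Before (Conj (NLe (Var ''b'') (Var ''c'')) (NLe (Var ''c'') (Var ''b'')))))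
        (Cond (NLess (Var ''u'') (Var ''v''))
           (Seq (NSet ''h'' (Const 0) (Var ''c'') (Const 1))
           (Seq (Assign ''count'' (NPlus (Var ''count'') (Const 1)))
                (RSet ''val'' (Const 0) (Const 0)
                   (RPlus (RGet ''val'' (Const 0) (Const 0)) (RGet ''cost'' (Var ''c'') (Var ''s''))))))
           Skip)))
        Skip)"

definition Basis_of_prefix :: com where
  "Basis_of_prefix = Seq (Assign ''count'' (Const 0))
     (Seq (RSet ''val'' (Const 0) (Const 0) (OfNat (Const 0))) (For_boxes ''c'' Basis_step))"

text \<open>The stopping times \<open>t = n - x\<close> are tried in decreasing order, so that the last one written is the
  first at which the strategy may stop.\<close>

definition Stop_step :: com where
  "Stop_step = Seq (Assign ''t'' (NMinus (Var ''boxes'') (Var ''x''))) (Seq Basis_of_prefix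
     (Cond (Or (NLess (Var ''x'') (Const 1))
               (Conj (NLe (Var ''k'') (Var ''count''))
                     (RLe (RGet ''val'' (Const 0) (Const 0)) (OfNat (Var ''t'')))))
        (Seq (NSet ''stop'' (Var ''s'') (Const 0) (Var ''t''))
             (For_boxes ''b'' (NSet ''select'' (Var ''s'') (Var ''b'') (NGet ''h'' (Const 0) (Var ''b'')))))
        Skip))"

definition Stops :: com where
  "Stops = For_scenarios ''s'' (For ''x'' 0 (NPlus (Var ''boxes'') (Const 1)) Stop_step)"

context search
begin

lemma wp_Basis_step:
  assumes prep: "prepared \<sigma>" and s: "nmem \<sigma> ''s'' 0 0 = s" "s < m"
    and c: "nmem \<sigma> ''c'' 0 0 = c" "c \<in> boxes I"
    and G: "G = cheapest_basis (indep_sets I) (cost s) {b \<in> boxes I. nmem \<sigma> ''p'' 0 b \<le> nmem \<sigma> ''t'' 0 0}"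
  shows "WP Basis_step (\<lambda>\<sigma>'. agree {''h'', ''count'', ''val'', ''u'', ''v'', ''q'', ''b''} \<sigma> \<sigma>' \<and>
    (\<forall>b. nmem \<sigma>' ''h'' 0 b = (if b = c then of_bool (c \<in> G) else nmem \<sigma> ''h'' 0 b)) \<and>
    nmem \<sigma>' ''count'' 0 0 = nmem \<sigma> ''count'' 0 0 + of_bool (c \<in> G) \<and>
    rmem \<sigma>' ''val'' 0 0 = rmem \<sigma> ''val'' 0 0 + (if c \<in> G then cost s c else 0)) \<sigma>"
    (is "WP _ ?Q \<sigma>")
proof -
  let ?A = "{''h'', ''count'', ''val'', ''u'', ''v'', ''q'', ''b''}"
  define S where "S = {b \<in> boxes I. nmem \<sigma> ''p'' 0 b \<le> nmem \<sigma> ''t'' 0 0}"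
  define X where "X = {b \<in> S. cheaper (cost s) b c}"
  let ?\<sigma>1 = "nwrite ''h'' (nval (Const 0) \<sigma>) (nval (Var ''c'') \<sigma>) (nval (Const 0) \<sigma>) \<sigma>"
  have ag1: "agree ?A \<sigma> ?\<sigma>1" by (auto intro!: agree_nwrite agree_refl)
  have static: "nmem \<sigma>' ''boxes'' 0 0 = n" "nmem \<sigma>' ''s'' 0 0 = s" "nmem \<sigma>' ''c'' 0 0 = c"
    "nmem \<sigma>' ''t'' = nmem \<sigma> ''t''" "nmem \<sigma>' ''p'' = nmem \<sigma> ''p''"
    "\<And>b. b \<in> boxes I \<Longrightarrow> rmem \<sigma>' ''cost'' b s = cost s b" if "agree ?A \<sigma> \<sigma>'" for \<sigma>'
    using prep s c agree_nmem[OF that] agree_rmem[OF that] by (simp_all add: prepared_def input_ok_def)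
  have before: "bval Before \<sigma>' \<longleftrightarrow> b \<in> X"
    if "agree ?A \<sigma> \<sigma>'" "nmem \<sigma>' ''b'' 0 0 = b" "b \<in> boxes I" for \<sigma>' b
    using static[OF that(1)] that(2,3) c by (auto simp: X_def S_def cheaper_def)
  have X: "X \<subseteq> boxes I" "insert c X \<subseteq> boxes I" using c by (auto simp: X_def S_def)
  show ?thesis
    unfolding Basis_step_def
  proof (rule wp_Seq, rule wp_NSet, rule wp_Cond)
    assume "bval (NLe (NGet ''p'' (Const 0) (Var ''c'')) (Var ''t'')) ?\<sigma>1"
    then have cS: "c \<in> S" using c by (auto simp: S_def)
    have inG: "c \<in> G \<longleftrightarrow> rk X < rk (insert c X)"
      using cS unfolding G S_def[symmetric] X_def by (simp add: cheapest_basis_def)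
    show "WP (Seq (Rank_of ''u'' Before)
        (Seq (Rank_of ''v'' (Or Before (Conj (NLe (Var ''b'') (Var ''c'')) (NLe (Var ''c'') (Var ''b'')))))
        (Cond (NLess (Var ''u'') (Var ''v''))
           (Seq (NSet ''h'' (Const 0) (Var ''c'') (Const 1))
           (Seq (Assign ''count'' (NPlus (Var ''count'') (Const 1)))
                (RSet ''val'' (Const 0) (Const 0)
                   (RPlus (RGet ''val'' (Const 0) (Const 0)) (RGet ''cost'' (Var ''c'') (Var ''s''))))))
           Skip))) ?Q ?\<sigma>1"
    proof (rule wp_Seq, rule wp_mono[OF wp_Rank_of[OF static(1)[OF ag1] _ X(1)]])
      fix \<sigma>' b assume "agree {''q'', ''b''} ?\<sigma>1 \<sigma>'" "nmem \<sigma>' ''b'' 0 0 = b" "b \<in> boxes I"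
      moreover from this(1) have "agree ?A \<sigma> \<sigma>'" by (rule agree_trans[OF ag1]) auto
      ultimately show "bval Before \<sigma>' \<longleftrightarrow> b \<in> X" by (intro before)
    next
      fix \<sigma>2 assume 2: "agree {''q'', ''b'', ''u''} ?\<sigma>1 \<sigma>2 \<and> nmem \<sigma>2 ''u'' 0 0 = rk X"
      then have ag2: "agree ?A \<sigma> \<sigma>2" by (intro agree_trans[OF ag1, of "{''q'', ''b'', ''u''}"]) auto
      show "WP (Seq (Rank_of ''v'' (Or Before (Conj (NLe (Var ''b'') (Var ''c'')) (NLe (Var ''c'') (Var ''b'')))))
        (Cond (NLess (Var ''u'') (Var ''v''))
           (Seq (NSet ''h'' (Const 0) (Var ''c'') (Const 1))
           (Seq (Assign ''count'' (NPlus (Var ''count'') (Const 1)))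
                (RSet ''val'' (Const 0) (Const 0)
                   (RPlus (RGet ''val'' (Const 0) (Const 0)) (RGet ''cost'' (Var ''c'') (Var ''s''))))))
           Skip)) ?Q \<sigma>2"
      proof (rule wp_Seq, rule wp_mono[OF wp_Rank_of[OF static(1)[OF ag2] _ X(2)]])
        fix \<sigma>' b assume *: "agree {''q'', ''b''} \<sigma>2 \<sigma>'" "nmem \<sigma>' ''b'' 0 0 = b" "b \<in> boxes I"
        from *(1) have ag: "agree ?A \<sigma> \<sigma>'" by (rule agree_trans[OF ag2]) auto
        show "bval (Or Before (Conj (NLe (Var ''b'') (Var ''c'')) (NLe (Var ''c'') (Var ''b'')))) \<sigma>'
            \<longleftrightarrow> b \<in> insert c X"
          using before[OF ag *(2,3)] static(3)[OF ag] *(2) by (auto simp del: bval.simps(1,2) simp: bval.simps(1))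
      next
        fix \<sigma>3 assume 3: "agree {''q'', ''b'', ''v''} \<sigma>2 \<sigma>3 \<and> nmem \<sigma>3 ''v'' 0 0 = rk (insert c X)"
        then have ag3: "agree ?A \<sigma> \<sigma>3" by (intro agree_trans[OF ag2, of "{''q'', ''b'', ''v''}"]) auto
        have ag13: "agree {''q'', ''b'', ''u'', ''v''} ?\<sigma>1 \<sigma>3"
          using 2 3 by (auto simp: agree_def simp del: nmem_nwrite rmem_nwrite)
        have h: "nmem \<sigma>3 ''h'' 0 b = (if b = c then 0 else nmem \<sigma> ''h'' 0 b)" for b
          using agree_nmem[OF ag13, of "''h''"] c by simp
        have rest: "nmem \<sigma>3 ''count'' = nmem \<sigma> ''count''" "rmem \<sigma>3 ''val'' = rmem \<sigma> ''val''"
          using agree_nmem[OF ag13, of "''count''"] agree_rmem[OF ag13, of "''val''"] by (simp_all add: fun_eq_iff)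
        have uv: "nmem \<sigma>3 ''u'' 0 0 = rk X" "nmem \<sigma>3 ''v'' 0 0 = rk (insert c X)"
          using 2 3 by (auto simp: agree_nmem[of "{''q'', ''b'', ''v''}" \<sigma>2])
        show "WP (Cond (NLess (Var ''u'') (Var ''v''))
           (Seq (NSet ''h'' (Const 0) (Var ''c'') (Const 1))
           (Seq (Assign ''count'' (NPlus (Var ''count'') (Const 1)))
                (RSet ''val'' (Const 0) (Const 0)
                   (RPlus (RGet ''val'' (Const 0) (Const 0)) (RGet ''cost'' (Var ''c'') (Var ''s''))))))
           Skip) ?Q \<sigma>3"
        proof (rule wp_Cond)
          assume "bval (NLess (Var ''u'') (Var ''v'')) \<sigma>3"
          then have "c \<in> G" using inG uv by simp
          then show "WP (Seq (NSet ''h'' (Const 0) (Var ''c'') (Const 1))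
           (Seq (Assign ''count'' (NPlus (Var ''count'') (Const 1)))
                (RSet ''val'' (Const 0) (Const 0)
                   (RPlus (RGet ''val'' (Const 0) (Const 0)) (RGet ''cost'' (Var ''c'') (Var ''s'')))))) ?Q \<sigma>3"
            using static[OF ag3] h rest ag3 c(2)
            by (intro wp_Seq wp_NSet wp_RSet) (simp add: agree_nwrite agree_rwrite)
        next
          assume "\<not> bval (NLess (Var ''u'') (Var ''v'')) \<sigma>3"
          then have "c \<notin> G" using inG uv by simp
          then show "WP Skip ?Q \<sigma>3" using h rest ag3 by (intro wp_Skip) simp
        qed
      qed
    qed
  next
    assume "\<not> bval (NLe (NGet ''p'' (Const 0) (Var ''c'')) (Var ''t'')) ?\<sigma>1"
    then have "c \<notin> S" using c by (auto simp: S_def)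
    then have "c \<notin> G" unfolding G S_def[symmetric] using cheapest_basis_subset by blast
    then show "WP Skip ?Q ?\<sigma>1" using c ag1 by (intro wp_Skip) simp
  qed
qed

lemma wp_Basis_of_prefix:
  assumes prep: "prepared \<sigma>" and s: "nmem \<sigma> ''s'' 0 0 = s" "s < m"
    and G: "G = cheapest_basis (indep_sets I) (cost s) {b \<in> boxes I. nmem \<sigma> ''p'' 0 b \<le> nmem \<sigma> ''t'' 0 0}"
  shows "WP Basis_of_prefix (\<lambda>\<sigma>'. agree {''h'', ''count'', ''val'', ''u'', ''v'', ''q'', ''b'', ''c''} \<sigma> \<sigma>' \<and>
    (\<forall>b\<in>boxes I. nmem \<sigma>' ''h'' 0 b = of_bool (b \<in> G)) \<and>
    nmem \<sigma>' ''count'' 0 0 = card G \<and> rmem \<sigma>' ''val'' 0 0 = sum (cost s) G) \<sigma>"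
proof -
  let ?A = "{''h'', ''count'', ''val'', ''u'', ''v'', ''q'', ''b'', ''c''}"
  let ?R = "\<lambda>c \<sigma>'. agree ?A \<sigma> \<sigma>' \<and> nmem \<sigma>' ''c'' 0 0 = c \<and>
    (\<forall>b\<in>{1..<c}. nmem \<sigma>' ''h'' 0 b = of_bool (b \<in> G)) \<and>
    nmem \<sigma>' ''count'' 0 0 = card (G \<inter> {1..<c}) \<and> rmem \<sigma>' ''val'' 0 0 = sum (cost s) (G \<inter> {1..<c})"
  have static: "prepared \<sigma>'" "nmem \<sigma>' ''boxes'' 0 0 = n" "nmem \<sigma>' ''s'' 0 0 = s"
    "nmem \<sigma>' ''t'' = nmem \<sigma> ''t''" "nmem \<sigma>' ''p'' = nmem \<sigma> ''p''" if "agree ?A \<sigma> \<sigma>'" for \<sigma>'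
    using prepared_agree[OF prep that] agree_nmem[OF that] prep s
    by (simp_all add: prepared_def input_ok_def)
  show ?thesis
    unfolding Basis_of_prefix_def
  proof (intro wp_Seq wp_NSet wp_RSet, rule wp_For_boxes[where R = ?R])
    fix c \<sigma>1 assume c: "1 \<le> c" "c < Suc n" and R: "?R c \<sigma>1"
    then have ag: "agree ?A \<sigma> \<sigma>1" and c1: "nmem \<sigma>1 ''c'' 0 0 = c" by auto
    have cI: "c \<in> boxes I" using c by (simp add: boxes_def)
    have upto: "G \<inter> {1..<Suc c} = (if c \<in> G then insert c (G \<inter> {1..<c}) else G \<inter> {1..<c})"
      using c(1) by (auto simp: less_Suc_eq)
    have fin: "finite (G \<inter> {1..<c})" "c \<notin> G \<inter> {1..<c}" by auto
    show "WP Basis_step (\<lambda>\<sigma>'. ?R (Suc c) (nwrite ''c'' 0 0 (Suc (nmem \<sigma>' ''c'' 0 0)) \<sigma>')) \<sigma>1"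
    proof (rule wp_mono[OF wp_Basis_step[OF static(1,3)[OF ag] s(2) c1 cI,
            unfolded static(4,5)[OF ag], OF G]])
      fix \<sigma>2 assume 2: "agree {''h'', ''count'', ''val'', ''u'', ''v'', ''q'', ''b''} \<sigma>1 \<sigma>2 \<and>
        (\<forall>b. nmem \<sigma>2 ''h'' 0 b = (if b = c then of_bool (c \<in> G) else nmem \<sigma>1 ''h'' 0 b)) \<and>
        nmem \<sigma>2 ''count'' 0 0 = nmem \<sigma>1 ''count'' 0 0 + of_bool (c \<in> G) \<and>
        rmem \<sigma>2 ''val'' 0 0 = rmem \<sigma>1 ''val'' 0 0 + (if c \<in> G then cost s c else 0)"
      then have ag2: "agree {''h'', ''count'', ''val'', ''u'', ''v'', ''q'', ''b''} \<sigma>1 \<sigma>2" by blast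
      have ag': "agree ?A \<sigma> \<sigma>2" by (rule agree_trans[OF ag ag2]) auto
      have c2: "nmem \<sigma>2 ''c'' 0 0 = c" using agree_nmem[OF ag2] c1 by simp
      have "\<forall>b\<in>{1..<Suc c}. nmem \<sigma>2 ''h'' 0 b = of_bool (b \<in> G)"
      proof
        fix b assume "b \<in> {1..<Suc c}"
        then show "nmem \<sigma>2 ''h'' 0 b = of_bool (b \<in> G)" using 2 R by (cases "b = c") auto
      qed
      moreover have "nmem \<sigma>2 ''count'' 0 0 = card (G \<inter> {1..<Suc c})"
        using 2 R fin unfolding upto by simp
      moreover have "rmem \<sigma>2 ''val'' 0 0 = sum (cost s) (G \<inter> {1..<Suc c})"
        using 2 R fin unfolding upto by simp
      ultimately show "?R (Suc c) (nwrite ''c'' 0 0 (Suc (nmem \<sigma>2 ''c'' 0 0)) \<sigma>2)"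
        using ag' c2 by (simp add: agree_nwrite)
    qed
  next
    fix \<sigma>1 assume R: "?R (Suc n) \<sigma>1"
    have "{1..<Suc n} = boxes I" by (auto simp: boxes_def)
    moreover have "G \<inter> boxes I = G" unfolding G using cheapest_basis_subset by blast
    ultimately show "agree ?A \<sigma> \<sigma>1 \<and> (\<forall>b\<in>boxes I. nmem \<sigma>1 ''h'' 0 b = of_bool (b \<in> G)) \<and>
        nmem \<sigma>1 ''count'' 0 0 = card G \<and> rmem \<sigma>1 ''val'' 0 0 = sum (cost s) G"
      using R by simp
  qed (use static in \<open>auto intro!: agree_nwrite agree_rwrite agree_refl\<close>)
qed

lemma wp_Stops:
  assumes prep: "prepared \<sigma>" and xs: "distinct xs" "set xs = boxes I"
    and p: "\<And>j. j < n \<Longrightarrow> nmem \<sigma> ''p'' 0 (xs ! j) = Suc j"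
  shows "WP Stops (\<lambda>\<sigma>'. nmem \<sigma>' ''order'' = nmem \<sigma> ''order'' \<and>
    (\<forall>s<m. nmem \<sigma>' ''stop'' s 0 = first_stop I xs s \<and>
      {i \<in> boxes I. nmem \<sigma>' ''select'' s i \<noteq> 0} = prefix_basis I xs s (first_stop I xs s))) \<sigma>"
proof -
  let ?A = "{''stop'', ''select'', ''s'', ''x'', ''t'', ''h'', ''count'', ''val'', ''u'', ''v'', ''q'', ''b'', ''c''}"
  let ?sel = "\<lambda>\<sigma>' s. {i \<in> boxes I. nmem \<sigma>' ''select'' s i \<noteq> 0}"
  \<comment> \<open>After \<open>x\<close> attempts, from \<open>n\<close> downwards, the stored
    time is the least admissible one among those tried.\<close>
  define row where "row = (\<lambda>x (\<sigma>' :: memory) s. nmem \<sigma>' ''stop'' s 0 \<in> {n + 1 - x..n} \<and>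
    may_stop I xs s (nmem \<sigma>' ''stop'' s 0) \<and> (\<forall>t\<in>{n + 1 - x..<nmem \<sigma>' ''stop'' s 0}. \<not> may_stop I xs s t) \<and>
    ?sel \<sigma>' s = prefix_basis I xs s (nmem \<sigma>' ''stop'' s 0))"
  let ?R1 = "\<lambda>s \<sigma>'. agree ?A \<sigma> \<sigma>' \<and> nmem \<sigma>' ''s'' 0 0 = s \<and> (\<forall>u<s. row (n + 1) \<sigma>' u)"
  let ?R2 = "\<lambda>s x \<sigma>'. ?R1 s \<sigma>' \<and> nmem \<sigma>' ''x'' 0 0 = x \<and> (0 < x \<longrightarrow> row x \<sigma>' s)"
  have len: "length xs = n" using xs distinct_card[of xs] card_boxes by simp
  \<comment> \<open>Every box has a position by now, so no zero entry of \<open>p\<close> slips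
    through the comparison.\<close>
  have prefix: "{b \<in> boxes I. nmem \<sigma> ''p'' 0 b \<le> t} = set (take t xs)" for t
  proof -
    have "b \<in> set (take t xs) \<longleftrightarrow> (\<exists>j<n. j < t \<and> b = xs ! j)" for b
      using len by (auto simp: in_set_conv_nth)
    moreover have "b \<in> boxes I \<longleftrightarrow> (\<exists>j<n. b = xs ! j)" for b
      unfolding xs(2)[symmetric] using len by (auto simp: in_set_conv_nth)
    ultimately show ?thesis using p by (auto simp: Suc_le_eq)
  qed
  have static: "prepared \<sigma>'" "nmem \<sigma>' ''boxes'' 0 0 = n" "nmem \<sigma>' ''scenarios'' 0 0 = m" "nmem \<sigma>' ''k'' 0 0 = k"
    "nmem \<sigma>' ''p'' = nmem \<sigma> ''p''" "nmem \<sigma>' ''order'' = nmem \<sigma> ''order''" if "agree ?A \<sigma> \<sigma>'" for \<sigma>'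
    using prepared_agree[OF prep that] agree_nmem[OF that] prep
    by (simp_all add: prepared_def input_ok_def)
  have row_cong: "row x \<sigma>' u \<longleftrightarrow> row x \<sigma>'' u"
    if "nmem \<sigma>' ''stop'' u = nmem \<sigma>'' ''stop'' u" "nmem \<sigma>' ''select'' u = nmem \<sigma>'' ''select'' u" for x \<sigma>' \<sigma>'' u
    using that by (simp add: row_def)
  show ?thesis
    unfolding Stops_def
  proof (rule wp_For_scenarios[where R = ?R1])
    fix s \<sigma>1 assume s: "s < m" and R1: "?R1 s \<sigma>1"
    show "WP (For ''x'' 0 (NPlus (Var ''boxes'') (Const 1)) Stop_step)
      (\<lambda>\<sigma>'. ?R1 (Suc s) (nwrite ''s'' 0 0 (Suc (nmem \<sigma>' ''s'' 0 0)) \<sigma>')) \<sigma>1"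
    proof (rule wp_For_stops[where R = "?R2 s"])
      have "\<forall>u<s. row (n + 1) (nwrite ''x'' 0 0 0 \<sigma>1) u"
        using R1 row_cong[of \<sigma>1 _ "nwrite ''x'' 0 0 0 \<sigma>1"] by (simp add: fun_eq_iff)
      then show "?R2 s 0 (nwrite ''x'' 0 0 0 \<sigma>1)" using R1 by (simp add: agree_nwrite)
    next
      fix x \<sigma>2 assume x: "x < Suc n" and R2: "?R2 s x \<sigma>2"
      then have ag: "agree ?A \<sigma> \<sigma>2" and s2: "nmem \<sigma>2 ''s'' 0 0 = s" and x2: "nmem \<sigma>2 ''x'' 0 0 = x"
        and old: "\<forall>u<s. row (n + 1) \<sigma>2 u" "0 < x \<Longrightarrow> row x \<sigma>2 s" by auto
      define t where "t = n - x"
      let ?G = "prefix_basis I xs s t"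
      let ?\<sigma>3 = "nwrite ''t'' (nval (Const 0) \<sigma>2) (nval (Const 0) \<sigma>2) (nval (NMinus (Var ''boxes'') (Var ''x'')) \<sigma>2) \<sigma>2"
      have ag3: "agree ?A \<sigma> ?\<sigma>3" by (intro agree_nwrite ag) auto
      have t3: "nmem ?\<sigma>3 ''t'' 0 0 = t" using static(2)[OF ag] x2 by (simp add: t_def)
      have s3: "nmem ?\<sigma>3 ''s'' 0 0 = s" "nmem ?\<sigma>3 ''x'' 0 0 = x" using s2 x2 by auto
      have G: "?G = cheapest_basis (indep_sets I) (cost s) {b \<in> boxes I. nmem ?\<sigma>3 ''p'' 0 b \<le> nmem ?\<sigma>3 ''t'' 0 0}"
        unfolding t3 static(5)[OF ag3] prefix prefix_basis_def ..
      show "WP Stop_step (\<lambda>\<sigma>'. ?R2 s (Suc x) (nwrite ''x'' 0 0 (Suc (nmem \<sigma>' ''x'' 0 0)) \<sigma>')) \<sigma>2"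
        unfolding Stop_step_def
      proof (rule wp_Seq, rule wp_NSet, rule wp_Seq,
          rule wp_mono[OF wp_Basis_of_prefix[OF static(1)[OF ag3] s3(1) s G]])
        let ?B = "{''h'', ''count'', ''val'', ''u'', ''v'', ''q'', ''b'', ''c''}"
        fix \<sigma>4 assume 4: "agree ?B ?\<sigma>3 \<sigma>4 \<and> (\<forall>b\<in>boxes I. nmem \<sigma>4 ''h'' 0 b = of_bool (b \<in> ?G)) \<and>
          nmem \<sigma>4 ''count'' 0 0 = card ?G \<and> rmem \<sigma>4 ''val'' 0 0 = sum (cost s) ?G"
        then have ag34: "agree ?B ?\<sigma>3 \<sigma>4" by blast
        have ag4: "agree ?A \<sigma> \<sigma>4" by (rule agree_trans[OF ag3 ag34]) auto
        have vars: "nmem \<sigma>4 ''t'' 0 0 = t" "nmem \<sigma>4 ''s'' 0 0 = s" "nmem \<sigma>4 ''x'' 0 0 = x"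
          "nmem \<sigma>4 ''stop'' = nmem \<sigma>2 ''stop''" "nmem \<sigma>4 ''select'' = nmem \<sigma>2 ''select''"
          using agree_nmem[OF ag34] t3 s3 by (simp_all add: fun_eq_iff)
        have rows4: "\<forall>u<s. row (n + 1) \<sigma>4 u" "0 < x \<Longrightarrow> row x \<sigma>4 s"
          using old row_cong[of \<sigma>4 _ \<sigma>2] vars(4,5) by auto
        \<comment> \<open>The program tests only \<open>k \<le> count\<close>; this bound makes it a
          test for equality.\<close>
        have card_le: "card ?G \<le> k"
          using indep_cheapest_basis[of "set (take t xs)"] rank_le_rank_carrier k_eq
          by (simp add: prefix_basis_def)
        let ?c = "Or (NLess (Var ''x'') (Const 1)) (Conj (NLe (Var ''k'') (Var ''count''))
                     (RLe (RGet ''val'' (Const 0) (Const 0)) (OfNat (Var ''t''))))"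
        have cond: "bval ?c \<sigma>4 \<longleftrightarrow> may_stop I xs s t"
        proof -
          \<comment> \<open>As \<open>n\<close> is positive, only the first attempt has
            \<open>t = n\<close>; there the program records a stop unconditionally.\<close>
          have "n \<le> t \<longleftrightarrow> x = 0" using k_le_n rank_pos x by (auto simp: t_def)
          then show ?thesis using 4 vars static(4)[OF ag4] card_le by (auto simp: may_stop_def not_less)
        qed
        have range: "n + 1 - Suc x = t" "n + 1 - x = Suc t" using x by (auto simp: t_def)
        show "WP (Cond ?c
           (Seq (NSet ''stop'' (Var ''s'') (Const 0) (Var ''t''))
             (For_boxes ''b'' (NSet ''select'' (Var ''s'') (Var ''b'') (NGet ''h'' (Const 0) (Var ''b'')))))
           Skip) (\<lambda>\<sigma>'. ?R2 s (Suc x) (nwrite ''x'' 0 0 (Suc (nmem \<sigma>' ''x'' 0 0)) \<sigma>')) \<sigma>4"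
        proof (rule wp_Cond, unfold cond)
          assume no: "\<not> may_stop I xs s t"
          have "0 < x" using no by (auto simp: may_stop_def t_def)
          with rows4 have "row x \<sigma>4 s" by blast
          moreover have "u = t \<or> u \<in> {Suc t..<T}" if "u \<in> {t..<T}" for u T using that by auto
          ultimately have "row (Suc x) \<sigma>4 s"
            using no unfolding row_def range by (auto simp only: atLeastAtMost_iff Suc_leD)
          then have "row (Suc x) (nwrite ''x'' 0 0 (Suc x) \<sigma>4) s"
            "\<forall>u<s. row (n + 1) (nwrite ''x'' 0 0 (Suc x) \<sigma>4) u"
            using rows4 row_cong[of \<sigma>4 _ "nwrite ''x'' 0 0 (Suc x) \<sigma>4"] by (simp_all add: fun_eq_iff)
          then show "WP Skip (\<lambda>\<sigma>'. ?R2 s (Suc x) (nwrite ''x'' 0 0 (Suc (nmem \<sigma>' ''x'' 0 0)) \<sigma>')) \<sigma>4"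
            using ag4 vars by (intro wp_Skip) (simp add: agree_nwrite)
        next
          assume yes: "may_stop I xs s t"
          let ?\<sigma>5 = "nwrite ''stop'' (nval (Var ''s'') \<sigma>4) (nval (Const 0) \<sigma>4) (nval (Var ''t'') \<sigma>4) \<sigma>4"
          let ?R3 = "\<lambda>b \<sigma>'. agree {''select'', ''b''} ?\<sigma>5 \<sigma>' \<and> nmem \<sigma>' ''b'' 0 0 = b \<and>
            (\<forall>u. u \<noteq> s \<longrightarrow> nmem \<sigma>' ''select'' u = nmem \<sigma>4 ''select'' u) \<and>
            (\<forall>c\<in>{1..<b}. nmem \<sigma>' ''select'' s c = nmem \<sigma>4 ''h'' 0 c)"
          have static5: "nmem \<sigma>' ''boxes'' 0 0 = n" "nmem \<sigma>' ''s'' 0 0 = s" "nmem \<sigma>' ''x'' 0 0 = x"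
            "nmem \<sigma>' ''h'' 0 c = nmem \<sigma>4 ''h'' 0 c" "nmem \<sigma>' ''stop'' u 0 = (if u = s then t else nmem \<sigma>4 ''stop'' u 0)"
            "agree ?A \<sigma> \<sigma>'"
            if that: "agree {''select'', ''b''} ?\<sigma>5 \<sigma>'" for \<sigma>' c u
          proof -
            show "agree ?A \<sigma> \<sigma>'" by (rule agree_trans[OF _ that]) (auto intro!: agree_nwrite ag4)
          qed (use agree_nmem[OF that] static(2)[OF ag4] vars in simp_all)
          show "WP (Seq (NSet ''stop'' (Var ''s'') (Const 0) (Var ''t''))
             (For_boxes ''b'' (NSet ''select'' (Var ''s'') (Var ''b'') (NGet ''h'' (Const 0) (Var ''b'')))))
             (\<lambda>\<sigma>'. ?R2 s (Suc x) (nwrite ''x'' 0 0 (Suc (nmem \<sigma>' ''x'' 0 0)) \<sigma>')) \<sigma>4"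
          proof (rule wp_Seq, rule wp_NSet, rule wp_For_boxes[where R = ?R3])
            show "?R3 1 (nwrite ''b'' 0 0 1 ?\<sigma>5)" by (auto intro!: agree_nwrite agree_refl)
          next
            fix b \<sigma>6 assume b: "1 \<le> b" "b < Suc n" and R3: "?R3 b \<sigma>6"
            then have ag6: "agree {''select'', ''b''} ?\<sigma>5 \<sigma>6" and b6: "nmem \<sigma>6 ''b'' 0 0 = b" by auto
            let ?\<sigma>7 = "nwrite ''b'' 0 0 (Suc b) (nwrite ''select'' s b (nmem \<sigma>4 ''h'' 0 b) \<sigma>6)"
            have "agree {''select'', ''b''} ?\<sigma>5 ?\<sigma>7" by (intro agree_nwrite ag6) auto
            moreover have "\<forall>u. u \<noteq> s \<longrightarrow> nmem ?\<sigma>7 ''select'' u = nmem \<sigma>4 ''select'' u"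
              using R3 by (auto simp: fun_eq_iff)
            moreover have "\<forall>c\<in>{1..<Suc b}. nmem ?\<sigma>7 ''select'' s c = nmem \<sigma>4 ''h'' 0 c"
              using R3 by (auto simp: less_Suc_eq)
            ultimately have "?R3 (Suc b) ?\<sigma>7" by simp
            then show "WP (NSet ''select'' (Var ''s'') (Var ''b'') (NGet ''h'' (Const 0) (Var ''b'')))
                (\<lambda>\<sigma>'. ?R3 (Suc b) (nwrite ''b'' 0 0 (Suc (nmem \<sigma>' ''b'' 0 0)) \<sigma>')) \<sigma>6"
              using static5[OF ag6] b6 by (intro wp_NSet) simp
          next
            fix \<sigma>6 assume R3: "?R3 (Suc n) \<sigma>6"
            then have ag6: "agree {''select'', ''b''} ?\<sigma>5 \<sigma>6" by blast
            have "{1..<Suc n} = boxes I" by (auto simp: boxes_def)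
            then have h: "\<forall>c\<in>boxes I. nmem \<sigma>6 ''select'' s c = of_bool (c \<in> ?G)" using R3 4 by simp
            have "?G \<subseteq> boxes I"
              unfolding G using cheapest_basis_subset by blast
            then have "?sel \<sigma>6 s = ?G" using h by auto
            then have "row (Suc x) \<sigma>6 s" using static5(5)[OF ag6, of s] yes range by (simp add: row_def t_def)
            moreover have "row (n + 1) \<sigma>6 u" if "u < s" for u
            proof -
              have "row (n + 1) \<sigma>4 u" using rows4 that by blast
              then show ?thesis using R3 that static5(5)[OF ag6, of u] by (simp add: row_def)
            qed
            moreover have "row y (nwrite ''x'' 0 0 (Suc x) \<sigma>6) u \<longleftrightarrow> row y \<sigma>6 u" for y u
              by (rule row_cong) (simp_all add: fun_eq_iff)
            ultimately show "?R2 s (Suc x) (nwrite ''x'' 0 0 (Suc (nmem \<sigma>6 ''x'' 0 0)) \<sigma>6)"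
              using static5[OF ag6] by (simp add: agree_nwrite)
          next
            fix b \<sigma>6 assume "?R3 b \<sigma>6"
            then show "nmem \<sigma>6 ''b'' 0 0 = b \<and> nval (NPlus (Var ''boxes'') (Const 1)) \<sigma>6 = Suc n"
              using static5 by auto
          qed
        qed
      qed
    next
      fix \<sigma>2 assume R2: "?R2 s (Suc n) \<sigma>2"
      have last: "row (Suc n) \<sigma>2 s" using R2 by blast
      have "row y (nwrite ''s'' 0 0 (Suc s) \<sigma>2) u \<longleftrightarrow> row y \<sigma>2 u" for y u
        by (rule row_cong) (simp_all add: fun_eq_iff)
      then show "?R1 (Suc s) (nwrite ''s'' 0 0 (Suc (nmem \<sigma>2 ''s'' 0 0)) \<sigma>2)"
        using R2 last by (simp add: agree_nwrite less_Suc_eq)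
    next
      fix x \<sigma>2 assume "?R2 s x \<sigma>2"
      then show "nmem \<sigma>2 ''x'' 0 0 = x \<and> nval (NPlus (Var ''boxes'') (Const 1)) \<sigma>2 = Suc n"
        using static by auto
    qed
  next
    fix \<sigma>1 assume R1: "?R1 m \<sigma>1"
    have "nmem \<sigma>1 ''stop'' s 0 = first_stop I xs s" if "s < m" for s
    proof -
      have row: "row (n + 1) \<sigma>1 s" using R1 that by blast
      then show ?thesis
        unfolding first_stop_def by (intro Least_equality[symmetric]) (auto simp: row_def not_less[symmetric])
    qed
    moreover have "?sel \<sigma>1 s = prefix_basis I xs s (nmem \<sigma>1 ''stop'' s 0)" if "s < m" for s
      using R1 that by (simp add: row_def)
    ultimately show "nmem \<sigma>1 ''order'' = nmem \<sigma> ''order'' \<and> (\<forall>s<m. nmem \<sigma>1 ''stop'' s 0 = first_stop I xs s \<and>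
      ?sel \<sigma>1 s = prefix_basis I xs s (first_stop I xs s))"
      using static(6) R1 by simp
  next
    fix s \<sigma>1 assume "?R1 s \<sigma>1"
    then show "nmem \<sigma>1 ''s'' 0 0 = s \<and> nval (Var ''scenarios'') \<sigma>1 = m" using static by auto
  next
    show "?R1 0 (nwrite ''s'' 0 0 0 \<sigma>)" by (auto intro!: agree_nwrite agree_refl)
  qed
qed

end

section \<open>Correctness and running time of the whole program\<close>

definition Search :: com where
  "Search = Seq Prepare (Seq Order Stops)"

lemma (in search) wp_Search:
  assumes k: "2 \<le> k"
  shows "WP Search (\<lambda>\<sigma>. output_strategy I \<sigma> \<in> pa_strategies I \<and>
    expected_total_cost I (return_pmf (output_strategy I \<sigma>)) \<le> 1100 * ln (real k) * pa_opt I)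
    (input_memory I)"
  unfolding Search_def
proof (rule wp_Seq, rule wp_mono[OF wp_Prepare])
  show "input_ok (input_memory I)" by (simp add: input_ok_def input_memory_def)
next
  fix \<sigma>1 assume 1: "prepared \<sigma>1 \<and> nmem \<sigma>1 ''p'' = nmem (input_memory I) ''p''"
  then have p0: "nmem \<sigma>1 ''p'' 0 b = 0" for b by (simp add: input_memory_def)
  let ?\<alpha> = "nmem \<sigma>1 ''alpha'' 0 0"
  show "WP (Seq Order Stops) (\<lambda>\<sigma>. output_strategy I \<sigma> \<in> pa_strategies I \<and>
    expected_total_cost I (return_pmf (output_strategy I \<sigma>)) \<le> 1100 * ln (real k) * pa_opt I) \<sigma>1"
  proof (rule wp_Seq, rule wp_mono[OF wp_Order[OF conjunct1[OF 1] p0]])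
    fix \<sigma>2 assume 2: "prepared \<sigma>2 \<and> nmem \<sigma>2 ''alpha'' 0 0 = ?\<alpha> \<and> (\<exists>xs. greedy_order I ?\<alpha> xs \<and>
      (\<forall>j<n. nmem \<sigma>2 ''order'' j 0 = xs ! j \<and> nmem \<sigma>2 ''p'' 0 (xs ! j) = Suc j))"
    then obtain xs where greedy: "greedy_order I ?\<alpha> xs"
      and order: "\<And>j. j < n \<Longrightarrow> nmem \<sigma>2 ''order'' j 0 = xs ! j"
        "\<And>j. j < n \<Longrightarrow> nmem \<sigma>2 ''p'' 0 (xs ! j) = Suc j" by blast
    have factor: "16 * pot (k * k) (k * k) \<le> ?\<alpha> * (k * k)" "?\<alpha> * (k * k) \<le> 16 * pot (k * k) (k * k) + 16 * (k * k)"
      using 1 by (auto simp: prepared_def)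
    interpret greedy_search I ?\<alpha> xs
      by unfold_locales (use greedy factor in auto)
    show "WP Stops (\<lambda>\<sigma>. output_strategy I \<sigma> \<in> pa_strategies I \<and>
      expected_total_cost I (return_pmf (output_strategy I \<sigma>)) \<le> 1100 * ln (real k) * pa_opt I) \<sigma>2"
    proof (rule wp_mono[OF wp_Stops[OF conjunct1[OF 2] xs(1,2) order(2)]])
      fix \<sigma>3 :: memory assume 3: "nmem \<sigma>3 ''order'' = nmem \<sigma>2 ''order'' \<and>
        (\<forall>s<m. nmem \<sigma>3 ''stop'' s 0 = first_stop I xs s \<and>
          {i \<in> boxes I. nmem \<sigma>3 ''select'' s i \<noteq> 0} = prefix_basis I xs s (first_stop I xs s))"
      let ?\<pi> = "output_strategy I \<sigma>3"
      have order3: "nmem \<sigma>3 ''order'' j 0 = xs ! j" if "j < n" for j using 3 order(1)[OF that] by simp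
      have stop3: "nmem \<sigma>3 ''stop'' s 0 = first_stop I xs s"
        "{i \<in> boxes I. nmem \<sigma>3 ''select'' s i \<noteq> 0} = prefix_basis I xs s (first_stop I xs s)"
        if "s < m" for s using 3 that by blast+
      note \<pi> = table_strategy[OF xs(1,2) order3 stop3]
      have le: "expected_total_cost I (return_pmf ?\<pi>) \<le> 11 * (real ?\<alpha> + 2) * pa_opt I"
        by (rule table_strategy_cost_le[OF \<pi>])
      \<comment> \<open>Nonnegativity allows the factor to be replaced by a larger one.\<close>
      have "0 \<le> pa_opt I"
        by (rule le_pa_opt) (use \<pi>(1) bounds_scenario_average_cost(1) in auto)
      then have "11 * (real ?\<alpha> + 2) * pa_opt I \<le> 1100 * ln (real k) * pa_opt I"
        by (intro mult_right_mono phase_factor_le_ln[OF k factor(2)])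
      then show "?\<pi> \<in> pa_strategies I \<and>
          expected_total_cost I (return_pmf ?\<pi>) \<le> 1100 * ln (real k) * pa_opt I"
        using \<pi>(1) le by linarith
    qed
  qed
qed

text \<open>The program is fixed, so its time bound is a fixed polynomial in the loop bound, and the
  loop bound is at most quadratic in \<open>n + m\<close>.\<close>

lemma time_bound_Search_polynomial:
  "\<exists>a d. \<forall>I. search_problem I \<longrightarrow> 2 \<le> instance_rank I \<longrightarrow>
    time_bound (search.loop_bound I) Search \<le> a * (num_boxes I + num_scenarios I) ^ d + a"
proof -
  obtain a d where bound: "\<And>B. time_bound B Search \<le> a * B ^ d + a"
    using time_bound_polynomial by blast
  show ?thesis
  proof (rule exI[of _ "a * 4 ^ d"], rule exI[of _ "2 * d"], intro allI impI)
    fix I assume I: "search_problem I" and k: "2 \<le> instance_rank I"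
    interpret search I by unfold_locales (use I k in auto)
    let ?N = "n + m"
    have "1 \<le> ?N" using m_pos by simp
    from mult_le_mono[OF this this] have "1 \<le> ?N * ?N" by simp
    moreover have "?N \<le> ?N * ?N" by (rule le_square)
    moreover have "n * n \<le> ?N * ?N" by (intro mult_le_mono) auto
    \<comment> \<open>One square each for \<open>n * n\<close> and \<open>n + m\<close>, and two for
      the constant 2.\<close>
    ultimately have "loop_bound \<le> 4 * ?N\<^sup>2" unfolding loop_bound_def power2_eq_square by linarith
    then have "loop_bound ^ d \<le> 4 ^ d * ?N ^ (2 * d)"
      using power_mono[of loop_bound "4 * ?N\<^sup>2" d] by (simp add: power_mult_distrib power_mult)
    then have "a * loop_bound ^ d + a \<le> a * 4 ^ d * ?N ^ (2 * d) + a * 4 ^ d"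
      by (intro add_mono) (simp_all add: mult.assoc)
    then show "time_bound loop_bound Search \<le> a * 4 ^ d * ?N ^ (2 * d) + a * 4 ^ d"
      using bound[of loop_bound] by linarith
  qed
qed

theorem mainTheorem9:
  shows "\<exists>C :: real. \<exists>P :: com. \<exists>a d :: nat.
    \<forall>I. search_problem I \<longrightarrow> 2 \<le> instance_rank I \<longrightarrow>
      (\<exists>Q \<in> randomized_pa_strategies I.
         computes_strategy_within P I (a * (num_boxes I + num_scenarios I) ^ d + a) Q \<and>
         expected_total_cost I Q \<le> C * ln (real (instance_rank I)) * pa_opt I)"
proof -
  obtain a d where time: "\<And>I. search_problem I \<Longrightarrow> 2 \<le> instance_rank I \<Longrightarrow>
    time_bound (search.loop_bound I) Search \<le> a * (num_boxes I + num_scenarios I) ^ d + a"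
    using time_bound_Search_polynomial by blast
  show ?thesis
  proof (rule exI[of _ 1100], rule exI[of _ Search], rule exI[of _ a], rule exI[of _ d], intro allI impI)
    fix I assume I: "search_problem I" and k: "2 \<le> instance_rank I"
    let ?T = "a * (num_boxes I + num_scenarios I) ^ d + a"
    interpret search I by unfold_locales (use I k in auto)
    obtain \<sigma> t where t: "t \<le> time_bound loop_bound Search"
      "nsteps (rank_oracle I) t Search (input_memory I) Skip \<sigma>"
      and \<sigma>: "output_strategy I \<sigma> \<in> pa_strategies I"
        "expected_total_cost I (return_pmf (output_strategy I \<sigma>)) \<le> 1100 * ln (real k) * pa_opt I"
      using wp_Search[OF k] unfolding wp_def by blast
    have "steps (rank_oracle I) ?T Search (input_memory I) = return_pmf (Skip, \<sigma>)"
      by (rule steps_if_nsteps[OF t(2) order_trans[OF t(1) time[OF I k]]])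
    then have "computes_strategy_within Search I ?T (return_pmf (output_strategy I \<sigma>))"
      by (simp add: computes_strategy_within_def)
    moreover have "return_pmf (output_strategy I \<sigma>) \<in> randomized_pa_strategies I"
      using \<sigma>(1) by (simp add: randomized_pa_strategies_def)
    ultimately show "\<exists>Q \<in> randomized_pa_strategies I. computes_strategy_within Search I ?T Q \<and>
         expected_total_cost I Q \<le> 1100 * ln (real (instance_rank I)) * pa_opt I"
      using \<sigma>(2) by blast
  qed
qed

end
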